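(* Let $k \geq 2$ and $b \geq 3$ be integers, and suppose that $d_1, d_2 \in \{0,1,\dots,b-1\}$ are distinct and coprime. Let $\mathcal{S}$ be the set of non-negative integers, all of whose digits in base $b$ are either $d_1$ or $d_2$. Then every sufficiently large integer is a sum of at most $b^{160k^2}$ numbers of the form $x^k$ with $x \in \mathcal{S}$.
   Context: Coprime means $\gcd(d_1,d_2)=1$ (so if one of the digits is $0$ the other is $1$). By convention $0 \in \mathcal{S}$. Summands may be repeated. "Sufficiently large" may depend on $k,b,d_1,d_2$. *)

theory Defs
  imports Main
begin

text \<open>
  The digit of \<open>n\<close> in base \<open>b\<close> at position \<open>i\<close> is \<open>n div b ^ i mod b\<close>. The guard
  \<open>b ^ i \<le> n\<close> restricts to the positions that occur in the expansion of \<open>n\<close>, so that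
  leading zeros do not count as digits. No position occurs for \<open>n = 0\<close>, which makes \<open>0\<close> a
  member of \<open>restricted_digits b D\<close> for every \<open>D\<close>, as is the convention.
\<close>

definition restricted_digits :: "nat \<Rightarrow> nat set \<Rightarrow> nat set" where
  "restricted_digits b D = {n. \<forall>i. b ^ i \<le> n \<longrightarrow> n div b ^ i mod b \<in> D}"

end

theory Submission
  imports Defs "HOL-Analysis.Analysis"
begin

text \<open>
  Differencing: cut the digit positions into \<open>k\<close> classes modulo \<open>k\<close>, so that an element of \<open>\<S>\<close> with
  \<open>m * k\<close> digits is a constant plus a sum of \<open>k\<close> independent variables. Applying the Cauchy--Schwarz
  inequality once in each variable, the \<open>2 ^ k\<close>-th power of the normalised exponential sum at \<open>\<theta>\<close> is at most
  the average of \<open>e(M \<theta> h\<^sub>1 \<dots> h\<^sub>k)\<close>, where each \<open>h\<^sub>j\<close> has independent digits \<open>-1, 0, 1\<close> in base \<open>B = b ^ k\<close>.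

  Inverse theorem: if that average is at least \<open>(1/2) ^ y\<close>, then \<open>M \<theta>\<close> is within \<open>B ^ (O(y) - k * m)\<close> of a
  rational number with denominator \<open>B ^ O(y)\<close>. The variables are treated one at a time. Varying only the
  digits in a short window of one variable, the pigeonhole principle gives \<open>q < B ^ w\<close> with \<open>q * B ^ t * \<theta>\<close>
  close to an integer. This holds for every position \<open>t\<close> of the window, and the resulting
  fractions at consecutive positions must agree, which yields an approximation of \<open>\<theta>\<close> of full
  strength, without logarithmic losses.

  Consequently a high moment of the exponential sum is of the expected order \<open>B ^ (-k * m)\<close>. A larger
  moment kills everything except the \<open>\<theta>\<close> at which the sum is almost \<open>1\<close>; these are so close to
  multiples of \<open>1 / M\<close> that the implied constant becomes \<open>b ^ O(k\<^sup>2)\<close>. By Parseval and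
  Cauchy--Schwarz the sums of \<open>s\<close> powers have lower density at least \<open>b ^ (-O(k\<^sup>2))\<close>.
  Adding boundedly many copies of \<open>d1 ^ k\<close> and \<open>d2 ^ k\<close>, which are coprime, produces an initial interval
  of integers, and Schnirelmann's theorem completes the proof.
\<close>

section \<open>Differencing\<close>

text \<open>A set \<open>T\<close> encodes a string of \<open>m\<close> digits 0 and 1, and
  \<open>digit_sum B T\<close> is the number it spells in base \<open>B\<close>;
  \<open>mean m\<close> is the expectation over a uniformly random string.\<close>

definition mean :: "nat \<Rightarrow> (nat set \<Rightarrow> 'a::real_normed_field) \<Rightarrow> 'a" where
  "mean m f = (\<Sum>T\<in>Pow {..<m}. f T) / 2 ^ m"

definition digit_sum :: "nat \<Rightarrow> nat set \<Rightarrow> nat" where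
  "digit_sum B T = (\<Sum>i\<in>T. B ^ i)"

definition unit_exp :: "real \<Rightarrow> complex" where
  "unit_exp x = cis (2 * pi * x)"

lemma mean_const [simp]: "mean m (\<lambda>_. c) = c"
  by (simp add: mean_def card_Pow)

lemma mean_add: "mean m (\<lambda>T. f T + g T) = mean m f + mean m g"
  by (simp add: mean_def sum.distrib add_divide_distrib)

lemma mean_cmult: "mean m (\<lambda>T. c * f T) = c * mean m f"
  by (simp add: mean_def sum_distrib_left)

lemma mean_multc: "mean m (\<lambda>T. f T * c) = mean m f * c"
  by (simp add: mean_def sum_distrib_right)

lemma mean_swap: "mean m (\<lambda>T. mean n (\<lambda>T'. f T T')) = mean n (\<lambda>T'. mean m (\<lambda>T. f T T'))"
  unfolding mean_def sum_divide_distrib[symmetric]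
  by (subst sum.swap) (simp add: divide_divide_eq_left mult.commute)

lemma mean_mono:
  fixes f g :: "nat set \<Rightarrow> real"
  shows "(\<And>T. T \<subseteq> {..<m} \<Longrightarrow> f T \<le> g T) \<Longrightarrow> mean m f \<le> mean m g"
  unfolding mean_def by (intro divide_right_mono sum_mono) auto

lemma mean_nonneg:
  fixes f :: "nat set \<Rightarrow> real"
  shows "(\<And>T. T \<subseteq> {..<m} \<Longrightarrow> 0 \<le> f T) \<Longrightarrow> 0 \<le> mean m f"
  using mean_mono[of m "\<lambda>_. 0" f] by simp

lemma mean_of_real: "mean m (\<lambda>T. of_real (f T)) = of_real (mean m f)"
  by (simp add: mean_def)

lemma norm_mean_le: "norm (mean m f) \<le> mean m (\<lambda>T. norm (f T))"
  unfolding mean_def by (auto simp: norm_divide norm_power intro!: divide_right_mono norm_sum)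

text \<open>The variance of \<open>f\<close> is nonnegative.\<close>

lemma square_mean_le:
  fixes f :: "nat set \<Rightarrow> real"
  shows "(mean m f)\<^sup>2 \<le> mean m (\<lambda>T. (f T)\<^sup>2)"
proof -
  have "0 \<le> mean m (\<lambda>T. (f T - mean m f)\<^sup>2)"
    by (intro mean_nonneg) auto
  also have "(\<lambda>T. (f T - mean m f)\<^sup>2) =
      (\<lambda>T. (f T)\<^sup>2 + ((- 2 * mean m f) * f T + (mean m f)\<^sup>2))"
    by (auto simp: power2_diff)
  also have "mean m \<dots> = mean m (\<lambda>T. (f T)\<^sup>2) - (mean m f)\<^sup>2"
    unfolding mean_add mean_cmult by (simp add: power2_eq_square)
  finally show ?thesis by simp
qed

lemma power_mean_le:
  fixes f :: "nat set \<Rightarrow> real"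
  assumes "\<And>T. T \<subseteq> {..<m} \<Longrightarrow> 0 \<le> f T"
  shows "(mean m f) ^ (2 ^ j) \<le> mean m (\<lambda>T. f T ^ (2 ^ j))"
proof (induction j)
  case (Suc j)
  have "(mean m f) ^ (2 ^ Suc j) = ((mean m f) ^ (2 ^ j))\<^sup>2"
    by (simp add: power_mult[symmetric] mult.commute)
  also have "\<dots> \<le> (mean m (\<lambda>T. f T ^ (2 ^ j)))\<^sup>2"
    using Suc assms by (intro power_mono zero_le_power mean_nonneg)
  also have "\<dots> \<le> mean m (\<lambda>T. (f T ^ (2 ^ j))\<^sup>2)"
    by (rule square_mean_le)
  finally show ?case by (simp add: power_mult[symmetric] mult.commute)
qed auto

lemma unit_exp_add: "unit_exp (x + y) = unit_exp x * unit_exp y"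
  by (simp add: unit_exp_def cis_mult distrib_left)

lemma norm_unit_exp [simp]: "norm (unit_exp x) = 1"
  by (simp add: unit_exp_def)

lemma unit_exp_diff: "unit_exp (x - y) = unit_exp x * cnj (unit_exp y)"
  by (simp add: unit_exp_def cis_cnj cis_mult algebra_simps)

lemma Re_unit_exp: "Re (unit_exp x) = cos (2 * pi * x)"
  by (simp add: unit_exp_def)

lemma Re_mean: "Re (mean m f) = mean m (\<lambda>T. Re (f T))"
  unfolding mean_def by (simp add: Re_divide_of_real[of _ "2^m", simplified])

lemma cnj_mean: "cnj (mean m f) = mean m (\<lambda>T. cnj (f T))"
  by (simp add: mean_def)

lemma norm_mean_square:
  fixes f :: "nat set \<Rightarrow> complex"
  shows "of_real ((norm (mean m f))\<^sup>2) = mean m (\<lambda>T. mean m (\<lambda>T'. f T * cnj (f T')))"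
  by (simp add: mean_cmult mean_multc complex_norm_square cnj_mean[symmetric] del: of_real_power)

text \<open>The expectation of \<open>g\<close> at the random point
  \<open>(\<Sum>i<j. c i * digit_sum B (T i))\<close> with independent strings \<open>T i\<close>.
  The recursion keeps the variables separate, so that Cauchy-Schwarz can be applied to the last one
  alone.\<close>

fun mean_shift :: "(nat \<Rightarrow> real) \<Rightarrow> nat \<Rightarrow> nat \<Rightarrow> nat \<Rightarrow> (real \<Rightarrow> 'a::real_normed_field) \<Rightarrow> 'a" where
  "mean_shift c B m 0 g = g 0"
| "mean_shift c B m (Suc j) g =
     mean m (\<lambda>T. mean_shift c B m j (\<lambda>x. g (x + c j * real (digit_sum B T))))"

lemma mean_shift_mean:
  "mean_shift c B m j (\<lambda>x. mean n (\<lambda>T. g T x)) = mean n (\<lambda>T. mean_shift c B m j (g T))"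
proof (induction j arbitrary: g)
  case (Suc j)
  then show ?case by (simp add: mean_swap[of m n])
qed auto

lemma mean_shift_of_real:
  "mean_shift c B m j (\<lambda>x. of_real (g x)) = of_real (mean_shift c B m j g)"
  by (induction j arbitrary: g) (auto simp: mean_of_real)

lemma norm_mean_shift_square_le:
  fixes g :: "real \<Rightarrow> complex"
  shows "(norm (mean_shift c B m j g))\<^sup>2 \<le> mean_shift c B m j (\<lambda>x. (norm (g x))\<^sup>2)"
proof (induction j arbitrary: g)
  case (Suc j)
  have "(norm (mean_shift c B m (Suc j) g))\<^sup>2 \<le>
     (mean m (\<lambda>T. norm (mean_shift c B m j (\<lambda>x. g (x + c j * real (digit_sum B T))))))\<^sup>2"
    by (auto intro!: power_mono norm_mean_le)
  also have "\<dots> \<le> mean m (\<lambda>T. (norm (mean_shift c B m j (\<lambda>x. g (x + c j * real (digit_sum B T)))))\<^sup>2)"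
    by (rule square_mean_le)
  also have "\<dots> \<le> mean_shift c B m (Suc j) (\<lambda>x. (norm (g x))\<^sup>2)"
    using Suc.IH by (auto intro!: mean_mono)
  finally show ?case .
qed auto

text \<open>\<open>poly_lead j a g\<close> says that \<open>g\<close> is a polynomial function of degree at most \<open>j\<close> whose
  coefficient at \<open>x ^ j\<close> is \<open>a / fact j\<close>.\<close>

fun poly_lead :: "nat \<Rightarrow> real \<Rightarrow> (real \<Rightarrow> real) \<Rightarrow> bool" where
  "poly_lead 0 a g = (\<forall>x. g x = a)"
| "poly_lead (Suc j) a g = (\<forall>h h'. poly_lead j (a * (h - h')) (\<lambda>x. g (x + h) - g (x + h')))"

lemma poly_lead_add: "poly_lead j a g \<Longrightarrow> poly_lead j a' g' \<Longrightarrow> poly_lead j (a + a') (\<lambda>x. g x + g' x)"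
proof (induction j arbitrary: a a' g g')
  case (Suc j)
  show ?case
    unfolding poly_lead.simps
  proof (intro allI)
    fix h h'
    have "poly_lead j (a * (h - h') + a' * (h - h'))
        (\<lambda>x. (g (x + h) - g (x + h')) + (g' (x + h) - g' (x + h')))"
      using Suc.prems by (intro Suc.IH) auto
    then show "poly_lead j ((a + a') * (h - h')) (\<lambda>x. g (x + h) + g' (x + h) - (g (x + h') + g' (x + h')))"
      by (simp add: algebra_simps)
  qed
qed auto

lemma poly_lead_scale: "poly_lead j a g \<Longrightarrow> poly_lead j (c * a) (\<lambda>x. c * g x)"
proof (induction j arbitrary: a g)
  case (Suc j)
  show ?case
    unfolding poly_lead.simps
  proof (intro allI)
    fix h h'
    have "poly_lead j (c * (a * (h - h'))) (\<lambda>x. c * (g (x + h) - g (x + h')))"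
      using Suc.prems by (intro Suc.IH) auto
    then show "poly_lead j (c * a * (h - h')) (\<lambda>x. c * g (x + h) - c * g (x + h'))"
      by (simp add: algebra_simps)
  qed
qed auto

lemma poly_lead_shift: "poly_lead j a g \<Longrightarrow> poly_lead j a (\<lambda>x. g (x + t))"
proof (induction j arbitrary: a g)
  case (Suc j)
  show ?case
    unfolding poly_lead.simps
  proof (intro allI)
    fix h h'
    have "poly_lead j (a * ((h + t) - (h' + t))) (\<lambda>x. g (x + (h + t)) - g (x + (h' + t)))"
      using Suc.prems by (simp only: poly_lead.simps)
    then show "poly_lead j (a * (h - h')) (\<lambda>x. g (x + h + t) - g (x + h' + t))"
      by (simp add: add.assoc)
  qed
qed auto

text \<open>A Leibniz rule for differences: the difference of the product is
  \<open>x + h + c\<close> times the difference of \<open>g\<close>, plus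
  \<open>(h - h') * g (x + h')\<close>. The induction hypothesis applies to the first term, and the
  second adds one more copy of \<open>a * (h - h')\<close> to the constant.\<close>

lemma poly_lead_times_linear:
  "poly_lead j a g \<Longrightarrow> poly_lead (Suc j) (real (Suc j) * a) (\<lambda>x. (x + c) * g x)"
proof (induction j arbitrary: a g c)
  case (Suc j)
  show ?case
    unfolding poly_lead.simps(2)[of "Suc j"]
  proof (intro allI)
    fix h h'
    have "poly_lead (Suc j) (real (Suc j) * (a * (h - h')))
        (\<lambda>x. (x + (h + c)) * (g (x + h) - g (x + h')))"
      using Suc.prems by (intro Suc.IH) auto
    moreover have "poly_lead (Suc j) ((h - h') * a) (\<lambda>x. (h - h') * g (x + h'))"
      using Suc.prems by (intro poly_lead_scale poly_lead_shift)
    ultimately have "poly_lead (Suc j) (real (Suc j) * (a * (h - h')) + (h - h') * a)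
        (\<lambda>x. (x + (h + c)) * (g (x + h) - g (x + h')) + (h - h') * g (x + h'))"
      by (rule poly_lead_add)
    then show "poly_lead (Suc j) (real (Suc (Suc j)) * a * (h - h'))
        (\<lambda>x. (x + h + c) * g (x + h) - (x + h' + c) * g (x + h'))"
      by (simp add: algebra_simps)
  qed
qed (auto simp: algebra_simps)

lemma poly_lead_power: "poly_lead j (fact j) (\<lambda>x. (x + c) ^ j)"
proof (induction j)
  case (Suc j)
  from poly_lead_times_linear[OF this, of c] show ?case by (simp del: poly_lead.simps)
qed auto

text \<open>The multilinear average that remains once every variable has been differenced: for
  \<open>j \<ge> 1\<close> it is the expectation of \<open>e(\<alpha> * h_1 * ... * h_j)\<close>,
  each \<open>h_i\<close> being a difference of two independent digit sums. The symmetry of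
  \<open>h_i\<close> makes it real, hence the cosine.\<close>

fun box_mean :: "nat \<Rightarrow> nat \<Rightarrow> nat \<Rightarrow> real \<Rightarrow> real" where
  "box_mean B m 0 \<alpha> = cos (2 * pi * \<alpha>)"
| "box_mean B m (Suc j) \<alpha> = mean m (\<lambda>T. mean m (\<lambda>T'.
     box_mean B m j (\<alpha> * (real (digit_sum B T) - real (digit_sum B T')))))"

lemma norm_mean_shift_difference:
  fixes g :: "real \<Rightarrow> real"
  shows "(norm (mean_shift c B m (Suc j) (\<lambda>x. unit_exp (g x))))\<^sup>2 \<le>
    mean m (\<lambda>T. mean m (\<lambda>T'. norm (mean_shift c B m j (\<lambda>x.
      unit_exp (g (x + c j * real (digit_sum B T)) - g (x + c j * real (digit_sum B T')))))))"
proof -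
  let ?h = "\<lambda>T. c j * real (digit_sum B T)"
  let ?G = "\<lambda>T T'. mean_shift c B m j (\<lambda>x. unit_exp (g (x + ?h T) - g (x + ?h T')))"
  have "(norm (mean_shift c B m (Suc j) (\<lambda>x. unit_exp (g x))))\<^sup>2
      = (norm (mean_shift c B m j (\<lambda>x. mean m (\<lambda>T. unit_exp (g (x + ?h T))))))\<^sup>2"
    by (simp add: mean_shift_mean)
  also have "\<dots> \<le> mean_shift c B m j (\<lambda>x. (norm (mean m (\<lambda>T. unit_exp (g (x + ?h T)))))\<^sup>2)"
    by (rule norm_mean_shift_square_le)
  \<comment> \<open>Expanding the square leaves a complex double mean that equals the nonnegative
    real \<open>?r\<close>; taking its norm changes nothing, and the norm can then be moved
    inwards.\<close>
  also have "\<dots> = norm (mean m (\<lambda>T. mean m (\<lambda>T'. ?G T T')))" (is "?r = _")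
  proof -
    have eq: "complex_of_real ?r = mean m (\<lambda>T. mean m (\<lambda>T'. ?G T T'))"
      unfolding mean_shift_of_real[symmetric] norm_mean_square
      by (simp add: mean_shift_mean unit_exp_diff)
    have "0 \<le> ?r"
      by (rule order_trans[OF zero_le_power2 norm_mean_shift_square_le])
    then have "?r = norm (complex_of_real ?r)" by (simp only: norm_of_real abs_of_nonneg)
    then show ?thesis unfolding eq .
  qed
  also have "\<dots> \<le> mean m (\<lambda>T. mean m (\<lambda>T'. norm (?G T T')))"
    by (intro order_trans[OF norm_mean_le] mean_mono norm_mean_le)
  finally show ?thesis .
qed

text \<open>Cauchy-Schwarz is applied once per variable. Each application squares the left side,
  lowers the degree of the phase by one and multiplies its leading constant by some
  \<open>c i\<close> and a difference of digit sums. With one variable left the phase is linear and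
  squaring is exact.\<close>

lemma box_inequality:
  assumes "poly_lead (Suc j) a g"
  shows "norm (mean_shift c B m (Suc j) (\<lambda>x. unit_exp (g x))) ^ (2 ^ Suc j)
    \<le> box_mean B m (Suc j) (a * (\<Prod>i\<le>j. c i))"
  using assms
proof (induction j arbitrary: a g)
  case 0
  let ?h = "\<lambda>T. c 0 * real (digit_sum B T)"
  have g: "g (x + h) - g (x + h') = a * (h - h')" for x h h'
    using 0 by auto
  have "of_real ((norm (mean_shift c B m 1 (\<lambda>x. unit_exp (g x))))\<^sup>2)
     = mean m (\<lambda>T. mean m (\<lambda>T'. unit_exp (g (0 + ?h T) - g (0 + ?h T'))))"
    by (simp add: norm_mean_square unit_exp_diff del: of_real_power)
  also have "\<dots> = mean m (\<lambda>T. mean m (\<lambda>T'. unit_exp (a * (?h T - ?h T'))))"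
    by (simp only: g)
  finally have "Re (of_real ((norm (mean_shift c B m 1 (\<lambda>x. unit_exp (g x))))\<^sup>2)) =
      mean m (\<lambda>T. mean m (\<lambda>T'. cos (2 * pi * (a * (?h T - ?h T')))))"
    by (simp only: Re_mean Re_unit_exp)
  then show ?case by (simp add: algebra_simps power2_eq_square)
next
  case (Suc j)
  let ?h = "\<lambda>T. c (Suc j) * real (digit_sum B T)"
  let ?G = "\<lambda>T T'. norm (mean_shift c B m (Suc j) (\<lambda>x. unit_exp (g (x + ?h T) - g (x + ?h T'))))"
  have IH: "?G T T' ^ (2 ^ Suc j) \<le> box_mean B m (Suc j) (a * (?h T - ?h T') * (\<Prod>i\<le>j. c i))" for T T'
    using Suc.prems unfolding poly_lead.simps(2)[of "Suc j"] by (intro Suc.IH) blast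
  have "norm (mean_shift c B m (Suc (Suc j)) (\<lambda>x. unit_exp (g x))) ^ (2 ^ Suc (Suc j))
      = ((norm (mean_shift c B m (Suc (Suc j)) (\<lambda>x. unit_exp (g x))))\<^sup>2) ^ (2 ^ Suc j)"
    by (simp only: power_mult[symmetric] power_Suc)
  also have "\<dots> \<le> (mean m (\<lambda>T. mean m (\<lambda>T'. ?G T T'))) ^ (2 ^ Suc j)"
    by (intro power_mono norm_mean_shift_difference) auto
  also have "\<dots> \<le> mean m (\<lambda>T. (mean m (\<lambda>T'. ?G T T')) ^ (2 ^ Suc j))"
    by (intro power_mean_le mean_nonneg) auto
  also have "\<dots> \<le> mean m (\<lambda>T. mean m (\<lambda>T'. ?G T T' ^ (2 ^ Suc j)))"
    by (intro mean_mono power_mean_le) auto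
  also have "\<dots> \<le> mean m (\<lambda>T. mean m (\<lambda>T'. box_mean B m (Suc j) (a * (?h T - ?h T') * (\<Prod>i\<le>j. c i))))"
    by (intro mean_mono IH)
  also have "\<dots> = box_mean B m (Suc (Suc j)) (a * (\<Prod>i\<le>Suc j. c i))"
  proof -
    have "a * (?h T - ?h T') * (\<Prod>i\<le>j. c i) =
        a * (\<Prod>i\<le>Suc j. c i) * (real (digit_sum B T) - real (digit_sum B T'))" for T T'
      by (simp add: algebra_simps)
    then show ?thesis
      by (simp only: box_mean.simps(2)[of B m "Suc j"])
  qed
  finally show ?case .
qed

section \<open>Approximation by rationals and the pigeonhole argument\<close>

definition near :: "real \<Rightarrow> real \<Rightarrow> bool" where
  "near \<eta> x \<longleftrightarrow> (\<exists>n::int. \<bar>x - of_int n\<bar> \<le> \<eta>)"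

lemma near_mono: "near \<eta> x \<Longrightarrow> \<eta> \<le> \<eta>' \<Longrightarrow> near \<eta>' x"
  unfolding near_def by (meson order_trans)

lemma near_diff:
  assumes "near \<eta> x" "near \<eta>' y"
  shows "near (\<eta> + \<eta>') (x - y)"
proof -
  obtain n n' where "\<bar>x - of_int n\<bar> \<le> \<eta>" "\<bar>y - of_int n'\<bar> \<le> \<eta>'"
    using assms by (auto simp: near_def)
  then have "\<bar>x - y - of_int (n - n')\<bar> \<le> \<eta> + \<eta>'" by simp
  then show ?thesis unfolding near_def by blast
qed

lemma near_minus: "near \<eta> (- x) \<longleftrightarrow> near \<eta> x"
proof -
  have "near \<eta> x \<Longrightarrow> near \<eta> (- x)" for x
  proof -
    assume "near \<eta> x"
    then obtain n where "\<bar>x - of_int n\<bar> \<le> \<eta>" by (auto simp: near_def)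
    then have "\<bar>- x - of_int (- n)\<bar> \<le> \<eta>" by simp
    then show ?thesis unfolding near_def by blast
  qed
  from this[of x] this[of "- x"] show ?thesis by auto
qed

definition rational_approx :: "nat \<Rightarrow> real \<Rightarrow> real \<Rightarrow> bool" where
  "rational_approx Q \<eta> \<alpha> \<longleftrightarrow> (\<exists>q\<in>{1..Q}. near \<eta> (real q * \<alpha>))"

text \<open>Approximations with small denominators at consecutive scales come from the same fraction,
  since the difference of two distinct such fractions would be too large.\<close>

lemma glue_rational_approx:
  assumes app: "\<And>t. t \<le> n \<Longrightarrow> rational_approx Q \<eta> (real B ^ t * \<theta>)"
    and small: "real Q * \<eta> * (real B + 1) < 1" and B: "B \<ge> 1" and "\<eta> \<ge> 0"
  shows "rational_approx Q (real Q * \<eta> / real B ^ n) \<theta>"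
proof -
  have "\<forall>t. \<exists>q a. t \<le> n \<longrightarrow> q \<in> {1..Q} \<and> \<bar>real q * (real B ^ t * \<theta>) - of_int a\<bar> \<le> \<eta>"
    using app unfolding rational_approx_def near_def by meson
  then obtain q a where
    qa: "\<And>t. t \<le> n \<Longrightarrow> q t \<in> {1..Q} \<and> \<bar>real (q t) * (real B ^ t * \<theta>) - of_int (a t)\<bar> \<le> \<eta>"
    by metis
  define \<epsilon> where "\<epsilon> t = real (q t) * (real B ^ t * \<theta>) - of_int (a t)" for t
  have eps: "\<bar>\<epsilon> t\<bar> \<le> \<eta>" and q: "1 \<le> q t" "q t \<le> Q" if "t \<le> n" for t
    using qa[OF that] by (auto simp: \<epsilon>_def)
  \<comment> \<open>The errors at \<open>t\<close> and \<open>Suc t\<close> combine to the integer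
    \<open>?d\<close>, which is less than 1 in absolute value by \<open>small\<close>. So it
    vanishes: up to the scaling by \<open>B\<close>, the two fractions agree.\<close>
  have step: "real B * real (q (Suc t)) * \<epsilon> t = real (q t) * \<epsilon> (Suc t)" if "Suc t \<le> n" for t
  proof -
    let ?d = "int (q t) * a (Suc t) - int B * int (q (Suc t)) * a t"
    have eq: "of_int ?d = real B * real (q (Suc t)) * \<epsilon> t - real (q t) * \<epsilon> (Suc t)"
      by (simp add: \<epsilon>_def algebra_simps)
    have "\<bar>real B * real (q (Suc t)) * \<epsilon> t - real (q t) * \<epsilon> (Suc t)\<bar>
        \<le> \<bar>real B * real (q (Suc t)) * \<epsilon> t\<bar> + \<bar>real (q t) * \<epsilon> (Suc t)\<bar>" by linarith
    also have "\<dots> \<le> real B * real Q * \<eta> + real Q * \<eta>"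
      unfolding abs_mult using q[of "Suc t"] q[of t] eps[of t] eps[of "Suc t"] that
      by (intro add_mono mult_mono) auto
    also have "\<dots> < 1" using small by (simp add: algebra_simps)
    finally have "\<bar>real_of_int ?d\<bar> < 1" by (simp only: eq)
    then have "?d = 0" by linarith
    then show ?thesis using eq by simp
  qed
  have "real B ^ t * real (q t) * \<epsilon> 0 = real (q 0) * \<epsilon> t" if "t \<le> n" for t
    using that
  proof (induction t)
    case (Suc t)
    have "real (q t) * (real B ^ Suc t * real (q (Suc t)) * \<epsilon> 0)
        = real B * real (q (Suc t)) * (real B ^ t * real (q t) * \<epsilon> 0)" by simp
    also have "\<dots> = real (q 0) * (real B * real (q (Suc t)) * \<epsilon> t)" using Suc by simp
    also have "\<dots> = real (q t) * (real (q 0) * \<epsilon> (Suc t))" using step Suc.prems by simp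
    finally show ?case using q[of t] Suc.prems by simp
  qed auto
  \<comment> \<open>Read at \<open>t = n\<close>, the identity shows that the error at scale 0,
    magnified by \<open>B ^ n\<close>, is still at most \<open>Q * \<eta>\<close>.\<close>
  from arg_cong[OF this[of n], of abs] have "real B ^ n * real (q n) * \<bar>\<epsilon> 0\<bar> = real (q 0) * \<bar>\<epsilon> n\<bar>"
    by (simp add: abs_mult)
  moreover have "real B ^ n * 1 * \<bar>\<epsilon> 0\<bar> \<le> real B ^ n * real (q n) * \<bar>\<epsilon> 0\<bar>"
    using q[of n] by (intro mult_right_mono mult_left_mono) auto
  moreover have "real (q 0) * \<bar>\<epsilon> n\<bar> \<le> real Q * \<eta>"
    using q[of 0] eps[of n] by (intro mult_mono) auto
  ultimately have "\<bar>\<epsilon> 0\<bar> * real B ^ n \<le> real Q * \<eta>" by (simp add: mult.commute)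
  then have "\<bar>\<epsilon> 0\<bar> \<le> real Q * \<eta> / real B ^ n"
    using B by (simp add: pos_le_divide_eq)
  then show ?thesis
    using q[of 0] unfolding rational_approx_def near_def \<epsilon>_def by (intro bexI[of _ "q 0"]) auto
qed

text \<open>An entropy bound modulo 1: \<open>N\<close> bounds the number of pigeonholes and
  \<open>L\<close> the width of each.\<close>

definition labelled :: "real set \<Rightarrow> nat \<Rightarrow> real \<Rightarrow> bool" where
  "labelled \<Omega> N L \<longleftrightarrow> (\<exists>lab :: real \<Rightarrow> int. finite (lab ` \<Omega>) \<and> card (lab ` \<Omega>) \<le> N \<and>
     (\<forall>\<alpha>\<in>\<Omega>. \<forall>\<beta>\<in>\<Omega>. lab \<alpha> = lab \<beta> \<longrightarrow> near L (\<alpha> - \<beta>)))"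

lemma labelled_near: "labelled {\<alpha>. near \<eta> \<alpha>} 1 (2 * \<eta>)"
proof -
  have "card ((\<lambda>_. 0 :: int) ` {\<alpha>. near \<eta> \<alpha>}) \<le> 1"
    using card_mono[of "{0::int}" "(\<lambda>_. 0 :: int) ` {\<alpha>. near \<eta> \<alpha>}"] by auto
  moreover have "finite ((\<lambda>_. 0 :: int) ` {\<alpha>. near \<eta> \<alpha>})"
    by (rule finite_subset[of _ "{0}"]) auto
  ultimately show ?thesis unfolding labelled_def
    using near_diff[of \<eta> _ \<eta>] by (intro exI[of _ "\<lambda>_. 0"]) auto
qed

text \<open>The pigeonhole of \<open>\<alpha>\<close> is its approximating fraction modulo 1. If
  \<open>\<alpha>\<close> and \<open>\<beta>\<close> share \<open>q\<close> and
  \<open>a mod q\<close>, then \<open>q * (\<alpha> - \<beta>)\<close> is within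
  \<open>2 * \<eta>\<close> of a multiple of \<open>q\<close>, and dividing by \<open>q\<close> does
  not increase the error.\<close>

lemma labelled_rational_approx: "labelled {\<alpha>. rational_approx Q \<eta> \<alpha>} (Q\<^sup>2) (2 * \<eta>)"
proof -
  let ?\<Omega> = "{\<alpha>. rational_approx Q \<eta> \<alpha>}"
  have "\<forall>\<alpha>. \<exists>q a. \<alpha> \<in> ?\<Omega> \<longrightarrow> q \<in> {1..Q} \<and> \<bar>real q * \<alpha> - of_int a\<bar> \<le> \<eta>"
    unfolding rational_approx_def near_def by blast
  then obtain q a where
    qa: "\<And>\<alpha>. \<alpha> \<in> ?\<Omega> \<Longrightarrow> q \<alpha> \<in> {1..Q} \<and> \<bar>real (q \<alpha>) * \<alpha> - of_int (a \<alpha>)\<bar> \<le> \<eta>"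
    by metis
  \<comment> \<open>The pair \<open>(q, a mod q)\<close> is coded by the base \<open>Q\<close>
    digits \<open>q - 1\<close> and \<open>a mod q\<close>, so the codes lie below
    \<open>Q ^ 2\<close>.\<close>
  define lab where "lab \<alpha> = int Q * (int (q \<alpha>) - 1) + a \<alpha> mod int (q \<alpha>)" for \<alpha>
  have md: "0 \<le> a \<alpha> mod int (q \<alpha>)" "a \<alpha> mod int (q \<alpha>) < int Q" "1 \<le> q \<alpha>" "q \<alpha> \<le> Q"
    if "\<alpha> \<in> ?\<Omega>" for \<alpha>
    using qa[OF that] pos_mod_bound[of "int (q \<alpha>)" "a \<alpha>"]
    by (auto simp del: pos_mod_bound intro: less_le_trans)
  have "lab ` ?\<Omega> \<subseteq> {0..<int (Q\<^sup>2)}"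
  proof (rule image_subsetI)
    fix \<alpha> assume \<alpha>: "\<alpha> \<in> ?\<Omega>"
    have "int Q * (int (q \<alpha>) - 1) \<le> int Q * (int Q - 1)"
      using md[OF \<alpha>] by (intro mult_left_mono) auto
    moreover have "0 \<le> int Q * (int (q \<alpha>) - 1)"
      using md[OF \<alpha>] by (intro mult_nonneg_nonneg) auto
    moreover have "int (Q\<^sup>2) = int Q * (int Q - 1) + int Q"
      by (simp add: power2_eq_square algebra_simps)
    ultimately show "lab \<alpha> \<in> {0..<int (Q\<^sup>2)}"
      using md(1,2)[OF \<alpha>] unfolding lab_def atLeastLessThan_iff by linarith
  qed
  then have fin: "finite (lab ` ?\<Omega>)" and "card (lab ` ?\<Omega>) \<le> card {0..<int (Q\<^sup>2)}"
    by (rule finite_subset, simp) (rule card_mono, simp, fact)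
  then have cd: "card (lab ` ?\<Omega>) \<le> Q\<^sup>2" by (simp only: card_atLeastLessThan_int diff_zero nat_int)
  have "near (2 * \<eta>) (\<alpha> - \<beta>)" if \<alpha>: "\<alpha> \<in> ?\<Omega>" and \<beta>: "\<beta> \<in> ?\<Omega>" and eq: "lab \<alpha> = lab \<beta>" for \<alpha> \<beta>
  proof -
    have "lab \<gamma> div int Q = int (q \<gamma>) - 1" "lab \<gamma> mod int Q = a \<gamma> mod int (q \<gamma>)"
      if "\<gamma> \<in> ?\<Omega>" for \<gamma>
      using md[OF that] unfolding lab_def by simp_all
    from this[OF \<alpha>] this[OF \<beta>] eq have q: "q \<alpha> = q \<beta>"
      and "a \<alpha> mod int (q \<alpha>) = a \<beta> mod int (q \<alpha>)" by auto
    then have "int (q \<alpha>) dvd a \<alpha> - a \<beta>" by (simp only: mod_eq_dvd_iff)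
    then obtain j where j: "a \<alpha> - a \<beta> = int (q \<alpha>) * j" by (rule dvdE)
    have "real (q \<alpha>) * \<bar>\<alpha> - \<beta> - of_int j\<bar> = \<bar>real (q \<alpha>) * (\<alpha> - \<beta> - of_int j)\<bar>"
      by (simp add: abs_mult)
    also have "real (q \<alpha>) * (\<alpha> - \<beta> - of_int j) =
        (real (q \<alpha>) * \<alpha> - of_int (a \<alpha>)) - (real (q \<beta>) * \<beta> - of_int (a \<beta>))"
      using arg_cong[OF j, of real_of_int] q by (simp add: algebra_simps)
    also have "\<bar>\<dots>\<bar> \<le> 2 * \<eta>" using qa[OF \<alpha>] qa[OF \<beta>] by linarith
    finally have *: "real (q \<alpha>) * \<bar>\<alpha> - \<beta> - of_int j\<bar> \<le> 2 * \<eta>" .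
    have "1 * \<bar>\<alpha> - \<beta> - of_int j\<bar> \<le> real (q \<alpha>) * \<bar>\<alpha> - \<beta> - of_int j\<bar>"
      using md[OF \<alpha>] by (intro mult_right_mono) auto
    from order_trans[OF this *] show ?thesis unfolding near_def by (intro exI[of _ j]) simp
  qed
  then show ?thesis unfolding labelled_def using fin cd by blast
qed

lemma digit_sum_less:
  assumes "B \<ge> 2"
  shows "T \<subseteq> {..<m} \<Longrightarrow> digit_sum B T < B ^ m"
proof -
  assume "T \<subseteq> {..<m}"
  then have "digit_sum B T \<le> digit_sum B {..<m}"
    unfolding digit_sum_def by (intro sum_mono2) auto
  also have "\<dots> < B ^ m"
    unfolding digit_sum_def using assms
  proof (induction m)
    case (Suc m)
    then have "(\<Sum>i<Suc m. B ^ i) < B ^ m + B ^ m" by simp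
    also have "\<dots> = 2 * B ^ m" by simp
    also have "\<dots> \<le> B ^ Suc m" using assms unfolding power_Suc by (intro mult_right_mono) auto
    finally show ?case .
  qed auto
  finally show ?thesis .
qed

lemma digit_sum_inj:
  assumes B: "B \<ge> 2"
  shows "T \<subseteq> {..<m} \<Longrightarrow> T' \<subseteq> {..<m} \<Longrightarrow> digit_sum B T = digit_sum B T' \<Longrightarrow> T = T'"
proof (induction m arbitrary: T T')
  case (Suc m)
  have split: "digit_sum B U = digit_sum B (U - {m}) + (if m \<in> U then B ^ m else 0)"
    if "U \<subseteq> {..<Suc m}" for U
    using finite_subset[OF that] by (cases "m \<in> U") (simp_all add: digit_sum_def sum.remove[of U m])
  have sub: "U - {m} \<subseteq> {..<m}" if "U \<subseteq> {..<Suc m}" for U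
    using that by (auto simp: less_Suc_eq)
  \<comment> \<open>The top digit can be read off from the size, because the lower positions sum to
    less than \<open>B ^ m\<close>.\<close>
  have mem: "m \<in> U \<longleftrightarrow> B ^ m \<le> digit_sum B U" if "U \<subseteq> {..<Suc m}" for U
    unfolding split[OF that] using digit_sum_less[OF B sub[OF that]] by auto
  have iff: "m \<in> T \<longleftrightarrow> m \<in> T'"
    unfolding mem[OF Suc.prems(1)] mem[OF Suc.prems(2)] Suc.prems(3) ..
  have "digit_sum B (T - {m}) = digit_sum B (T' - {m})"
    using Suc.prems(3)[unfolded split[OF Suc.prems(1)] split[OF Suc.prems(2)] iff]
    by (simp only: add_right_cancel)
  then have "T - {m} = T' - {m}"
    by (intro Suc.IH sub Suc.prems)
  with iff show ?case by blast
qed auto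

text \<open>Among the subsets that agree outside the window \<open>{t..<t + w}\<close>, two distinct ones get the same
  label by the pigeonhole principle; their difference is a multiple of \<open>B ^ t\<close>.\<close>

lemma window_pigeonhole:
  assumes B: "B \<ge> 2" and lab: "labelled \<Omega> N L" and tw: "t + w \<le> m"
    and good: "\<rho> * 2 ^ m \<le> real (card {T\<in>Pow {..<m}. \<theta> * real (digit_sum B T) + c \<in> \<Omega>})"
    and N: "real N < \<rho> * 2 ^ w"
  shows "rational_approx (\<Sum>i<w. B ^ i) L (real B ^ t * \<theta>)"
proof -
  let ?z = "\<lambda>T. \<theta> * real (digit_sum B T) + c"
  let ?G = "{T\<in>Pow {..<m}. ?z T \<in> \<Omega>}"
  let ?W = "{t..<t + w}"
  obtain lab :: "real \<Rightarrow> int" where lab: "finite (lab ` \<Omega>)" "card (lab ` \<Omega>) \<le> N"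
     "\<And>\<alpha> \<beta>. \<alpha> \<in> \<Omega> \<Longrightarrow> \<beta> \<in> \<Omega> \<Longrightarrow> lab \<alpha> = lab \<beta> \<Longrightarrow> near L (\<alpha> - \<beta>)"
    using assms(2) unfolding labelled_def by blast
  \<comment> \<open>An injection would bound the number of good sets by \<open>2 ^ (m - w)\<close>
    choices outside the window times \<open>N\<close> labels, which contradicts
    \<open>good\<close>.\<close>
  have "\<not> inj_on (\<lambda>T. (T - ?W, lab (?z T))) ?G"
  proof
    assume inj: "inj_on (\<lambda>T. (T - ?W, lab (?z T))) ?G"
    have "card ?G \<le> card (Pow ({..<m} - ?W) \<times> lab ` \<Omega>)"
      using lab(1) by (intro card_inj_on_le[OF inj]) auto
    also have "\<dots> = 2 ^ (m - w) * card (lab ` \<Omega>)"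
    proof -
      have "card ({..<m} - ?W) = m - w" using tw by (subst card_Diff_subset) auto
      then show ?thesis by (simp add: card_cartesian_product card_Pow)
    qed
    also have "\<dots> \<le> 2 ^ (m - w) * N" using lab(2) by simp
    finally have "real (card ?G) \<le> real (2 ^ (m - w) * N)" by (rule of_nat_mono)
    then have "real (card ?G) \<le> 2 ^ (m - w) * real N" by simp
    also have "\<dots> < 2 ^ (m - w) * (\<rho> * 2 ^ w)" using N by simp
    also have "\<dots> = \<rho> * 2 ^ m" using tw by (simp add: power_add[symmetric])
    finally show False using good by simp
  qed
  then obtain T T' where T: "T \<subseteq> {..<m}" "?z T \<in> \<Omega>" and T': "T' \<subseteq> {..<m}" "?z T' \<in> \<Omega>"
    and ne: "T \<noteq> T'" and out: "T - ?W = T' - ?W" and eq: "lab (?z T) = lab (?z T')"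
    unfolding inj_on_def by auto
  have fin: "finite T" "finite T'" using T(1) T'(1) finite_subset by blast+
  define V where "V U = (\<lambda>i. i - t) ` (U \<inter> ?W)" for U
  have V: "V U \<subseteq> {..<w}" for U by (auto simp: V_def)
  have ds: "digit_sum B U = digit_sum B (U - ?W) + B ^ t * digit_sum B (V U)" if "finite U" for U
  proof -
    have "digit_sum B U = digit_sum B (U - ?W) + digit_sum B (U \<inter> ?W)"
      unfolding digit_sum_def using that
      by (subst sum.union_disjoint[symmetric]) (auto intro!: sum.cong)
    also have "digit_sum B (U \<inter> ?W) = (\<Sum>i\<in>V U. B ^ (t + i))"
      unfolding digit_sum_def V_def by (rule sum.reindex_cong[of "\<lambda>i. i - t", symmetric])
         (auto simp: inj_on_def)
    finally show ?thesis by (simp add: digit_sum_def power_add sum_distrib_left)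
  qed
  have "V T \<noteq> V T'"
  proof
    assume "V T = V T'"
    then have "digit_sum B T = digit_sum B T'" using ds[OF fin(1)] ds[OF fin(2)] out by simp
    with digit_sum_inj[OF B T(1) T'(1)] ne show False by simp
  qed
  then have ne': "digit_sum B (V T) \<noteq> digit_sum B (V T')"
    using digit_sum_inj[OF B V V] by blast
  have le: "digit_sum B (V U) \<le> (\<Sum>i<w. B ^ i)" for U
    unfolding digit_sum_def by (intro sum_mono2 V) auto
  \<comment> \<open>The absolute difference of the two window parts; the lost sign is harmless
    because \<open>near\<close> is symmetric.\<close>
  define q where "q = (if digit_sum B (V T) < digit_sum B (V T') then
    digit_sum B (V T') - digit_sum B (V T) else digit_sum B (V T) - digit_sum B (V T'))"
  have q: "q \<in> {1..(\<Sum>i<w. B ^ i)}"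
    using ne' le[of T] le[of T'] by (auto simp: q_def)
  have "near L (?z T - ?z T')" by (rule lab(3)[OF T(2) T'(2) eq])
  moreover have "?z T - ?z T' = real q * (real B ^ t * \<theta>) \<or> ?z T - ?z T' = - (real q * (real B ^ t * \<theta>))"
    unfolding ds[OF fin(1)] ds[OF fin(2)] out by (auto simp: q_def of_nat_diff algebra_simps)
  ultimately have "near L (real q * (real B ^ t * \<theta>))" by (auto simp: near_minus)
  with q show ?thesis unfolding rational_approx_def by blast
qed

section \<open>From large means to large level sets\<close>

lemma mean_le_threshold:
  fixes f :: "nat set \<Rightarrow> real" and c :: real
  assumes "\<And>T. T \<subseteq> {..<m} \<Longrightarrow> f T \<le> 1"
  defines "p \<equiv> real (card {T\<in>Pow {..<m}. c \<le> f T}) / 2 ^ m"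
  shows "mean m f \<le> p + (1 - p) * c"
proof -
  let ?G = "{T\<in>Pow {..<m}. c \<le> f T}"
  have "(\<Sum>T\<in>Pow {..<m}. f T) = (\<Sum>T\<in>?G. f T) + (\<Sum>T\<in>Pow {..<m} - ?G. f T)"
    by (subst sum.subset_diff[of ?G]) auto
  also have "(\<Sum>T\<in>?G. f T) \<le> (\<Sum>T\<in>?G. 1)" using assms(1) by (intro sum_mono) auto
  also have "(\<Sum>T\<in>Pow {..<m} - ?G. f T) \<le> (\<Sum>T\<in>Pow {..<m} - ?G. c)" by (intro sum_mono) auto
  also have "\<dots> = (2 ^ m - real (card ?G)) * c"
  proof -
    have "card (Pow {..<m} - ?G) = 2 ^ m - card ?G" by (subst card_Diff_subset) (auto simp: card_Pow)
    moreover have "card ?G \<le> card (Pow {..<m})" by (intro card_mono) auto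
    ultimately show ?thesis by (simp add: of_nat_diff card_Pow)
  qed
  finally have "(\<Sum>T\<in>Pow {..<m}. f T) \<le> real (card ?G) + (2 ^ m - real (card ?G)) * c" by simp
  then show ?thesis unfolding mean_def p_def by (simp add: field_simps)
qed

lemma exists_mean_le:
  fixes f :: "nat set \<Rightarrow> real"
  shows "\<exists>T\<subseteq>{..<m}. mean m f \<le> f T"
proof (rule ccontr)
  assume "\<not> ?thesis"
  then have "(\<Sum>T\<in>Pow {..<m}. f T) < (\<Sum>T\<in>Pow {..<m}. mean m f)"
    by (intro sum_strict_mono) auto
  also have "\<dots> = (\<Sum>T\<in>Pow {..<m}. f T)" by (simp add: mean_def card_Pow)
  finally show False by simp
qed

lemma box_mean_le_1: "box_mean B m j \<alpha> \<le> 1"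
proof (induction j arbitrary: \<alpha>)
  case (Suc j)
  have "box_mean B m (Suc j) \<alpha> \<le> mean m (\<lambda>T. mean m (\<lambda>T'. 1))"
    unfolding box_mean.simps using Suc by (intro mean_mono)
  then show ?case by simp
qed auto

text \<open>Freezing the second copy \<open>T'\<close> at a value where the mean over
  \<open>T\<close> is at least its average turns the difference of digit sums into a translate of
  one of them, which produces the shift \<open>c\<close>.\<close>

lemma box_mean_threshold:
  obtains c where "box_mean B m (Suc j) \<theta> \<le>
    (let p = real (card {T\<in>Pow {..<m}. r \<le> box_mean B m j (\<theta> * real (digit_sum B T) + c)}) / 2 ^ m
     in p + (1 - p) * r)"
proof -
  let ?f = "\<lambda>T T'. box_mean B m j (\<theta> * (real (digit_sum B T) - real (digit_sum B T')))"
  obtain T' where "mean m (\<lambda>T'. mean m (\<lambda>T. ?f T T')) \<le> mean m (\<lambda>T. ?f T T')"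
    using exists_mean_le[of m "\<lambda>T'. mean m (\<lambda>T. ?f T T')"] by blast
  then have "box_mean B m (Suc j) \<theta> \<le> mean m (\<lambda>T. ?f T T')"
    unfolding box_mean.simps by (subst mean_swap)
  also have "\<dots> \<le> (let p = real (card {T\<in>Pow {..<m}. r \<le> ?f T T'}) / 2 ^ m in p + (1 - p) * r)"
    unfolding Let_def by (rule mean_le_threshold) (rule box_mean_le_1)
  finally show thesis
    by (intro that[of "- \<theta> * real (digit_sum B T')"]) (simp only: right_diff_distrib mult_minus_left add_uminus_conv_diff)
qed

text \<open>Put \<open>r = (1/2) ^ Suc y\<close>. The mean is at least \<open>2 * r\<close>, and
  values below \<open>r\<close> contribute at most \<open>r\<close>; as all values are at most 1,
  the others have density at least \<open>r\<close>.\<close>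

lemma box_mean_half:
  assumes "(1/2) ^ y \<le> box_mean B m (Suc j) \<theta>"
  obtains c where "(1/2) ^ Suc y * 2 ^ m \<le>
    real (card {T\<in>Pow {..<m}. (1/2) ^ Suc y \<le> box_mean B m j (\<theta> * real (digit_sum B T) + c)})"
proof -
  let ?r = "(1/2) ^ Suc y :: real"
  obtain c where c: "box_mean B m (Suc j) \<theta> \<le>
    (let p = real (card {T\<in>Pow {..<m}. ?r \<le> box_mean B m j (\<theta> * real (digit_sum B T) + c)}) / 2 ^ m
     in p + (1 - p) * ?r)" by (rule box_mean_threshold)
  define p where "p = real (card {T\<in>Pow {..<m}. ?r \<le> box_mean B m j (\<theta> * real (digit_sum B T) + c)}) / 2 ^ m"
  have "0 \<le> p" by (simp add: p_def)
  then have "(1 - p) * ?r \<le> 1 * ?r" by (intro mult_right_mono) auto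
  moreover have "2 * ?r \<le> p + (1 - p) * ?r" using c assms by (simp add: p_def Let_def)
  ultimately have "?r \<le> p" by linarith
  then show thesis by (intro that[of c]) (simp add: p_def field_simps)
qed

section \<open>One variable: a product of cosines\<close>

lemma mean_prod_unit_exp:
  "mean m (\<lambda>T. unit_exp (\<alpha> * real (digit_sum B T))) = (\<Prod>i<m. (1 + unit_exp (\<alpha> * real B ^ i)) / 2)"
proof -
  have "unit_exp (\<alpha> * real (digit_sum B T)) = (\<Prod>i\<in>T. unit_exp (\<alpha> * real B ^ i))"
    if "finite T" for T
    using that by (induction T rule: finite_induct)
      (auto simp: digit_sum_def distrib_left unit_exp_def simp flip: cis_mult)
  then have "(\<Sum>T\<in>Pow {..<m}. unit_exp (\<alpha> * real (digit_sum B T)))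
      = (\<Sum>T\<in>Pow {..<m}. (\<Prod>i\<in>T. unit_exp (\<alpha> * real B ^ i)) * (\<Prod>i\<in>{..<m} - T. 1))"
    by (intro sum.cong) (auto intro: finite_subset)
  also have "\<dots> = (\<Prod>i<m. unit_exp (\<alpha> * real B ^ i) + 1)"
    by (rule prod_add[symmetric]) simp
  finally show ?thesis by (simp add: mean_def prod_dividef add.commute)
qed

lemma norm_one_plus_unit_exp: "(norm ((1 + unit_exp x) / 2))\<^sup>2 = (cos (pi * x))\<^sup>2"
proof -
  have "(norm (1 + unit_exp x))\<^sup>2 = (1 + cos (2 * (pi * x)))\<^sup>2 + (sin (2 * (pi * x)))\<^sup>2"
    by (simp add: cmod_power2 unit_exp_def algebra_simps)
  also have "\<dots> = 2 + 2 * cos (2 * (pi * x))"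
    using sin_cos_squared_add[of "2 * (pi * x)"] by (simp add: power2_eq_square algebra_simps)
  also have "\<dots> = 4 * (cos (pi * x))\<^sup>2"
    by (simp add: cos_double_cos)
  finally show ?thesis by (simp add: norm_divide power_divide)
qed

text \<open>The digits are independent, so the mean of \<open>unit_exp\<close> factorises over the
  positions, and \<open>(1 + e(x)) / 2\<close> has absolute value
  \<open>|cos (pi * x)|\<close>.\<close>

lemma box_mean_1: "box_mean B m (Suc 0) \<alpha> = (\<Prod>i<m. (cos (pi * (real B ^ i * \<alpha>)))\<^sup>2)"
proof -
  let ?u = "\<lambda>T. unit_exp (\<alpha> * real (digit_sum B T))"
  have "of_real ((norm (mean m ?u))\<^sup>2) = mean m (\<lambda>T. mean m (\<lambda>T'. unit_exp (\<alpha> * (real (digit_sum B T) - real (digit_sum B T')))))"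
    by (simp add: norm_mean_square right_diff_distrib unit_exp_diff del: of_real_power)
  from arg_cong[OF this, of Re] have "(norm (mean m ?u))\<^sup>2 = box_mean B m (Suc 0) \<alpha>"
    by (simp add: Re_mean Re_unit_exp)
  moreover have "(norm (mean m ?u))\<^sup>2 = (\<Prod>i<m. (cos (pi * (real B ^ i * \<alpha>)))\<^sup>2)"
    unfolding mean_prod_unit_exp prod_norm[symmetric] prod_power_distrib norm_one_plus_unit_exp
    by (simp add: mult.commute)
  ultimately show ?thesis by simp
qed

lemma cos_pi_add_int_square: "(cos (pi * (x + of_int n)))\<^sup>2 = (cos (pi * x))\<^sup>2"
proof -
  have s: "sin (pi * of_int n) = 0"
    using sin_zero_iff_int2[of "pi * of_int n"] by auto
  then have "(cos (pi * of_int n))\<^sup>2 = 1"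
    using sin_cos_squared_add[of "pi * of_int n"] by simp
  with s show ?thesis by (simp add: distrib_left cos_add power_mult_distrib)
qed

text \<open>For \<open>y = pi * r\<close>, Taylor's bound \<open>|sin y - y| \<le> |y|^3 / 6\<close>
  together with \<open>|y| \<le> 2\<close> gives \<open>|sin y| \<ge> |y| / 3\<close>, which is at
  least \<open>|r|\<close> because \<open>pi > 3\<close>.\<close>

lemma abs_le_abs_sin_pi:
  assumes "\<bar>r\<bar> \<le> 1/2"
  shows "\<bar>r\<bar> \<le> \<bar>sin (pi * r)\<bar>"
proof -
  have "\<bar>sin (pi * r) - pi * r\<bar> \<le> \<bar>pi * r\<bar> ^ 3 / 6"
    using Maclaurin_sin_bound[of "pi * r" 3]
    by (simp add: numeral_3_eq_3 sin_coeff_def fact_numeral field_simps)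
  moreover have "\<bar>pi * r\<bar> ^ 3 / 6 \<le> 2 / 3 * \<bar>pi * r\<bar>"
  proof -
    have "\<bar>pi * r\<bar> \<le> 4 * (1/2)" unfolding abs_mult using assms pi_less_4 by (intro mult_mono) auto
    then have "\<bar>pi * r\<bar> ^ 2 \<le> 2\<^sup>2" by (intro power_mono) auto
    then have "\<bar>pi * r\<bar> ^ 2 * \<bar>pi * r\<bar> \<le> 4 * \<bar>pi * r\<bar>" by (intro mult_right_mono) auto
    moreover have "\<bar>pi * r\<bar> ^ 3 = \<bar>pi * r\<bar> ^ 2 * \<bar>pi * r\<bar>" by (simp only: numeral_3_eq_3 numeral_2_eq_2 power_Suc2)
    ultimately show ?thesis by linarith
  qed
  moreover have "3 * \<bar>r\<bar> \<le> \<bar>pi * r\<bar>" unfolding abs_mult using pi_gt3 by (intro mult_right_mono) auto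
  ultimately show ?thesis by linarith
qed

lemma near_round: "\<not> near \<eta> x \<Longrightarrow> \<eta> < \<bar>x - of_int (round x)\<bar>"
  unfolding near_def by (meson not_le)

lemma cos_pi_square_le:
  assumes "\<eta> \<le> \<bar>x - of_int (round x)\<bar>" "0 \<le> \<eta>"
  shows "(cos (pi * x))\<^sup>2 \<le> 1 - \<eta>\<^sup>2"
proof -
  define r where "r = x - of_int (round x)"
  have "\<bar>r\<bar> \<le> 1/2" using of_int_round_abs_le[of x] by (simp add: r_def abs_minus_commute)
  then have "\<eta> \<le> \<bar>sin (pi * r)\<bar>" using abs_le_abs_sin_pi[of r] assms by (simp add: r_def)
  then have "\<eta>\<^sup>2 \<le> \<bar>sin (pi * r)\<bar>\<^sup>2" using assms(2) by (intro power_mono)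
  moreover have "(cos (pi * x))\<^sup>2 = (cos (pi * r))\<^sup>2"
    using cos_pi_add_int_square[of r "round x"] by (simp add: r_def)
  ultimately show ?thesis using sin_cos_squared_add[of "pi * r"] by (simp only: power2_abs)
qed

lemma power_one_minus_inverse_le_half:
  assumes "n \<ge> 1"
  shows "(1 - 1 / real n) ^ n \<le> 1 / 2"
proof -
  have "(1 - 1 / real n) ^ n \<le> (exp (- 1 / real n)) ^ n"
    using assms exp_ge_add_one_self[of "- 1 / real n"] by (intro power_mono) (auto simp: field_simps)
  also have "\<dots> = inverse (exp 1)"
    using assms by (simp add: exp_of_nat_mult[symmetric] exp_minus[symmetric])
  also have "\<dots> \<le> inverse 2"
    using exp_ge_add_one_self[of 1] by (intro le_imp_inverse_le) auto
  finally show ?thesis by simp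
qed

text \<open>The possible values of \<open>round (B ^ l * \<beta>)\<close>, for \<open>\<beta> \<in> [0,1)\<close>, when at most \<open>T\<close> of the numbers
  \<open>B ^ i * \<beta>\<close> with \<open>i < l\<close> are far from an integer: as long as they are close, rounding commutes
  with multiplication by \<open>B\<close>.\<close>

fun rounded :: "nat \<Rightarrow> nat \<Rightarrow> nat \<Rightarrow> int set" where
  "rounded B 0 T = {0, 1}"
| "rounded B (Suc l) 0 = (\<lambda>r. int B * r) ` rounded B l 0"
| "rounded B (Suc l) (Suc T) = (\<lambda>r. int B * r) ` rounded B l (Suc T) \<union>
     (\<lambda>(r, d). int B * r + d) ` (rounded B l T \<times> {- int B..int B})"

lemma finite_rounded: "finite (rounded B l T)"
  by (induction B l T rule: rounded.induct) auto

text \<open>Exponential weights replace a binomial count. Charging \<open>8 * (2 * B + 1)\<close>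
  per far position makes the contribution of the \<open>2 * B + 1\<close> corrections an eighth of
  the main term, so each step costs a factor \<open>9/8\<close>.\<close>

lemma card_rounded: "real (card (rounded B l T)) \<le> 2 * real (8 * (2 * B + 1)) ^ T * (9/8) ^ l"
proof (induction B l T rule: rounded.induct)
  case (1 B T)
  have "(1::real) \<le> real (8 * (2 * B + 1)) ^ T" by (intro one_le_power) auto
  then show ?case by simp
next
  case (2 B l)
  have "real (card (rounded B (Suc l) 0)) \<le> real (card (rounded B l 0))"
    unfolding rounded.simps using finite_rounded by (intro of_nat_mono card_image_le)
  also have "\<dots> \<le> 2 * real (8 * (2 * B + 1)) ^ 0 * (9/8) ^ l" by (rule 2)
  also have "\<dots> \<le> 2 * real (8 * (2 * B + 1)) ^ 0 * (9/8) ^ Suc l" by simp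
  finally show ?case .
next
  case (3 B l T)
  let ?P = "real (8 * (2 * B + 1))"
  have "card (rounded B (Suc l) (Suc T)) \<le> card ((\<lambda>r. int B * r) ` rounded B l (Suc T)) +
       card ((\<lambda>(r, d). int B * r + d) ` (rounded B l T \<times> {- int B..int B}))"
    unfolding rounded.simps by (rule card_Un_le)
  also have "\<dots> \<le> card (rounded B l (Suc T)) + card (rounded B l T \<times> {- int B..int B})"
    using finite_rounded by (intro add_mono card_image_le finite_cartesian_product) auto
  also have "\<dots> = card (rounded B l (Suc T)) + card (rounded B l T) * (2 * B + 1)"
    by (simp add: card_cartesian_product nat_add_distrib nat_mult_distrib)
  finally have "real (card (rounded B (Suc l) (Suc T))) \<le>
      real (card (rounded B l (Suc T))) + real (card (rounded B l T)) * real (2 * B + 1)"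
    unfolding of_nat_mult[symmetric] of_nat_add[symmetric] by (rule of_nat_mono)
  also have "\<dots> \<le> 2 * ?P ^ Suc T * (9/8) ^ l + 2 * ?P ^ T * (9/8) ^ l * real (2 * B + 1)"
    using 3 by (intro add_mono mult_right_mono) auto
  also have "\<dots> = 2 * ?P ^ Suc T * (9/8) ^ Suc l"
    by (simp add: algebra_simps)
  finally show ?case .
qed

lemma abs_round_mult_diff_le:
  assumes "B \<ge> 1"
  shows "\<bar>round (real B * x) - int B * round x\<bar> \<le> int B"
proof -
  have "\<bar>real B * of_int (round x) - real B * x\<bar> \<le> real B * (1/2)"
    unfolding right_diff_distrib[symmetric] abs_mult abs_of_nat
    by (intro mult_left_mono of_int_round_abs_le) simp
  moreover have "\<bar>of_int (round (real B * x)) - real B * x\<bar> \<le> 1/2" by (rule of_int_round_abs_le)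
  moreover have "1 \<le> real B" using assms by simp
  ultimately have "\<bar>of_int (round (real B * x)) - real B * of_int (round x)\<bar> \<le> real B" by linarith
  then have "real_of_int \<bar>round (real B * x) - int B * round x\<bar> \<le> real_of_int (int B)" by simp
  then show ?thesis by (simp only: of_int_le_iff)
qed

lemma round_mult:
  assumes "B \<ge> 1" "\<bar>x - of_int (round x)\<bar> < 1 / (2 * real B)"
  shows "round (real B * x) = int B * round x"
proof (rule round_unique')
  have "\<bar>real B * x - of_int (int B * round x)\<bar> = real B * \<bar>x - of_int (round x)\<bar>"
    by (simp add: abs_mult flip: right_diff_distrib)
  also have "\<dots> < real B * (1 / (2 * real B))"
    using assms by (intro mult_strict_left_mono) auto
  also have "\<dots> = 1/2" using assms(1) by simp
  finally show "\<bar>real B * x - of_int (int B * round x)\<bar> < 1/2" .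
qed

lemma round_mem_rounded:
  fixes \<beta> :: real and B :: nat
  defines "x \<equiv> \<lambda>i. real B ^ i * \<beta>"
  assumes B: "B \<ge> 1" and \<beta>: "0 \<le> \<beta>" "\<beta> < 1"
  shows "card {i. i < l \<and> 1 / (2 * real B) \<le> \<bar>x i - of_int (round (x i))\<bar>} \<le> T
    \<Longrightarrow> round (x l) \<in> rounded B l T"
proof (induction l arbitrary: T)
  case 0
  have "round \<beta> = 0 \<or> round \<beta> = 1"
    using \<beta> by (auto simp: round_def floor_eq_iff)
  then show ?case by (auto simp: x_def)
next
  case (Suc l)
  define bad where "bad i \<longleftrightarrow> 1 / (2 * real B) \<le> \<bar>x i - of_int (round (x i))\<bar>" for i
  note IH = Suc.IH[folded bad_def] and prem = Suc.prems[folded bad_def]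
  have x_Suc: "x (Suc l) = real B * x l" by (simp add: x_def)
  define r where "r = round (x l)"
  show ?case
  proof (cases "bad l")
    case True
    then have "{i. i < Suc l \<and> bad i} = insert l {i. i < l \<and> bad i}" by (auto simp: less_Suc_eq)
    then have "Suc (card {i. i < l \<and> bad i}) \<le> T" using prem by simp
    then obtain T' where T: "T = Suc T'" "card {i. i < l \<and> bad i} \<le> T'" by (cases T) auto
    have "r \<in> rounded B l T'" unfolding r_def by (rule IH[OF T(2)])
    moreover obtain d where d: "d = round (x (Suc l)) - int B * r" by simp
    moreover have "\<bar>d\<bar> \<le> int B" unfolding d x_Suc r_def by (rule abs_round_mult_diff_le[OF B])
    ultimately have "int B * r + d \<in> rounded B (Suc l) T"
      unfolding T(1) rounded.simps by (intro UnI2 image_eqI[of _ _ "(r, d)"]) auto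
    then show ?thesis by (simp add: d)
  next
    case False
    then have "{i. i < Suc l \<and> bad i} = {i. i < l \<and> bad i}" by (auto simp: less_Suc_eq)
    then have "r \<in> rounded B l T" unfolding r_def using prem by (intro IH) simp
    then have "int B * r \<in> rounded B (Suc l) T" by (cases T) auto
    moreover have "round (x (Suc l)) = int B * r"
      unfolding x_Suc r_def using False B by (intro round_mult) (auto simp: bad_def)
    ultimately show ?thesis by simp
  qed
qed

text \<open>Every \<open>n\<close> factors \<open>1 - 1 / n\<close> at least halve a product. This
  bounds the number of far positions in a cosine product that is not too small.\<close>

lemma power_half_le_imp_exponent_le:
  assumes n: "n > 1" and le: "(1/2) ^ y \<le> (1 - 1 / real n) ^ c"
  shows "c \<le> n * y"
proof (rule ccontr)
  assume "\<not> c \<le> n * y"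
  have pos: "0 < 1 - 1 / real n" "1 - 1 / real n < 1" using n by (simp_all add: divide_less_eq)
  have "(1 - 1 / real n) ^ c < (1 - 1 / real n) ^ (n * y)"
    using pos \<open>\<not> c \<le> n * y\<close> by (intro power_strict_decreasing) simp_all
  also have "\<dots> = ((1 - 1 / real n) ^ n) ^ y" by (rule power_mult)
  also have "\<dots> \<le> (1/2) ^ y"
    using pos(1) n by (intro power_mono power_one_minus_inverse_le_half zero_le_power) simp_all
  finally show False using le leD by blast
qed

lemma near_diff_of_round_eq:
  assumes "round (c * frac \<alpha>) = round (c * frac \<beta>)" "c > 0"
  shows "near (1 / c) (\<alpha> - \<beta>)"
proof -
  have "\<bar>of_int (round (c * frac \<alpha>)) - c * frac \<alpha>\<bar> \<le> 1/2"
       "\<bar>of_int (round (c * frac \<alpha>)) - c * frac \<beta>\<bar> \<le> 1/2"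
    using of_int_round_abs_le[of "c * frac \<alpha>"] of_int_round_abs_le[of "c * frac \<beta>"] assms(1) by simp_all
  then have "\<bar>c * frac \<alpha> - c * frac \<beta>\<bar> \<le> 1" by linarith
  then have "c * \<bar>frac \<alpha> - frac \<beta>\<bar> \<le> 1"
    using assms(2) by (simp add: abs_mult flip: right_diff_distrib)
  then have "\<bar>frac \<alpha> - frac \<beta>\<bar> \<le> 1 / c" using assms(2) by (simp add: pos_le_divide_eq mult.commute)
  moreover have "\<alpha> - \<beta> - of_int (\<lfloor>\<alpha>\<rfloor> - \<lfloor>\<beta>\<rfloor>) = frac \<alpha> - frac \<beta>" by (simp add: frac_def)
  ultimately show ?thesis unfolding near_def by metis
qed

text \<open>The label \<open>round (B ^ l * frac \<alpha>)\<close> fixes \<open>\<alpha>\<close>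
  modulo 1 up to \<open>B ^ (-l)\<close>. A position at distance at least \<open>1 / (2 * B)\<close>
  from the integers contributes a factor at most \<open>1 - 1 / (4 * B\<^sup>2)\<close>, so there
  are at most \<open>4 * B\<^sup>2 * y\<close> of them and the label lies in
  \<open>rounded\<close>.\<close>

lemma labelled_cos_product:
  assumes B: "B \<ge> 1"
  shows "labelled {\<alpha>. (1/2) ^ y \<le> (\<Prod>i<l. (cos (pi * (real B ^ i * \<alpha>)))\<^sup>2)}
    (card (rounded B l (4 * B\<^sup>2 * y))) (1 / real B ^ l)" (is "labelled ?\<Omega> (card ?R) _")
proof -
  define lab where "lab \<alpha> = round (real B ^ l * frac \<alpha>)" for \<alpha>
  have "lab \<alpha> \<in> ?R" if \<alpha>: "\<alpha> \<in> ?\<Omega>" for \<alpha>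
  proof -
    define x where "x i = real B ^ i * frac \<alpha>" for i
    define n where "n = 4 * B\<^sup>2"
    define bad where "bad i \<longleftrightarrow> 1 / (2 * real B) \<le> \<bar>x i - of_int (round (x i))\<bar>" for i
    have "1 \<le> B\<^sup>2" using B by (intro one_le_power)
    then have n: "1 < n" unfolding n_def by linarith
    have cos_x: "(cos (pi * (real B ^ i * \<alpha>)))\<^sup>2 = (cos (pi * x i))\<^sup>2" for i
      using cos_pi_add_int_square[of "x i" "int B ^ i * \<lfloor>\<alpha>\<rfloor>"]
      by (simp add: x_def frac_def right_diff_distrib)
    have "(1/2) ^ y \<le> (\<Prod>i<l. (cos (pi * x i))\<^sup>2)"
      using \<alpha> by (simp only: cos_x mem_Collect_eq)
    also have "\<dots> \<le> (\<Prod>i<l. if bad i then 1 - 1 / real n else 1)"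
    proof (intro prod_mono conjI)
      fix i
      show "(cos (pi * x i))\<^sup>2 \<le> (if bad i then 1 - 1 / real n else 1)"
      proof (cases "bad i")
        case True
        then show ?thesis
          using cos_pi_square_le[of "1 / (2 * real B)" "x i"]
          by (simp add: bad_def n_def power_divide power_mult_distrib)
      qed (simp add: abs_square_le_1)
    qed simp
    also have "\<dots> = (1 - 1 / real n) ^ card {i. i < l \<and> bad i}"
      by (simp add: prod.If_cases Int_def)
    finally have "card {i. i < l \<and> bad i} \<le> n * y"
      by (rule power_half_le_imp_exponent_le[OF n])
    then have "round (x l) \<in> rounded B l (n * y)"
      unfolding bad_def x_def using B by (intro round_mem_rounded) (simp_all add: frac_lt_1)
    then show ?thesis by (simp add: lab_def x_def n_def)
  qed
  then have sub: "lab ` ?\<Omega> \<subseteq> ?R" by blast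
  have "finite (lab ` ?\<Omega>)" by (rule finite_subset[OF sub finite_rounded])
  moreover have "card (lab ` ?\<Omega>) \<le> card ?R" by (rule card_mono[OF finite_rounded sub])
  moreover have "near (1 / real B ^ l) (\<alpha> - \<beta>)" if "lab \<alpha> = lab \<beta>" for \<alpha> \<beta>
    using that B unfolding lab_def by (intro near_diff_of_round_eq) simp_all
  ultimately show ?thesis unfolding labelled_def by blast
qed

section \<open>The inverse theorem\<close>

lemma rational_approx_mono:
  assumes "rational_approx Q \<eta> \<alpha>" "Q \<le> Q'" "\<eta> \<le> \<eta>'"
  shows "rational_approx Q' \<eta>' \<alpha>"
proof -
  obtain q where "q \<in> {1..Q}" "near \<eta> (real q * \<alpha>)"
    using assms(1) unfolding rational_approx_def by blast
  then have "q \<in> {1..Q'}" "near \<eta>' (real q * \<alpha>)" using assms(2,3) near_mono by auto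
  then show ?thesis unfolding rational_approx_def by blast
qed

lemma sum_powers_le: "B \<ge> 2 \<Longrightarrow> (\<Sum>i<w. B ^ i) \<le> (B::nat) ^ w"
  using digit_sum_less[of B "{..<w}" w] by (simp add: digit_sum_def)

lemma linear_le_two_power: "B \<ge> 9 \<Longrightarrow> 8 * (2 * B + 1) \<le> (2::nat) ^ B"
  by (induction B rule: nat_induct_at_least) auto

text \<open>Counted in bits: since \<open>(9/8)^2 \<le> 2\<close>, the factor
  \<open>(9/8) ^ (w + 2)\<close> uses about half of the \<open>w\<close> available bits. The other
  half, \<open>B ^ 4 * Y\<close>, has room for the far positions, which need at most
  \<open>4 * B ^ 3 * Y\<close>, and for the loss \<open>Y\<close>.\<close>

lemma card_rounded_less:
  fixes B Y :: nat
  assumes B: "B \<ge> 9" and Y: "Y \<ge> 1"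
  defines "w \<equiv> 2 * B ^ 4 * Y"
  shows "real (card (rounded B (w + 2) (4 * B\<^sup>2 * Y))) < (1/2) ^ Y * 2 ^ w"
proof -
  define p where "p = B ^ 4 * Y"
  define T where "T = 4 * B\<^sup>2 * Y"
  define a where "a = B ^ 3 * Y"
  have w: "w = 2 * p" by (simp add: w_def p_def)
  have "real (8 * (2 * B + 1)) \<le> real (2 ^ B)" by (rule of_nat_mono[OF linear_le_two_power[OF B]])
  then have "real (8 * (2 * B + 1)) ^ T \<le> (2 ^ B) ^ T" by (intro power_mono) simp_all
  also have "\<dots> = 2 ^ (4 * a)"
    unfolding power_mult[symmetric] by (simp add: T_def a_def power3_eq_cube power2_eq_square ac_simps)
  finally have P: "real (8 * (2 * B + 1)) ^ T \<le> 2 ^ (4 * a)" .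
  have "(9/8 :: real) ^ (w + 2) = ((9/8)\<^sup>2) ^ (p + 1)"
    unfolding power_mult[symmetric] by (simp add: w)
  also have "\<dots> \<le> 2 ^ (p + 1)" by (intro power_mono) (simp_all add: power2_eq_square)
  finally have E: "(9/8 :: real) ^ (w + 2) \<le> 2 ^ (p + 1)" .
  have "real (card (rounded B (w + 2) T)) \<le> 2 * real (8 * (2 * B + 1)) ^ T * (9/8) ^ (w + 2)"
    by (rule card_rounded)
  also have "\<dots> \<le> 2 * 2 ^ (4 * a) * 2 ^ (p + 1)"
    by (intro mult_mono P E order_refl mult_nonneg_nonneg zero_le_power) simp_all
  also have "\<dots> = 2 ^ (4 * a + p + 2)" by (simp add: power_add)
  also have "(2::real) ^ (4 * a + p + 2) < 2 ^ (w - Y)"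
  proof (rule power_strict_increasing)
    have "9 * a \<le> B * a" using B by simp
    also have "B * a = p" by (simp add: a_def p_def power3_eq_cube power4_eq_xxxx)
    finally have "9 * a \<le> p" .
    have "9 ^ 3 * Y \<le> a" unfolding a_def using B by (intro mult_right_mono power_mono) simp_all
    then have "729 * Y \<le> a" by simp
    with \<open>9 * a \<le> p\<close> Y show "4 * a + p + 2 < w - Y" unfolding w by linarith
  qed simp
  also have "(2::real) ^ (w - Y) = (1/2) ^ Y * 2 ^ w"
  proof -
    have "Y \<le> w" using B by (simp add: w_def)
    then have "(2::real) ^ w = 2 ^ (w - Y) * 2 ^ Y" by (simp flip: power_add)
    then show ?thesis by (simp add: power_divide)
  qed
  finally show ?thesis by (simp add: T_def)
qed

text \<open>Two variables are treated together. A position \<open>t\<close> is split as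
  \<open>s + (t - s)\<close>: the inner variable supplies the cosines at the positions
  \<open>s, ..., s + l - 1\<close>, the outer one the pigeonhole window starting at
  \<open>t - s\<close>. Gluing over all \<open>t \<le> 2 * m - l - w\<close> gives the
  precision.\<close>

lemma box_mean_2_inverse:
  fixes B m y :: nat
  assumes B: "B \<ge> 9" and large: "(1/2) ^ y \<le> box_mean B m 2 \<theta>"
  defines "w \<equiv> 2 * B ^ 4 * Suc y"
  assumes m: "w + 2 \<le> m"
  shows "rational_approx (B ^ w) (real B ^ (2 * w) / real B ^ (2 * m)) \<theta>"
proof -
  \<comment> \<open>The two positions beyond \<open>w\<close> reduce the gluing condition to
    \<open>(B + 1) / B\<^sup>2 < 1\<close>.\<close>
  define l where "l = w + 2"
  let ?\<Omega> = "{\<alpha>. (1/2) ^ Suc y \<le> (\<Prod>i<l. (cos (pi * (real B ^ i * \<alpha>)))\<^sup>2)}"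
  have B2: "B \<ge> 2" using B by simp
  obtain c where c: "(1/2) ^ Suc y * 2 ^ m \<le>
      real (card {T\<in>Pow {..<m}. (1/2) ^ Suc y \<le> box_mean B m (Suc 0) (\<theta> * real (digit_sum B T) + c)})"
    using large unfolding numeral_2_eq_2 by (rule box_mean_half)
  have sub: "{T\<in>Pow {..<m}. (1/2) ^ Suc y \<le> box_mean B m (Suc 0) (\<theta> * real (digit_sum B T) + c)}
      \<subseteq> {T\<in>Pow {..<m}. real B ^ s * \<theta> * real (digit_sum B T) + real B ^ s * c \<in> ?\<Omega>}"
    if s: "s + l \<le> m" for s
  proof safe
    fix T assume "(1/2) ^ Suc y \<le> box_mean B m (Suc 0) (\<theta> * real (digit_sum B T) + c)" (is "_ \<le> box_mean _ _ _ ?\<alpha>")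
    also have "\<dots> = (\<Prod>i<m. (cos (pi * (real B ^ i * ?\<alpha>)))\<^sup>2)" by (rule box_mean_1)
    also have "\<dots> = (\<Prod>i\<in>{..<m} - {s..<s + l}. (cos (pi * (real B ^ i * ?\<alpha>)))\<^sup>2) *
        (\<Prod>i\<in>{s..<s + l}. (cos (pi * (real B ^ i * ?\<alpha>)))\<^sup>2)"
      using s by (intro prod.subset_diff) auto
    \<comment> \<open>Factors outside the block are at most 1, so the product over the block stays
      large for every admissible \<open>s\<close>.\<close>
    also have "\<dots> \<le> 1 * (\<Prod>i\<in>{s..<s + l}. (cos (pi * (real B ^ i * ?\<alpha>)))\<^sup>2)"
      by (intro mult_right_mono prod_le_1 prod_nonneg) (simp_all add: abs_square_le_1)
    also have "\<dots> = (\<Prod>i<l. (cos (pi * (real B ^ (i + s) * ?\<alpha>)))\<^sup>2)"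
      using prod.shift_bounds_nat_ivl[of "\<lambda>i. (cos (pi * (real B ^ i * ?\<alpha>)))\<^sup>2" 0 s l]
      by (simp add: atLeast0LessThan add.commute)
    also have "\<dots> = (\<Prod>i<l. (cos (pi * (real B ^ i * (real B ^ s * \<theta> * real (digit_sum B T) + real B ^ s * c))))\<^sup>2)"
      by (simp add: power_add distrib_left mult.assoc)
    finally show "(1/2) ^ Suc y \<le> \<dots>" .
  qed
  have app: "rational_approx (B ^ w) (1 / real B ^ l) (real B ^ t * \<theta>)" if t: "t \<le> 2 * m - l - w" for t
  proof -
    define s where "s = min t (m - l)"
    have s: "s + l \<le> m" and ts: "(t - s) + w \<le> m" "s \<le> t" using t m by (auto simp: s_def l_def)
    have good: "(1/2) ^ Suc y * 2 ^ m \<le>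
        real (card {T\<in>Pow {..<m}. real B ^ s * \<theta> * real (digit_sum B T) + real B ^ s * c \<in> ?\<Omega>})"
      by (rule order_trans[OF c of_nat_mono[OF card_mono[OF _ sub[OF s]]]]) simp
    have "rational_approx (\<Sum>i<w. B ^ i) (1 / real B ^ l) (real B ^ (t - s) * (real B ^ s * \<theta>))"
    proof (rule window_pigeonhole[OF B2 _ ts(1) good])
      show "labelled ?\<Omega> (card (rounded B l (4 * B\<^sup>2 * Suc y))) (1 / real B ^ l)"
        by (rule labelled_cos_product) (use B in simp)
      show "real (card (rounded B l (4 * B\<^sup>2 * Suc y))) < (1/2) ^ Suc y * 2 ^ w"
        using card_rounded_less[OF B, of "Suc y"] unfolding w_def[symmetric] l_def by simp
    qed
    moreover have "real B ^ (t - s) * (real B ^ s * \<theta>) = real B ^ t * \<theta>"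
      using ts(2) by (simp flip: mult.assoc power_add)
    ultimately show ?thesis using rational_approx_mono[OF _ sum_powers_le[OF B2] order_refl] by simp
  qed
  have "rational_approx (B ^ w) (real (B ^ w) * (1 / real B ^ l) / real B ^ (2 * m - l - w)) \<theta>"
  proof (rule glue_rational_approx[OF app])
    have "9 * real B \<le> real B * real B" using B by (intro mult_right_mono) simp_all
    then have "real B + 1 < real B * real B" using B by linarith
    then show "real (B ^ w) * (1 / real B ^ l) * (real B + 1) < 1"
      using B by (simp add: l_def power_add power2_eq_square field_simps)
  qed (use B in auto)
  also have "real (B ^ w) * (1 / real B ^ l) / real B ^ (2 * m - l - w) = real B ^ (2 * w) / real B ^ (2 * m)"
  proof -
    have "2 * m = l + (2 * m - l - w) + w" using m by (simp add: l_def)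
    then have "real B ^ (2 * m) = real B ^ l * real B ^ (2 * m - l - w) * real B ^ w"
      by (metis power_add)
    then show ?thesis using B by (simp add: mult_2 power_add)
  qed
  finally show ?thesis .
qed

text \<open>For many \<open>T\<close> the induction hypothesis puts
  \<open>\<theta> * digit_sum B T + c\<close> near a rational with denominator at most
  \<open>Q\<close>, which leaves at most \<open>Q\<^sup>2\<close> pigeonholes. Windows at all
  \<open>t \<le> m - w\<close> then give approximations that glue, and the new variable improves the
  precision by \<open>B ^ (m - w)\<close>.\<close>

lemma box_mean_inverse_step:
  fixes B m j y Q w :: nat
  assumes B: "B \<ge> 2"
    and IH: "\<And>\<alpha>. (1/2) ^ Suc y \<le> box_mean B m j \<alpha> \<Longrightarrow> rational_approx Q \<eta> \<alpha>"
    and large: "(1/2) ^ y \<le> box_mean B m (Suc j) \<theta>"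
    and Q: "real (Q\<^sup>2) < (1/2) ^ Suc y * 2 ^ w" and w: "w \<le> m" and \<eta>: "0 \<le> \<eta>"
    and small: "real (B ^ w) * (2 * \<eta>) * (real B + 1) < 1"
  shows "rational_approx (B ^ w) (real (B ^ w) * (2 * \<eta>) / real B ^ (m - w)) \<theta>"
proof (rule glue_rational_approx)
  fix t assume t: "t \<le> m - w"
  obtain c where c: "(1/2) ^ Suc y * 2 ^ m \<le>
      real (card {T\<in>Pow {..<m}. (1/2) ^ Suc y \<le> box_mean B m j (\<theta> * real (digit_sum B T) + c)})"
    using large by (rule box_mean_half)
  have "card {T\<in>Pow {..<m}. (1/2) ^ Suc y \<le> box_mean B m j (\<theta> * real (digit_sum B T) + c)}
      \<le> card {T\<in>Pow {..<m}. \<theta> * real (digit_sum B T) + c \<in> {\<alpha>. rational_approx Q \<eta> \<alpha>}}"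
    using IH by (intro card_mono) auto
  then have "(1/2) ^ Suc y * 2 ^ m \<le>
      real (card {T\<in>Pow {..<m}. \<theta> * real (digit_sum B T) + c \<in> {\<alpha>. rational_approx Q \<eta> \<alpha>}})"
    by (rule order_trans[OF c of_nat_mono])
  moreover have "t + w \<le> m" using t w by simp
  ultimately have "rational_approx (\<Sum>i<w. B ^ i) (2 * \<eta>) (real B ^ t * \<theta>)"
    by (intro window_pigeonhole[OF B labelled_rational_approx _ _ Q])
  then show "rational_approx (B ^ w) (2 * \<eta>) (real B ^ t * \<theta>)"
    by (rule rational_approx_mono[OF _ sum_powers_le[OF B] order_refl])
qed (use small B \<eta> in auto)

text \<open>Induction on the number \<open>i\<close> of variables beyond two. Each step halves the
  level once more, enlarges the window by the factor \<open>B\<^sup>2\<close> and loses another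
  \<open>B ^ (3 * W)\<close> in precision; \<open>W\<close> bounds all windows used.\<close>

lemma box_mean_inverse_aux:
  fixes B m Y W :: nat
  assumes B: "B \<ge> 9" and m: "3 * W \<le> m"
  shows "Suc i \<le> Y \<Longrightarrow> 2 * B ^ (4 + 2 * i) * Y \<le> W \<Longrightarrow> (1/2) ^ (Y - Suc i) \<le> box_mean B m (i + 2) \<alpha> \<Longrightarrow>
    rational_approx (B ^ (2 * B ^ (4 + 2 * i) * Y)) (real B ^ (3 * Suc i * W) / real B ^ ((i + 2) * m)) \<alpha>"
proof (induction i arbitrary: \<alpha>)
  case 0
  define w where "w = 2 * B ^ 4 * Y"
  have w: "w \<le> W" using 0 by (simp add: w_def)
  have "1 * 1 \<le> B ^ 4 * Y" using B 0 by (intro mult_mono one_le_power) auto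
  then have "2 \<le> w" by (simp add: w_def)
  then have "w + 2 \<le> m" using w m by linarith
  then have "rational_approx (B ^ w) (real B ^ (2 * w) / real B ^ (2 * m)) \<alpha>"
    using box_mean_2_inverse[OF B, of "Y - 1" m \<alpha>] 0 by (simp add: w_def numeral_2_eq_2)
  moreover have "real B ^ (2 * w) / real B ^ (2 * m) \<le> real B ^ (3 * W) / real B ^ (2 * m)"
    using w B by (intro divide_right_mono power_increasing) auto
  ultimately have "rational_approx (B ^ w) (real B ^ (3 * W) / real B ^ (2 * m)) \<alpha>"
    by (rule rational_approx_mono[OF _ order_refl])
  then show ?case by (simp add: w_def mult_2)
next
  case (Suc i)
  define w where "w = 2 * B ^ (4 + 2 * i) * Y"
  define w' where "w' = 2 * B ^ (4 + 2 * Suc i) * Y"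
  define \<eta> where "\<eta> = real B ^ (3 * Suc i * W) / real B ^ ((i + 2) * m)"
  let ?y = "Y - Suc (Suc i)"
  have "4 + 2 * Suc i = 2 + (4 + 2 * i)" by simp
  then have w'_w: "w' = B\<^sup>2 * w" unfolding w_def w'_def by (simp only: power_add ac_simps)
  have w'W: "w' \<le> W" using Suc.prems by (simp add: w'_def)
  have "1 * w \<le> B\<^sup>2 * w" using B by (intro mult_right_mono one_le_power) auto
  then have wW: "w \<le> W" using w'W unfolding w'_w by linarith
  have Yw: "1 * Y \<le> w" unfolding w_def using B one_le_power[of B "4 + 2 * i"] by (intro mult_right_mono) auto
  have w_pos: "1 \<le> w" using Yw Suc.prems by simp
  have Suc_y: "Suc ?y = Y - Suc i" using Suc.prems by simp
  have "rational_approx (B ^ w') (real (B ^ w') * (2 * \<eta>) / real B ^ (m - w')) \<alpha>"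
  proof (rule box_mean_inverse_step)
    fix \<beta> assume "(1/2) ^ Suc ?y \<le> box_mean B m (i + 2) \<beta>"
    then show "rational_approx (B ^ w) \<eta> \<beta>"
      unfolding w_def \<eta>_def Suc_y using Suc.prems wW[unfolded w_def] by (intro Suc.IH) simp_all
  next
    \<comment> \<open>This is why the window grows by \<open>B\<^sup>2\<close>: the at most
      \<open>B ^ (2 * w) \<le> 2 ^ (2 * B * w)\<close> pigeonholes and the loss
      \<open>2 ^ Suc ?y\<close> must fit into \<open>2 ^ w'\<close>.\<close>
    have "(2 * B + 1) * w + Suc ?y \<le> (2 * B + 2) * w"
      using Yw Suc_y Suc.prems by (simp add: add_mult_distrib)
    also have "\<dots> < B\<^sup>2 * w"
    proof (rule mult_strict_right_mono)
      have "9 * B \<le> B * B" using B by (intro mult_right_mono) auto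
      then show "2 * B + 2 < B\<^sup>2" using B unfolding power2_eq_square by linarith
    qed (use w_pos in simp)
    finally have less: "2 * B * w + Suc ?y < w'" unfolding w'_w by (simp add: algebra_simps)
    have "real ((B ^ w)\<^sup>2) = real B ^ (2 * w)" by (simp add: power_mult[symmetric] mult.commute)
    also have "\<dots> \<le> (2 ^ B) ^ (2 * w)"
      using less_exp[of B] by (intro power_mono) (simp_all add: of_nat_less_two_power order_less_imp_le)
    also have "\<dots> = 2 ^ (2 * B * w)" by (simp add: power_mult[symmetric] mult.commute mult.left_commute)
    also have "\<dots> < 2 ^ (w' - Suc ?y)" using less by (intro power_strict_increasing) auto
    also have "\<dots> = (1/2) ^ Suc ?y * 2 ^ w'"
    proof -
      have "(2::real) ^ w' = 2 ^ (w' - Suc ?y) * 2 ^ Suc ?y" unfolding power_add[symmetric] using less by simp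
      then show ?thesis by (simp add: power_divide)
    qed
    finally show "real ((B ^ w)\<^sup>2) < (1/2) ^ Suc ?y * 2 ^ w'" .
  next
    have "2 * (x + 1) < x\<^sup>2" if "9 \<le> x" for x :: real
    proof -
      have "2 * (x + 1) < 9 * x" using that by simp
      also have "\<dots> \<le> x * x" using that by (intro mult_right_mono) auto
      finally show ?thesis by (simp only: power2_eq_square)
    qed
    from this[of "real B"] have *: "2 * (real B + 1) < real B ^ 2" using B by simp
    have "real (B ^ w') * (2 * \<eta>) * (real B + 1) = real B ^ (w' + 3 * Suc i * W) * (2 * (real B + 1)) / real B ^ ((i + 2) * m)"
      by (simp add: \<eta>_def power_add)
    also have "\<dots> < real B ^ (w' + 3 * Suc i * W) * real B ^ 2 / real B ^ ((i + 2) * m)"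
      using * B by (intro divide_strict_right_mono mult_strict_left_mono) auto
    also have "\<dots> = real B ^ (w' + 3 * Suc i * W + 2) / real B ^ ((i + 2) * m)" by (simp only: power_add)
    also have "\<dots> \<le> real B ^ ((i + 2) * m) / real B ^ ((i + 2) * m)"
    proof (intro divide_right_mono power_increasing)
      have "Suc i * (3 * W) \<le> Suc i * m" using m by (rule mult_left_mono) simp
      moreover have "w' + 2 \<le> m" using w'W m w_pos wW by linarith
      ultimately show "w' + 3 * Suc i * W + 2 \<le> (i + 2) * m" by (simp add: algebra_simps)
    qed (use B in auto)
    also have "\<dots> = 1" using B by simp
    finally show "real (B ^ w') * (2 * \<eta>) * (real B + 1) < 1" .
  qed (use B Suc.prems w'W m in \<open>auto simp: \<eta>_def\<close>)
  then show ?case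
    unfolding w'_def[symmetric]
  proof (rule rational_approx_mono[OF _ order_refl])
    have "w' \<le> m" using w'W m by simp
    then have mm: "real B ^ m = real B ^ (m - w') * real B ^ w'" by (simp flip: power_add)
    have "real (B ^ w') * (2 * \<eta>) / real B ^ (m - w') =
        real B ^ (2 * w' + 3 * Suc i * W) * 2 / (real B ^ ((i + 2) * m) * real B ^ m)"
    proof -
      have "a * (2 * (e / f)) / g = a * a * e * 2 / (f * (g * a))" if "a \<noteq> 0" for a e f g :: real
        using that by simp
      from this[of "real B ^ w'"] show ?thesis
        using B unfolding mm \<eta>_def of_nat_power power_add mult_2 by simp
    qed
    \<comment> \<open>The factor 2 is absorbed into one \<open>B\<close>; the exponent then grows by
      \<open>2 * w' + 1 \<le> 3 * W\<close>.\<close>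
    also have "\<dots> \<le> real B ^ (2 * w' + 3 * Suc i * W) * real B / (real B ^ ((i + 2) * m) * real B ^ m)"
      using B by (intro divide_right_mono mult_left_mono) auto
    also have "\<dots> = real B ^ (2 * w' + 3 * Suc i * W + 1) / real B ^ ((Suc i + 2) * m)"
      by (simp add: power_add algebra_simps)
    also have "\<dots> \<le> real B ^ (3 * Suc (Suc i) * W) / real B ^ ((Suc i + 2) * m)"
    proof (intro divide_right_mono power_increasing)
      have "3 * Suc (Suc i) * W = 3 * Suc i * W + 3 * W" by (simp add: add_mult_distrib)
      then show "2 * w' + 3 * Suc i * W + 1 \<le> 3 * Suc (Suc i) * W" using w'W w_pos wW by linarith
    qed (use B in auto)
    finally show "real (B ^ w') * (2 * \<eta>) / real B ^ (m - w') \<le> real B ^ (3 * Suc (Suc i) * W) / real B ^ ((Suc i + 2) * m)" .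
  qed
qed

lemma box_mean_inverse:
  fixes B m k y :: nat
  assumes B: "B \<ge> 9" and k: "k \<ge> 2" and large: "(1/2) ^ y \<le> box_mean B m k \<alpha>"
  defines "W \<equiv> 2 * B ^ (2 * k) * (y + k)"
  assumes m: "3 * W \<le> m"
  shows "rational_approx (B ^ W) (real B ^ (3 * k * W) / real B ^ (k * m)) \<alpha>"
proof -
  define i where "i = k - 2"
  have k_i: "k = i + 2" using k by (simp add: i_def)
  \<comment> \<open>With \<open>Y = y + k\<close> and \<open>i = k - 2\<close> the level is
    \<open>(1/2) ^ (y + 1)\<close>, which is below the given one.\<close>
  have "(1/2) ^ (y + k - Suc i) \<le> (1/2 :: real) ^ y" by (intro power_decreasing) (auto simp: k_i)
  from order_trans[OF this large] have *: "(1/2) ^ (y + k - Suc i) \<le> box_mean B m (i + 2) \<alpha>"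
    by (simp only: k_i)
  have W: "2 * B ^ (4 + 2 * i) * (y + k) = W" 
  proof -
    have "4 + 2 * i = 2 * k" by (simp add: k_i)
    then show ?thesis by (simp only: W_def)
  qed
  have "rational_approx (B ^ W) (real B ^ (3 * Suc i * W) / real B ^ (k * m)) \<alpha>"
    using box_mean_inverse_aux[OF B m, of i "y + k" \<alpha>] * W by (simp add: k_i del: box_mean.simps)
  moreover have "real B ^ (3 * Suc i * W) / real B ^ (k * m) \<le> real B ^ (3 * k * W) / real B ^ (k * m)"
    using B by (intro divide_right_mono power_increasing mult_right_mono) (auto simp: k_i)
  ultimately show ?thesis by (rule rational_approx_mono[OF _ order_refl])
qed

lemma prod_le_factor:
  fixes f :: "nat \<Rightarrow> real"
  assumes "\<And>i. 0 \<le> f i" "\<And>i. f i \<le> 1" "t < m"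
  shows "(\<Prod>i<m. f i) \<le> f t"
proof -
  have "(\<Prod>i<m. f i) = f t * (\<Prod>i\<in>{..<m} - {t}. f i)" using assms(3) by (intro prod.remove) auto
  also have "\<dots> \<le> f t * 1" using assms by (intro mult_left_mono prod_le_1) auto
  finally show ?thesis by simp
qed

lemma rational_approx_1: "rational_approx 1 \<eta> \<alpha> \<longleftrightarrow> near \<eta> \<alpha>"
  by (simp add: rational_approx_def)

text \<open>Very large values force the denominator 1. If the mean is at least
  \<open>1 - \<kappa> / 4\<close>, three quarters of the sets \<open>T\<close> have value at least
  \<open>1 - \<kappa>\<close>. As this is more than half, a window of length one with a single
  pigeonhole suffices. For one variable each cosine factor is itself at least
  \<open>1 - (1 / (8 * B))\<^sup>2\<close>.\<close>

lemma box_mean_near_one: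
  fixes B m :: nat
  assumes B: "B \<ge> 9" and m: "m \<ge> 2"
  shows "1 - 1 / (64 * (real B)\<^sup>2 * 4 ^ j) \<le> box_mean B m (Suc j) \<alpha> \<Longrightarrow>
    near (2 ^ j / (8 * real B * real B ^ (Suc j * (m - 1)))) \<alpha>"
proof (induction j arbitrary: \<alpha>)
  case 0
  let ?\<eta> = "1 / (8 * real B)"
  have "rational_approx 1 ?\<eta> (real B ^ t * \<alpha>)" if t: "t \<le> m - 1" for t
  proof -
    let ?x = "real B ^ t * \<alpha>"
    have le: "1 - ?\<eta>\<^sup>2 \<le> (cos (pi * ?x))\<^sup>2"
    proof -
      have "1 - ?\<eta>\<^sup>2 \<le> box_mean B m (Suc 0) \<alpha>"
        using 0 by (simp add: power_divide power_mult_distrib del: box_mean.simps)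
      also have "\<dots> = (\<Prod>i<m. (cos (pi * (real B ^ i * \<alpha>)))\<^sup>2)" by (rule box_mean_1)
      also have "\<dots> \<le> (cos (pi * ?x))\<^sup>2"
        using t m by (intro prod_le_factor[of "\<lambda>i. (cos (pi * (real B ^ i * \<alpha>)))\<^sup>2"])
          (auto simp: abs_square_le_1)
      finally show ?thesis .
    qed
    have "near ?\<eta> ?x"
    proof (rule ccontr)
      assume "\<not> near ?\<eta> ?x"
      then have less: "?\<eta> < \<bar>?x - of_int (round ?x)\<bar>" by (rule near_round)
      have "(cos (pi * ?x))\<^sup>2 \<le> 1 - \<bar>?x - of_int (round ?x)\<bar>\<^sup>2"
        by (rule cos_pi_square_le) simp_all
      moreover have "?\<eta>\<^sup>2 < \<bar>?x - of_int (round ?x)\<bar>\<^sup>2" by (rule power_strict_mono[OF less]) simp_all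
      ultimately show False using le by linarith
    qed
    then show ?thesis by (simp only: rational_approx_1)
  qed
  then have "rational_approx 1 (real 1 * ?\<eta> / real B ^ (m - 1)) \<alpha>"
    using B by (intro glue_rational_approx) (auto simp: field_simps)
  then show ?case by (simp add: rational_approx_1[unfolded One_nat_def])
next
  case (Suc j)
  let ?\<kappa> = "1 / (64 * (real B)\<^sup>2 * 4 ^ j)"
  define \<eta> where "\<eta> = 2 ^ j / (8 * real B * real B ^ (Suc j * (m - 1)))"
  have \<kappa>: "0 < ?\<kappa>" using B by simp
  have le: "1 - ?\<kappa> / 4 \<le> box_mean B m (Suc (Suc j)) \<alpha>"
    using Suc.prems by (simp add: field_simps del: box_mean.simps)
  obtain c where c: "box_mean B m (Suc (Suc j)) \<alpha> \<le>
    (let p = real (card {T\<in>Pow {..<m}. 1 - ?\<kappa> \<le> box_mean B m (Suc j) (\<alpha> * real (digit_sum B T) + c)}) / 2 ^ m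
     in p + (1 - p) * (1 - ?\<kappa>))" by (rule box_mean_threshold)
  define p where "p = real (card {T\<in>Pow {..<m}. 1 - ?\<kappa> \<le> box_mean B m (Suc j) (\<alpha> * real (digit_sum B T) + c)}) / 2 ^ m"
  have "1 - ?\<kappa> / 4 \<le> p + (1 - p) * (1 - ?\<kappa>)"
    using order_trans[OF le c] unfolding Let_def p_def .
  moreover have "1 - \<kappa> / 4 \<le> p + (1 - p) * (1 - \<kappa>) \<longleftrightarrow> \<kappa> * (1 - p) \<le> \<kappa> * (1/4)" for \<kappa>
    by (simp add: algebra_simps)
  ultimately have "?\<kappa> * (1 - p) \<le> ?\<kappa> * (1/4)" by blast
  then have "1 - p \<le> 1/4" using \<kappa> by (simp only: mult_le_cancel_left_pos)
  then have "3/4 \<le> p" by simp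
  then have "3/4 * 2 ^ m \<le> real (card {T\<in>Pow {..<m}. 1 - ?\<kappa> \<le> box_mean B m (Suc j) (\<alpha> * real (digit_sum B T) + c)})"
    unfolding p_def by (simp only: pos_le_divide_eq zero_less_power zero_less_numeral)
  also have "\<dots> \<le> real (card {T\<in>Pow {..<m}. \<alpha> * real (digit_sum B T) + c \<in> {\<alpha>. near \<eta> \<alpha>}})"
    unfolding \<eta>_def using Suc.IH by (intro of_nat_mono card_mono) (auto simp del: box_mean.simps)
  finally have good: "3/4 * 2 ^ m \<le> real (card {T\<in>Pow {..<m}. \<alpha> * real (digit_sum B T) + c \<in> {\<alpha>. near \<eta> \<alpha>}})" .
  have app: "rational_approx 1 (2 * \<eta>) (real B ^ t * \<alpha>)" if "t \<le> m - 1" for t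
  proof -
    have "rational_approx (\<Sum>i<1. B ^ i) (2 * \<eta>) (real B ^ t * \<alpha>)"
      using that B m by (intro window_pigeonhole[OF _ labelled_near _ good]) simp_all
    then show ?thesis by simp
  qed
  have "rational_approx 1 (real 1 * (2 * \<eta>) / real B ^ (m - 1)) \<alpha>"
  proof (rule glue_rational_approx[OF app])
    have "(2::real) ^ j \<le> 2 ^ (Suc j * (m - 1))"
    proof (rule power_increasing)
      have "j * 1 \<le> Suc j * (m - 1)" using m by (intro mult_mono) auto
      then show "j \<le> Suc j * (m - 1)" by simp
    qed simp
    also have "\<dots> \<le> real B ^ (Suc j * (m - 1))" using B by (intro power_mono) auto
    finally have "\<eta> \<le> 1 / (8 * real B)"
      unfolding \<eta>_def using B by (simp add: field_simps)
    then have "2 * \<eta> * (real B + 1) \<le> 2 * (1 / (8 * real B)) * (real B + 1)"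
      by (intro mult_right_mono mult_left_mono) auto
    also have "\<dots> < 1" using B by (simp add: field_simps)
    finally show "real 1 * (2 * \<eta>) * (real B + 1) < 1" by simp
  qed (use B in \<open>auto simp: \<eta>_def\<close>)
  moreover have "real 1 * (2 * \<eta>) / real B ^ (m - 1) = 2 ^ Suc j / (8 * real B * real B ^ (Suc (Suc j) * (m - 1)))"
    unfolding \<eta>_def mult_Suc[of "Suc j"] power_add by simp
  ultimately show ?case by (simp only: rational_approx_1)
qed

section \<open>Moments\<close>

lemma card_nat_interval_le:
  fixes u v :: real
  assumes "u \<le> v"
  shows "finite {t::nat. u \<le> real t \<and> real t \<le> v}"
    and "real (card {t::nat. u \<le> real t \<and> real t \<le> v}) \<le> v - u + 1"
proof -
  let ?A = "{t::nat. u \<le> real t \<and> real t \<le> v}"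
  have sub: "int ` ?A \<subseteq> {\<lceil>u\<rceil>..\<lfloor>v\<rfloor>}" by (auto simp: ceiling_le_iff le_floor_iff)
  then have "finite (int ` ?A)" by (rule finite_subset) simp
  then show "finite ?A" by (rule finite_imageD) (simp add: inj_on_def)
  have "card ?A = card (int ` ?A)" by (simp add: card_image inj_on_def)
  also have "\<dots> \<le> card {\<lceil>u\<rceil>..\<lfloor>v\<rfloor>}" by (rule card_mono[OF _ sub]) simp
  finally have "real (card ?A) \<le> real (nat (\<lfloor>v\<rfloor> - \<lceil>u\<rceil> + 1))" by simp
  also have "\<dots> \<le> v - u + 1"
  proof (cases "\<lfloor>v\<rfloor> - \<lceil>u\<rceil> + 1 \<ge> 0")
    case True
    then have "real (nat (\<lfloor>v\<rfloor> - \<lceil>u\<rceil> + 1)) = of_int \<lfloor>v\<rfloor> - of_int \<lceil>u\<rceil> + 1" by simp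
    then show ?thesis using of_int_floor_le[of v] le_of_int_ceiling[of u] by linarith
  qed (use assms in simp)
  finally show "real (card ?A) \<le> v - u + 1" .
qed

text \<open>For \<open>\<eta> < 1/2\<close> the points lie in \<open>Q + 1 \<le> 2 * Q\<close>
  intervals around multiples of \<open>N / Q\<close>, each of length
  \<open>2 * \<eta> * N / Q\<close>. For larger \<open>\<eta>\<close> the bound exceeds
  \<open>N\<close>.\<close>

lemma card_near_le:
  fixes N Q :: nat
  assumes N: "N \<ge> 1" and Q: "Q \<ge> 1" and \<eta>: "\<eta> \<ge> 0"
  shows "real (card {t. t < N \<and> near \<eta> (real Q * (real t / real N))}) \<le> 4 * \<eta> * real N + 2 * real Q"
proof (cases "\<eta> < 1/2")
  case False
  have "card {t. t < N \<and> near \<eta> (real Q * (real t / real N))} \<le> card {..<N}"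
    by (intro card_mono) auto
  then have "real (card {t. t < N \<and> near \<eta> (real Q * (real t / real N))}) \<le> real N" by simp
  also have "\<dots> = 2 * (1/2) * real N" by simp
  also have "\<dots> \<le> 4 * \<eta> * real N" using False by (intro mult_right_mono) auto
  finally show ?thesis by simp
next
  case True
  define I where "I n = {t::nat. (real n - \<eta>) * real N / real Q \<le> real t \<and> real t \<le> (real n + \<eta>) * real N / real Q}"
    for n :: nat
  have iv: "(real n - \<eta>) * real N / real Q \<le> (real n + \<eta>) * real N / real Q" for n
    using \<eta> by (intro divide_right_mono mult_right_mono) auto
  have "{t. t < N \<and> near \<eta> (real Q * (real t / real N))} \<subseteq> (\<Union>n\<le>Q. I n)"
  proof safe
    fix t assume t: "t < N" and "near \<eta> (real Q * (real t / real N))"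
    then obtain n :: int where n: "\<bar>real Q * (real t / real N) - of_int n\<bar> \<le> \<eta>" by (auto simp: near_def)
    have "0 \<le> real Q * (real t / real N)" by simp
    then have "-1 < n" using n True by linarith
    then obtain n' where n': "n = int n'" using nonneg_int_cases[of n] by auto
    have "real Q * (real t / real N) \<le> real Q * 1" using t N by (intro mult_left_mono) auto
    then have "real n' < real Q + 1" using n True unfolding n' of_int_of_nat_eq by linarith
    then have "n' \<le> Q" by simp
    moreover have "t \<in> I n'"
    proof -
      have "(real n' - \<eta>) \<le> real Q * (real t / real N)" "real Q * (real t / real N) \<le> real n' + \<eta>"
        using n unfolding n' of_int_of_nat_eq by linarith+
      then show ?thesis using N Q by (simp add: I_def field_simps)
    qed
    ultimately show "t \<in> (\<Union>n\<le>Q. I n)" by blast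
  qed
  then have "card {t. t < N \<and> near \<eta> (real Q * (real t / real N))} \<le> card (\<Union>n\<le>Q. I n)"
    unfolding I_def by (intro card_mono finite_UN_I card_nat_interval_le iv) auto
  also have "\<dots> \<le> (\<Sum>n\<le>Q. card (I n))" by (rule card_UN_le) simp
  finally have "real (card {t. t < N \<and> near \<eta> (real Q * (real t / real N))}) \<le> (\<Sum>n\<le>Q. real (card (I n)))"
    unfolding of_nat_sum[symmetric] by (rule of_nat_mono)
  also have "\<dots> \<le> (\<Sum>n\<le>Q. 2 * \<eta> * real N / real Q + 1)"
  proof (rule sum_mono)
    fix n
    have "real (card (I n)) \<le> (real n + \<eta>) * real N / real Q - (real n - \<eta>) * real N / real Q + 1"
      unfolding I_def by (rule card_nat_interval_le(2)[OF iv])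
    also have "\<dots> = 2 * \<eta> * real N / real Q + 1" by (simp add: algebra_simps diff_divide_distrib add_divide_distrib)
    finally show "real (card (I n)) \<le> 2 * \<eta> * real N / real Q + 1" .
  qed
  also have "\<dots> = (real Q + 1) / real Q * (2 * \<eta> * real N) + (real Q + 1)"
    by (simp add: algebra_simps)
  also have "\<dots> \<le> 2 * (2 * \<eta> * real N) + (real Q + real Q)"
    using Q \<eta> by (intro add_mono mult_right_mono) (auto simp: divide_le_eq)
  finally show ?thesis by simp
qed

text \<open>A union bound over the denominators; \<open>large\<close> absorbs the discretisation
  error by raising the constant 4 to 5.\<close>

lemma card_rational_approx_le:
  fixes N M Q :: nat
  assumes N: "N \<ge> 1" and M: "M \<ge> 1" and \<eta>: "\<eta> \<ge> 0" and large: "2 * real Q * real M \<le> \<eta> * real N"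
  shows "real (card {t. t < N \<and> rational_approx Q \<eta> (real M * (real t / real N))}) \<le> 5 * real Q * \<eta> * real N"
proof -
  let ?S = "\<lambda>q. {t. t < N \<and> near \<eta> (real (q * M) * (real t / real N))}"
  have "{t. t < N \<and> rational_approx Q \<eta> (real M * (real t / real N))} \<subseteq> (\<Union>q\<in>{1..Q}. ?S q)"
    by (auto simp: rational_approx_def mult.assoc)
  then have "card {t. t < N \<and> rational_approx Q \<eta> (real M * (real t / real N))} \<le> card (\<Union>q\<in>{1..Q}. ?S q)"
    by (intro card_mono finite_UN_I) auto
  also have "\<dots> \<le> (\<Sum>q\<in>{1..Q}. card (?S q))" by (rule card_UN_le) simp
  finally have "real (card {t. t < N \<and> rational_approx Q \<eta> (real M * (real t / real N))})
      \<le> (\<Sum>q\<in>{1..Q}. real (card (?S q)))"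
    unfolding of_nat_sum[symmetric] by (rule of_nat_mono)
  also have "\<dots> \<le> (\<Sum>q\<in>{1..Q}. 5 * \<eta> * real N)"
  proof (rule sum_mono)
    fix q assume q: "q \<in> {1..Q}"
    have "real (card (?S q)) \<le> 4 * \<eta> * real N + 2 * real (q * M)"
      using q M by (intro card_near_le N \<eta>) auto
    also have "2 * real (q * M) \<le> 2 * real Q * real M"
      using q by (simp add: mult_right_mono)
    finally show "real (card (?S q)) \<le> 5 * \<eta> * real N" using large by linarith
  qed
  finally show ?thesis by simp
qed

text \<open>Dyadic decomposition: the level around \<open>(1/2) ^ i\<close> contributes at most
  \<open>N * \<delta> * \<beta>\<close> times \<open>(\<beta> / 2 ^ \<tau>) ^ i\<close>, a geometric
  series of ratio at most \<open>1/2\<close>. Values below \<open>(1/2) ^ Y\<close> contribute at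
  most \<open>\<delta>\<close> each.\<close>

lemma moment_le:
  fixes \<phi> :: "nat \<Rightarrow> real" and \<beta> \<delta> :: real
  assumes \<phi>: "\<And>t. 0 \<le> \<phi> t" "\<And>t. \<phi> t \<le> 1" and \<delta>: "0 \<le> \<delta>" and \<beta>: "1 \<le> \<beta>"
    and level: "\<And>y. y \<ge> 1 \<Longrightarrow> real (card {t. t < N \<and> (1/2) ^ y \<le> \<phi> t}) \<le> real N * \<delta> * \<beta> ^ y"
    and \<tau>: "2 * \<beta> \<le> 2 ^ \<tau>" and Y: "Y \<ge> 1" "(1/2) ^ (Y * \<tau>) \<le> \<delta>"
  shows "(\<Sum>t<N. \<phi> t ^ \<tau>) \<le> real N * \<delta> * 2 ^ (\<tau> + 1)"
proof -
  have pt: "\<phi> t ^ \<tau> \<le> (\<Sum>i<Y. (1/2) ^ (i * \<tau>) * (if (1/2) ^ Suc i \<le> \<phi> t then 1 else 0)) + (1/2) ^ (Y * \<tau>)" for t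
  proof (cases "(1/2) ^ Y \<le> \<phi> t")
    case False
    then have "\<phi> t ^ \<tau> \<le> ((1/2) ^ Y) ^ \<tau>" using \<phi>(1) by (intro power_mono) auto
    moreover have "0 \<le> (\<Sum>i<Y. (1/2) ^ (i * \<tau>) * (if (1/2) ^ Suc i \<le> \<phi> t then 1 else 0 :: real))"
      by (intro sum_nonneg) auto
    ultimately show ?thesis by (simp only: power_mult)
  next
    case True
    define P where "P i \<longleftrightarrow> (1/2) ^ Suc i \<le> \<phi> t" for i
    \<comment> \<open>The dyadic level of \<open>\<phi> t\<close>: by minimality its value lies
      between \<open>(1/2) ^ Suc i\<close> and \<open>(1/2) ^ i\<close>.\<close>
    define i where "i = (LEAST i. P i)"
    have *: "P (Y - 1)" using True Y(1) by (simp add: P_def)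
    have i: "(1/2) ^ Suc i \<le> \<phi> t" using LeastI[of P, OF *] by (simp only: P_def i_def)
    have "i \<le> Y - 1" unfolding i_def by (rule Least_le[of P, OF *])
    then have iY: "i < Y" using Y(1) by simp
    have "\<phi> t \<le> (1/2) ^ i"
    proof (cases i)
      case (Suc i')
      then have "\<not> P i'" using not_less_Least[of i' P] unfolding i_def by simp
      then show ?thesis using Suc by (simp add: P_def)
    qed (use \<phi> in simp)
    then have "\<phi> t ^ \<tau> \<le> ((1/2) ^ i) ^ \<tau>" using \<phi>(1) by (intro power_mono) auto
    also have "\<dots> = (1/2) ^ (i * \<tau>) * (if (1/2) ^ Suc i \<le> \<phi> t then 1 else 0)"
      using i by (simp add: power_mult)
    also have "\<dots> \<le> (\<Sum>i<Y. (1/2) ^ (i * \<tau>) * (if (1/2) ^ Suc i \<le> \<phi> t then 1 else 0))"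
      using iY by (intro member_le_sum) auto
    also have "\<dots> \<le> \<dots> + (1/2) ^ (Y * \<tau>)" by simp
    finally show ?thesis .
  qed
  have "(\<Sum>t<N. \<phi> t ^ \<tau>) \<le> (\<Sum>t<N. (\<Sum>i<Y. (1/2) ^ (i * \<tau>) * (if (1/2) ^ Suc i \<le> \<phi> t then 1 else 0)) + (1/2) ^ (Y * \<tau>))"
    by (intro sum_mono pt)
  also have "\<dots> = (\<Sum>i<Y. (1/2) ^ (i * \<tau>) * (\<Sum>t<N. if (1/2) ^ Suc i \<le> \<phi> t then 1 else 0)) + real N * (1/2) ^ (Y * \<tau>)"
    unfolding sum.distrib sum_distrib_left by (subst sum.swap) simp
  also have "\<dots> \<le> (\<Sum>i<Y. (real N * \<delta> * \<beta>) * (1/2) ^ i) + real N * \<delta>"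
  proof (rule add_mono)
    show "(\<Sum>i<Y. (1/2) ^ (i * \<tau>) * (\<Sum>t<N. if (1/2) ^ Suc i \<le> \<phi> t then 1 else 0))
        \<le> (\<Sum>i<Y. (real N * \<delta> * \<beta>) * (1/2) ^ i)"
    proof (rule sum_mono)
      fix i
      have "(\<Sum>t<N. if (1/2) ^ Suc i \<le> \<phi> t then 1 else 0 :: real) = real (card {t. t < N \<and> (1/2) ^ Suc i \<le> \<phi> t})"
        by (simp add: sum.If_cases Int_def)
      also have "\<dots> \<le> real N * \<delta> * \<beta> ^ Suc i" by (rule level) simp
      finally have "(1/2) ^ (i * \<tau>) * (\<Sum>t<N. if (1/2) ^ Suc i \<le> \<phi> t then 1 else 0)
          \<le> (1/2) ^ (i * \<tau>) * (real N * \<delta> * \<beta> ^ Suc i)"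
        by (rule mult_left_mono) simp
      also have "\<dots> = (real N * \<delta> * \<beta>) * (\<beta> * (1/2) ^ \<tau>) ^ i"
      proof -
        have "i * \<tau> = \<tau> * i" by simp
        then have "(1/2 :: real) ^ (i * \<tau>) = ((1/2) ^ \<tau>) ^ i" by (simp only: power_mult)
        then show ?thesis by (simp only: power_mult_distrib power_Suc ac_simps)
      qed
      also have "\<dots> \<le> (real N * \<delta> * \<beta>) * (1/2) ^ i"
      proof (intro mult_left_mono power_mono)
        show "\<beta> * (1/2) ^ \<tau> \<le> 1/2" using \<tau> by (simp add: power_divide divide_le_eq)
      qed (use \<beta> \<delta> in auto)
      finally show "(1/2) ^ (i * \<tau>) * (\<Sum>t<N. if (1/2) ^ Suc i \<le> \<phi> t then 1 else 0)
          \<le> (real N * \<delta> * \<beta>) * (1/2) ^ i" .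
    qed
    show "real N * (1/2) ^ (Y * \<tau>) \<le> real N * \<delta>" by (rule mult_left_mono[OF Y(2)]) simp
  qed
  also have "\<dots> \<le> real N * \<delta> * \<beta> * 2 + real N * \<delta>"
  proof (rule add_right_mono)
    have "(\<Sum>i<Y. (1/2) ^ i) = 2 - 2 * (1/2 :: real) ^ Y" by (induction Y) auto
    then have "(\<Sum>i<Y. (1/2) ^ i) \<le> (2 :: real)" by simp
    then have "real N * \<delta> * \<beta> * (\<Sum>i<Y. (1/2) ^ i) \<le> real N * \<delta> * \<beta> * 2"
      using \<beta> \<delta> by (intro mult_left_mono) simp_all
    then show "(\<Sum>i<Y. (real N * \<delta> * \<beta>) * (1/2) ^ i) \<le> real N * \<delta> * \<beta> * 2"
      by (simp only: sum_distrib_left)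
  qed
  also have "\<dots> = real N * \<delta> * (2 * \<beta> + 1)" by (simp only: distrib_left mult_1_right ac_simps)
  also have "\<dots> \<le> real N * \<delta> * 2 ^ (\<tau> + 1)"
  proof (rule mult_left_mono)
    have "(1 :: real) \<le> 2 ^ \<tau>" by simp
    then have "2 * \<beta> + 1 \<le> 2 * 2 ^ \<tau>" using \<tau> by linarith
    then show "2 * \<beta> + 1 \<le> 2 ^ (\<tau> + 1)" by simp
  qed (use \<delta> in simp)
  finally show ?thesis .
qed

text \<open>Where \<open>\<phi> t < 1 - 1 / n\<close>, raising to the power \<open>n\<close> gains a
  factor \<open>1/2\<close>; so \<open>n * \<sigma>\<close> additional powers cancel the constant
  \<open>2 ^ \<sigma>\<close>. The remaining points are merely counted.\<close>

lemma high_moment_le: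
  fixes \<phi> :: "nat \<Rightarrow> real"
  assumes \<phi>: "\<And>t. 0 \<le> \<phi> t" "\<And>t. \<phi> t \<le> 1" and n: "n \<ge> 1"
    and moment: "(\<Sum>t<N. \<phi> t ^ \<tau>) \<le> K * 2 ^ \<sigma>"
    and top: "real (card {t. t < N \<and> 1 - 1 / real n \<le> \<phi> t}) \<le> K'" and K: "0 \<le> K"
  shows "(\<Sum>t<N. \<phi> t ^ (\<tau> + n * \<sigma>)) \<le> K + K'"
proof -
  have "(\<Sum>t<N. \<phi> t ^ (\<tau> + n * \<sigma>)) \<le> (\<Sum>t<N. \<phi> t ^ \<tau> * (1/2) ^ \<sigma> + (if 1 - 1 / real n \<le> \<phi> t then 1 else 0))"
  proof (rule sum_mono)
    fix t
    show "\<phi> t ^ (\<tau> + n * \<sigma>) \<le> \<phi> t ^ \<tau> * (1/2) ^ \<sigma> + (if 1 - 1 / real n \<le> \<phi> t then 1 else 0)"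
    proof (cases "1 - 1 / real n \<le> \<phi> t")
      case True
      moreover have "\<phi> t ^ (\<tau> + n * \<sigma>) \<le> 1" using \<phi> by (simp add: power_le_one)
      ultimately show ?thesis using \<phi>(1) by (simp add: add_increasing)
    next
      case False
      then have "\<phi> t ^ n \<le> (1 - 1 / real n) ^ n" using \<phi>(1) by (intro power_mono) auto
      also have "\<dots> \<le> 1/2" by (rule power_one_minus_inverse_le_half[OF n])
      finally have "(\<phi> t ^ n) ^ \<sigma> \<le> (1/2) ^ \<sigma>" using \<phi>(1) by (intro power_mono) auto
      then have "\<phi> t ^ \<tau> * (\<phi> t ^ n) ^ \<sigma> \<le> \<phi> t ^ \<tau> * (1/2) ^ \<sigma>" using \<phi>(1) by (intro mult_left_mono) auto
      then show ?thesis using False by (simp add: power_add power_mult)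
    qed
  qed
  also have "\<dots> = (\<Sum>t<N. \<phi> t ^ \<tau>) * (1/2) ^ \<sigma> + real (card {t. t < N \<and> 1 - 1 / real n \<le> \<phi> t})"
    by (simp add: sum.distrib sum_distrib_right sum.If_cases Int_def)
  also have "\<dots> \<le> K * 2 ^ \<sigma> * (1/2) ^ \<sigma> + K'"
    using moment top by (intro add_mono mult_right_mono) auto
  finally show ?thesis by (simp add: power_divide)
qed

text \<open>\<open>char_on A F\<close>: \<open>F\<close> is the Fourier transform of a finitely supported probability measure on \<open>A\<close>.\<close>

definition char_on :: "nat set \<Rightarrow> (real \<Rightarrow> complex) \<Rightarrow> bool" where
  "char_on A F \<longleftrightarrow> (\<exists>X \<mu>. finite X \<and> X \<subseteq> A \<and> (\<forall>n\<in>X. 0 \<le> \<mu> n) \<and> (\<Sum>n\<in>X. \<mu> n) = 1 \<and>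
     (\<forall>\<theta>. F \<theta> = (\<Sum>n\<in>X. of_real (\<mu> n) * unit_exp (\<theta> * real n))))"

text \<open>The values \<open>a i\<close> may coincide: the measure is the image of the weights
  under \<open>a\<close>.\<close>

lemma char_onI:
  fixes w :: "'i \<Rightarrow> real" and a :: "'i \<Rightarrow> nat"
  assumes fin: "finite I" and a: "\<And>i. i \<in> I \<Longrightarrow> a i \<in> A" and w: "\<And>i. i \<in> I \<Longrightarrow> 0 \<le> w i"
    and sum: "(\<Sum>i\<in>I. w i) = 1"
    and F: "\<And>\<theta>. F \<theta> = (\<Sum>i\<in>I. of_real (w i) * unit_exp (\<theta> * real (a i)))"
  shows "char_on A F"
proof -
  define \<mu> where "\<mu> n = (\<Sum>i\<in>{i\<in>I. a i = n}. w i)" for n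
  have "F \<theta> = (\<Sum>n\<in>a ` I. of_real (\<mu> n) * unit_exp (\<theta> * real n))" for \<theta>
  proof -
    have "F \<theta> = (\<Sum>n\<in>a ` I. \<Sum>i\<in>{i\<in>I. a i = n}. of_real (w i) * unit_exp (\<theta> * real (a i)))"
      unfolding F by (rule sum.image_gen[OF fin])
    also have "\<dots> = (\<Sum>n\<in>a ` I. of_real (\<mu> n) * unit_exp (\<theta> * real n))"
      unfolding \<mu>_def of_real_sum sum_distrib_right by (intro sum.cong) auto
    finally show ?thesis .
  qed
  moreover have "(\<Sum>n\<in>a ` I. \<mu> n) = 1"
    using sum sum.image_gen[OF fin, of w a] by (simp add: \<mu>_def)
  moreover have "\<forall>n\<in>a ` I. 0 \<le> \<mu> n" unfolding \<mu>_def using w by (auto intro!: sum_nonneg)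
  moreover have "finite (a ` I)" "a ` I \<subseteq> A" using fin a by auto
  ultimately show ?thesis unfolding char_on_def by blast
qed

lemma char_on_mean:
  assumes "\<And>T. T \<subseteq> {..<m} \<Longrightarrow> char_on A (G T)"
  shows "char_on A (\<lambda>\<theta>. mean m (\<lambda>T. G T \<theta>))"
proof -
  define R where "R F p \<longleftrightarrow> finite (fst p) \<and> fst p \<subseteq> A \<and> (\<forall>n\<in>fst p. 0 \<le> snd p n) \<and> (\<Sum>n\<in>fst p. snd p n) = (1 :: real) \<and>
     (\<forall>\<theta>. F \<theta> = (\<Sum>n\<in>fst p. of_real (snd p n) * unit_exp (\<theta> * real n)))" for F p
  have "\<forall>T\<in>Pow {..<m}. \<exists>p. R (G T) p"
    using assms unfolding char_on_def R_def by simp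
  from bchoice[OF this] obtain p where p: "\<forall>T\<in>Pow {..<m}. R (G T) (p T)" by blast
  define X where "X T = fst (p T)" for T
  define \<mu> where "\<mu> T = snd (p T)" for T
  have fin: "finite (X T)" and sub: "X T \<subseteq> A" and nonneg: "\<And>n. n \<in> X T \<Longrightarrow> 0 \<le> \<mu> T n"
    and sum: "(\<Sum>n\<in>X T. \<mu> T n) = 1"
    and G: "\<And>\<theta>. G T \<theta> = (\<Sum>n\<in>X T. of_real (\<mu> T n) * unit_exp (\<theta> * real n))"
    if "T \<in> Pow {..<m}" for T
    using bspec[OF p that] unfolding R_def X_def \<mu>_def by blast+
  let ?I = "Sigma (Pow {..<m}) X"
  show ?thesis
  proof (rule char_onI[of ?I snd _ "\<lambda>p. \<mu> (fst p) (snd p) / 2 ^ m"])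
    show "finite ?I" using fin by (intro finite_SigmaI) simp_all
    show "snd p \<in> A" if "p \<in> ?I" for p
    proof -
      have "fst p \<in> Pow {..<m}" "snd p \<in> X (fst p)" using that by auto
      then show ?thesis using sub by blast
    qed
    show "0 \<le> \<mu> (fst p) (snd p) / 2 ^ m" if "p \<in> ?I" for p
    proof -
      have "fst p \<in> Pow {..<m}" "snd p \<in> X (fst p)" using that by auto
      then show ?thesis using nonneg by simp
    qed
    have *: "(\<Sum>p\<in>?I. h (fst p) (snd p)) = (\<Sum>T\<in>Pow {..<m}. \<Sum>n\<in>X T. h T n)"
      for h :: "nat set \<Rightarrow> nat \<Rightarrow> 'b::comm_monoid_add"
    proof -
      have "(\<Sum>T\<in>Pow {..<m}. \<Sum>n\<in>X T. h T n) = (\<Sum>(T, n)\<in>?I. h T n)"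
        using fin by (intro sum.Sigma) simp_all
      then show ?thesis by (simp only: case_prod_unfold)
    qed
    have "(\<Sum>p\<in>?I. \<mu> (fst p) (snd p) / 2 ^ m) = (\<Sum>T\<in>Pow {..<m}. \<Sum>n\<in>X T. \<mu> T n / 2 ^ m)"
      by (rule *)
    also have "\<dots> = (\<Sum>T\<in>Pow {..<m}. 1 / 2 ^ m)"
      by (intro sum.cong refl) (simp only: sum_divide_distrib[symmetric] sum)
    finally show "(\<Sum>p\<in>?I. \<mu> (fst p) (snd p) / 2 ^ m) = 1" by (simp add: card_Pow)
    fix \<theta>
    have "mean m (\<lambda>T. G T \<theta>) = (\<Sum>T\<in>Pow {..<m}. \<Sum>n\<in>X T. of_real (\<mu> T n / 2 ^ m) * unit_exp (\<theta> * real n))"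
      unfolding mean_def sum_divide_distrib
      by (intro sum.cong refl) (simp add: G sum_divide_distrib)
    also have "\<dots> = (\<Sum>p\<in>?I. of_real (\<mu> (fst p) (snd p) / 2 ^ m) * unit_exp (\<theta> * real (snd p)))"
      by (rule *[symmetric])
    finally show "mean m (\<lambda>T. G T \<theta>) = \<dots>" .
  qed
qed

text \<open>Convolution of the two measures.\<close>

lemma char_on_mult:
  assumes "char_on A F" "char_on A' F'" "\<And>n n'. n \<in> A \<Longrightarrow> n' \<in> A' \<Longrightarrow> n + n' \<in> A''"
  shows "char_on A'' (\<lambda>\<theta>. F \<theta> * F' \<theta>)"
proof -
  obtain X \<mu> where X: "finite X" "X \<subseteq> A" "\<forall>n\<in>X. 0 \<le> \<mu> n" "(\<Sum>n\<in>X. \<mu> n) = 1"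
    "\<And>\<theta>. F \<theta> = (\<Sum>n\<in>X. of_real (\<mu> n) * unit_exp (\<theta> * real n))"
    using assms(1) unfolding char_on_def by blast
  obtain X' \<mu>' where X': "finite X'" "X' \<subseteq> A'" "\<forall>n\<in>X'. 0 \<le> \<mu>' n" "(\<Sum>n\<in>X'. \<mu>' n) = 1"
    "\<And>\<theta>. F' \<theta> = (\<Sum>n\<in>X'. of_real (\<mu>' n) * unit_exp (\<theta> * real n))"
    using assms(2) unfolding char_on_def by blast
  show ?thesis
  proof (rule char_onI[of "X \<times> X'" "\<lambda>p. fst p + snd p" _ "\<lambda>p. \<mu> (fst p) * \<mu>' (snd p)"])
    have "(\<Sum>p\<in>X \<times> X'. \<mu> (fst p) * \<mu>' (snd p)) = (\<Sum>n\<in>X. \<mu> n) * (\<Sum>n\<in>X'. \<mu>' n)"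
      unfolding sum_product by (simp add: sum.cartesian_product case_prod_beta)
    then show "(\<Sum>p\<in>X \<times> X'. \<mu> (fst p) * \<mu>' (snd p)) = 1" using X(4) X'(4) by simp
    fix \<theta>
    show "F \<theta> * F' \<theta> = (\<Sum>p\<in>X \<times> X'. of_real (\<mu> (fst p) * \<mu>' (snd p)) * unit_exp (\<theta> * real (fst p + snd p)))"
      unfolding X(5) X'(5) sum_product
      by (simp add: sum.cartesian_product case_prod_beta distrib_left unit_exp_add ac_simps)
    show "fst p + snd p \<in> A''" if "p \<in> X \<times> X'" for p
      using that X(2) X'(2) by (intro assms(3)) auto
  qed (use X(1,3) X'(1,3) in auto)
qed

lemma char_on_mean_shift:
  assumes "\<And>T. (\<And>i. i < j \<Longrightarrow> T i \<subseteq> {..<m}) \<Longrightarrow> g (\<Sum>i<j. c i * real (digit_sum B (T i))) \<in> real ` A"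
  shows "char_on A (\<lambda>\<theta>. mean_shift c B m j (\<lambda>x. unit_exp (\<theta> * g x)))"
  using assms
proof (induction j arbitrary: g)
  case 0
  then obtain n where "n \<in> A" "g 0 = real n" by auto
  then show ?case by (intro char_onI[of "{n}" id _ "\<lambda>_. 1"]) auto
next
  case (Suc j)
  show ?case
    unfolding mean_shift.simps
  proof (intro char_on_mean Suc.IH)
    fix T T' assume T: "T \<subseteq> {..<m}" and T': "\<And>i. i < j \<Longrightarrow> T' i \<subseteq> {..<m}"
    have "g (\<Sum>i<Suc j. c i * real (digit_sum B ((T'(j := T)) i))) \<in> real ` A"
      using T T' by (intro Suc.prems) (auto simp: less_Suc_eq)
    moreover have "(\<Sum>i<j. c i * real (digit_sum B ((T'(j := T)) i))) = (\<Sum>i<j. c i * real (digit_sum B (T' i)))"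
      by (intro sum.cong) auto
    ultimately show "g ((\<Sum>i<j. c i * real (digit_sum B (T' i))) + c j * real (digit_sum B T)) \<in> real ` A"
      by simp
  qed
qed

section \<open>Parseval's identity on a finite grid\<close>

lemma unit_exp_eq_1_iff: "unit_exp x = 1 \<longleftrightarrow> x \<in> \<int>"
proof
  assume "unit_exp x = 1"
  then have "cos (2 * pi * x) = 1" by (simp add: unit_exp_def complex_eq_iff)
  then obtain n :: int where "2 * pi * x = of_int n * 2 * pi" using cos_one_2pi_int by auto
  then have "x = of_int n" by simp
  then show "x \<in> \<int>" by simp
next
  assume "x \<in> \<int>"
  then show "unit_exp x = 1" by (auto simp: unit_exp_def cis_multiple_2pi elim!: Ints_cases)
qed

lemma unit_exp_power: "unit_exp x ^ n = unit_exp (real n * x)"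
  by (simp add: unit_exp_def Complex.DeMoivre ac_simps)

lemma sum_unit_exp_orthogonal:
  assumes "a < N" "b < N"
  shows "(\<Sum>t<N. unit_exp (real t / real N * real a) * cnj (unit_exp (real t / real N * real b))) =
    (if a = b then of_nat N else 0)"
proof -
  have term_eq: "unit_exp (real t / real N * real a) * cnj (unit_exp (real t / real N * real b)) =
      unit_exp ((real a - real b) / real N) ^ t" for t
    unfolding unit_exp_diff[symmetric] unit_exp_power by (simp add: algebra_simps diff_divide_distrib)
  show ?thesis
  proof (cases "a = b")
    case True
    then show ?thesis unfolding term_eq by (simp add: unit_exp_def)
  next
    case False
    have "(real a - real b) / real N \<notin> \<int>"
    proof
      assume "(real a - real b) / real N \<in> \<int>"
      then obtain n :: int where "(real a - real b) / real N = of_int n" by (auto elim: Ints_cases)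
      then have "real_of_int (int a - int b) = real_of_int (n * int N)" using assms by (simp add: field_simps)
      then have n: "int a - int b = n * int N" by (simp only: of_int_eq_iff)
      have "\<bar>int a - int b\<bar> < int N" using assms by linarith
      then have "\<bar>n\<bar> * int N < 1 * int N" unfolding n abs_mult by simp
      then have "\<bar>n\<bar> < 1" by (rule mult_right_less_imp_less) simp
      then show False using n False by simp
    qed
    then have ne: "unit_exp ((real a - real b) / real N) \<noteq> 1" by (simp add: unit_exp_eq_1_iff)
    have "unit_exp ((real a - real b) / real N) ^ N = unit_exp (real_of_int (int a - int b))"
      using assms by (simp add: unit_exp_power)
    also have "\<dots> = 1" unfolding unit_exp_eq_1_iff by simp
    finally show ?thesis unfolding term_eq using False ne by (simp add: sum_gp_strict)
  qed
qed

text \<open>Since \<open>A\<close> lies below \<open>N\<close>, nothing wraps around modulo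
  \<open>N\<close>, and Parseval bounds the sum of the squared weights by \<open>\<epsilon>\<close>.
  Cauchy-Schwarz against the total mass 1 then bounds the size of the support from below.\<close>

lemma char_on_card:
  assumes F: "char_on A F" and A: "A \<subseteq> {..<N}"
    and energy: "(\<Sum>t<N. (norm (F (real t / real N)))\<^sup>2) \<le> real N * \<epsilon>" and N: "N \<ge> 1"
  shows "1 \<le> \<epsilon> * real (card A)"
proof -
  obtain X \<mu> where X: "finite X" "X \<subseteq> A" "\<forall>n\<in>X. 0 \<le> \<mu> n" "(\<Sum>n\<in>X. \<mu> n) = 1"
    "\<And>\<theta>. F \<theta> = (\<Sum>n\<in>X. of_real (\<mu> n) * unit_exp (\<theta> * real n))"
    using F unfolding char_on_def by blast
  have "complex_of_real (\<Sum>t<N. (norm (F (real t / real N)))\<^sup>2) =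
      (\<Sum>t<N. \<Sum>a\<in>X. \<Sum>b\<in>X. of_real (\<mu> a * \<mu> b) *
        (unit_exp (real t / real N * real a) * cnj (unit_exp (real t / real N * real b))))"
    unfolding of_real_sum complex_norm_square X(5) cnj_sum sum_product
    by (intro sum.cong) (auto simp: ac_simps)
  also have "\<dots> = (\<Sum>a\<in>X. \<Sum>b\<in>X. of_real (\<mu> a * \<mu> b) *
        (\<Sum>t<N. unit_exp (real t / real N * real a) * cnj (unit_exp (real t / real N * real b))))"
    (is "?l = _")
  proof -
    have "?l = (\<Sum>a\<in>X. \<Sum>t<N. \<Sum>b\<in>X. of_real (\<mu> a * \<mu> b) *
        (unit_exp (real t / real N * real a) * cnj (unit_exp (real t / real N * real b))))"
      by (rule sum.swap)
    also have "\<dots> = (\<Sum>a\<in>X. \<Sum>b\<in>X. \<Sum>t<N. of_real (\<mu> a * \<mu> b) *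
        (unit_exp (real t / real N * real a) * cnj (unit_exp (real t / real N * real b))))"
      by (intro sum.cong refl sum.swap)
    finally show ?thesis by (simp only: sum_distrib_left)
  qed
  also have "\<dots> = (\<Sum>a\<in>X. \<Sum>b\<in>X. of_real (\<mu> a * \<mu> b) * (if a = b then of_nat N else 0))"
    using X(2) A by (intro sum.cong refl arg_cong2[where f="(*)"] sum_unit_exp_orthogonal) auto
  also have "\<dots> = of_real (real N * (\<Sum>a\<in>X. (\<mu> a)\<^sup>2))"
    using X(1) by (simp add: sum_distrib_left if_distrib[of "\<lambda>x. _ * x"] power2_eq_square mult.commute cong: if_cong)
  finally have "(\<Sum>t<N. (norm (F (real t / real N)))\<^sup>2) = real N * (\<Sum>a\<in>X. (\<mu> a)\<^sup>2)"
    by (simp only: of_real_eq_iff)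
  with energy N have le: "(\<Sum>a\<in>X. (\<mu> a)\<^sup>2) \<le> \<epsilon>" by simp
  have "1 = (\<Sum>n\<in>X. \<mu> n)\<^sup>2" by (simp add: X(4))
  also have "\<dots> \<le> (\<Sum>a\<in>X. (\<mu> a)\<^sup>2) * real (card X)" by (rule sum_squared_le_sum_of_squares)
  also have "\<dots> \<le> \<epsilon> * real (card A)"
  proof (intro mult_mono le of_nat_mono card_mono X(2))
    show "finite A" using A finite_subset by blast
    show "0 \<le> \<epsilon>" using le sum_nonneg[of X "\<lambda>a. (\<mu> a)\<^sup>2"] by simp
  qed simp
  finally show ?thesis .
qed

section \<open>Digits\<close>

lemma digit_expansion_less:
  assumes "b \<ge> 1" "\<And>p. p < n \<Longrightarrow> c p < b"
  shows "(\<Sum>p<n. c p * b ^ p) < (b::nat) ^ n"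
  using assms(2)
proof (induction n)
  case (Suc n)
  have "(\<Sum>p<Suc n. c p * b ^ p) < b ^ n + c n * b ^ n" using Suc by simp
  also have "\<dots> = Suc (c n) * b ^ n" by simp
  also have "\<dots> \<le> b * b ^ n" using Suc.prems[of n] by (intro mult_right_mono) auto
  finally show ?case by simp
qed simp

lemma digit_of_expansion:
  assumes "\<And>p. p < n \<Longrightarrow> c p < b" "i < n"
  shows "(\<Sum>p<n. c p * b ^ p) div b ^ i mod b = (c i :: nat)"
  using assms
proof (induction i arbitrary: c n)
  case 0
  then obtain n' where n: "n = Suc n'" by (cases n) auto
  have "(\<Sum>p<n. c p * b ^ p) = c 0 + b * (\<Sum>p<n'. c (Suc p) * b ^ p)"
    unfolding n sum.lessThan_Suc_shift by (simp add: sum_distrib_left ac_simps)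
  then show ?case using 0 by simp
next
  case (Suc i)
  then obtain n' where n: "n = Suc n'" by (cases n) auto
  have "(\<Sum>p<n. c p * b ^ p) = c 0 + b * (\<Sum>p<n'. c (Suc p) * b ^ p)"
    unfolding n sum.lessThan_Suc_shift by (simp add: sum_distrib_left ac_simps)
  moreover have "c 0 < b" using Suc.prems(1)[of 0] n by simp
  ultimately have "(\<Sum>p<n. c p * b ^ p) div b = (\<Sum>p<n'. c (Suc p) * b ^ p)" by simp
  then have "(\<Sum>p<n. c p * b ^ p) div b ^ Suc i = (\<Sum>p<n'. c (Suc p) * b ^ p) div b ^ i"
    by (simp only: power_Suc div_mult2_eq)
  also have "\<dots> mod b = c (Suc i)"
    using Suc.prems n by (intro Suc.IH[of n' "\<lambda>p. c (Suc p)"]) auto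
  finally show ?case .
qed

lemma digit_expansion_mem_restricted_digits:
  assumes "b \<ge> 2" "\<And>p. p < n \<Longrightarrow> c p < b \<and> c p \<in> D"
  shows "(\<Sum>p<n. c p * b ^ p) \<in> restricted_digits b D"
  unfolding restricted_digits_def
proof (intro CollectI allI impI)
  fix i assume "b ^ i \<le> (\<Sum>p<n. c p * b ^ p)"
  also have "\<dots> < b ^ n" using assms by (intro digit_expansion_less) auto
  finally have "i < n" using assms(1) power_less_imp_less_exp[of b i n] by simp
  then show "(\<Sum>p<n. c p * b ^ p) div b ^ i mod b \<in> D"
    using digit_of_expansion[of n c b i] assms(2) by simp
qed

lemma sum_lessThan_mult_group:
  fixes h :: "nat \<Rightarrow> nat"
  shows "(\<Sum>p<m * k. h p) = (\<Sum>j<k. \<Sum>i<m. h (j + i * k))"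
proof -
  have "(\<Sum>p<m * k. h p) = (\<Sum>i<m. sum h {i * k..<i * k + k})" by (simp only: sum.nat_group)
  also have "\<dots> = (\<Sum>i<m. \<Sum>j<k. h (j + i * k))"
  proof (rule sum.cong[OF refl])
    fix i
    show "sum h {i * k..<i * k + k} = (\<Sum>j<k. h (j + i * k))"
      using sum.shift_bounds_nat_ivl[of h 0 "i * k" k] by (simp add: atLeast0LessThan add.commute)
  qed
  also have "\<dots> = (\<Sum>j<k. \<Sum>i<m. h (j + i * k))" by (rule sum.swap)
  finally show ?thesis .
qed

text \<open>The digit at position \<open>j + i * k\<close> is governed by the \<open>j\<close>-th of the \<open>k\<close> sets: this is the
  decomposition of a number with restricted digits into \<open>k\<close> independent summands, each of which is
  spread over the whole range of positions.\<close>

lemma interleaved_digits: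
  fixes b k m d1 d2 :: nat
  assumes k: "k \<ge> 1" and d: "d1 \<le> d2" and T: "\<And>j. j < k \<Longrightarrow> T j \<subseteq> {..<m}"
  shows "d1 * (\<Sum>p<m * k. b ^ p) + (\<Sum>j<k. (d2 - d1) * b ^ j * digit_sum (b ^ k) (T j)) =
    (\<Sum>p<m * k. (if p div k \<in> T (p mod k) then d2 else d1) * b ^ p)"
proof -
  have ds: "digit_sum (b ^ k) (T j) = (\<Sum>i<m. if i \<in> T j then (b ^ k) ^ i else 0)" if "j < k" for j
    unfolding digit_sum_def using T[OF that] by (simp add: sum.If_cases Int_absorb1)
  have "(\<Sum>p<m * k. (if p div k \<in> T (p mod k) then d2 else d1) * b ^ p) =
      (\<Sum>p<m * k. d1 * b ^ p + (d2 - d1) * (if p div k \<in> T (p mod k) then b ^ p else 0))"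
    using d by (intro sum.cong) (auto simp flip: add_mult_distrib)
  also have "\<dots> = d1 * (\<Sum>p<m * k. b ^ p) + (d2 - d1) * (\<Sum>p<m * k. if p div k \<in> T (p mod k) then b ^ p else 0)"
    by (simp only: sum.distrib sum_distrib_left)
  also have "(\<Sum>p<m * k. if p div k \<in> T (p mod k) then b ^ p else 0) = (\<Sum>j<k. b ^ j * digit_sum (b ^ k) (T j))"
    unfolding sum_lessThan_mult_group
  proof (rule sum.cong[OF refl])
    fix j assume "j \<in> {..<k}"
    then have j: "j < k" by simp
    have "(\<Sum>i<m. if (j + i * k) div k \<in> T ((j + i * k) mod k) then b ^ (j + i * k) else 0)
        = (\<Sum>i<m. b ^ j * (if i \<in> T j then (b ^ k) ^ i else 0))"
    proof (rule sum.cong[OF refl])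
      fix i
      have "(j + i * k) div k = i" "(j + i * k) mod k = j" using j by auto
      moreover have "b ^ (j + i * k) = b ^ j * (b ^ k) ^ i" by (simp add: power_add power_mult[symmetric] mult.commute)
      ultimately show "(if (j + i * k) div k \<in> T ((j + i * k) mod k) then b ^ (j + i * k) else 0)
          = b ^ j * (if i \<in> T j then (b ^ k) ^ i else 0)" by simp
    qed
    then show "(\<Sum>i<m. if (j + i * k) div k \<in> T ((j + i * k) mod k) then b ^ (j + i * k) else 0)
        = b ^ j * digit_sum (b ^ k) (T j)"
      by (simp only: ds[OF j] sum_distrib_left)
  qed
  finally show ?thesis by (simp only: sum_distrib_left mult.assoc)
qed

definition sumset :: "nat \<Rightarrow> nat set \<Rightarrow> nat set" where
  "sumset s A = {n. \<exists>xs. length xs = s \<and> set xs \<subseteq> A \<and> n = sum_list xs}"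

lemma char_on_power: "char_on A F \<Longrightarrow> char_on (sumset s A) (\<lambda>\<theta>. F \<theta> ^ s)"
proof (induction s)
  case 0
  show ?case by (rule char_onI[of "{0::nat}" id _ "\<lambda>_. 1"]) (auto simp: sumset_def unit_exp_def)
next
  case (Suc s)
  have "n + n' \<in> sumset (Suc s) A" if n: "n \<in> A" and n': "n' \<in> sumset s A" for n n'
  proof -
    obtain xs where "length xs = s" "set xs \<subseteq> A" "n' = sum_list xs"
      using n' unfolding sumset_def by blast
    then show ?thesis using n unfolding sumset_def by (intro CollectI exI[of _ "n # xs"]) auto
  qed
  from char_on_mult[OF Suc.prems Suc.IH[OF Suc.prems] this] show ?case by simp
qed

lemma sumset_le:
  assumes "n \<in> sumset s A" "\<And>a. a \<in> A \<Longrightarrow> a \<le> L"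
  shows "n \<le> s * L"
proof -
  obtain xs where xs: "length xs = s" "set xs \<subseteq> A" "n = sum_list xs"
    using assms(1) unfolding sumset_def by blast
  have "sum_list xs \<le> length xs * L"
    using xs(2) assms(2) by (induction xs) (auto intro!: add_mono)
  then show ?thesis using xs by simp
qed

lemma mean_shift_const [simp]: "mean_shift c B m j (\<lambda>_. a) = a"
  by (induction j) auto

lemma norm_mean_shift_unit_exp_le_1: "norm (mean_shift c B m j (\<lambda>x. unit_exp (g x))) \<le> 1"
proof -
  have "(norm (mean_shift c B m j (\<lambda>x. unit_exp (g x))))\<^sup>2 \<le> mean_shift c B m j (\<lambda>x. (norm (unit_exp (g x)))\<^sup>2)"
    by (rule norm_mean_shift_square_le)
  also have "\<dots> = 1" by simp
  finally show ?thesis by (simp add: power_le_one_iff abs_square_le_1)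
qed

text \<open>The bound \<open>b ^ (m * k)\<close> leaves \<open>m\<close> positions in each of the
  \<open>k\<close> residue classes, and the powers are below \<open>B ^ (k * m)\<close> with
  \<open>B = b ^ k\<close>.\<close>

definition kth_powers :: "nat \<Rightarrow> nat \<Rightarrow> nat \<Rightarrow> nat \<Rightarrow> nat \<Rightarrow> nat set" where
  "kth_powers b d1 d2 k m = {x ^ k | x. x \<in> restricted_digits b {d1, d2} \<and> x < b ^ (m * k)}"

lemma char_on_kth_powers:
  fixes b k m d1 d2 :: nat
  assumes b: "b \<ge> 2" and k: "k \<ge> 1" and d: "d1 \<le> d2" "d2 < b"
  defines "c0 \<equiv> real (d1 * (\<Sum>p<m * k. b ^ p))"
  shows "char_on (kth_powers b d1 d2 k m)
    (\<lambda>\<theta>. mean_shift (\<lambda>j. real ((d2 - d1) * b ^ j)) (b ^ k) m k (\<lambda>x. unit_exp (\<theta> * (x + c0) ^ k)))"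
proof (rule char_on_mean_shift)
  fix T assume T: "\<And>i. i < k \<Longrightarrow> T i \<subseteq> {..<m}"
  define v where "v = (\<Sum>p<m * k. (if p div k \<in> T (p mod k) then d2 else d1) * b ^ p)"
  have "v = d1 * (\<Sum>p<m * k. b ^ p) + (\<Sum>j<k. (d2 - d1) * b ^ j * digit_sum (b ^ k) (T j))"
    unfolding v_def using interleaved_digits[OF k d(1) T] by simp
  then have "(\<Sum>i<k. real ((d2 - d1) * b ^ i) * real (digit_sum (b ^ k) (T i))) + c0 = real v"
    by (simp add: c0_def)
  moreover have "v \<in> restricted_digits b {d1, d2}"
    unfolding v_def using b d by (intro digit_expansion_mem_restricted_digits) auto
  moreover have "v < b ^ (m * k)"
    unfolding v_def using b d by (intro digit_expansion_less) auto
  ultimately show "((\<Sum>i<k. real ((d2 - d1) * b ^ i) * real (digit_sum (b ^ k) (T i))) + c0) ^ k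
      \<in> real ` kth_powers b d1 d2 k m"
    unfolding kth_powers_def by (auto intro!: image_eqI[of _ _ "v ^ k"])
qed

text \<open>The coefficient of \<open>x ^ k\<close> in the phase is
  \<open>\<theta> = \<theta> * fact k / fact k\<close>, which explains \<open>fact k\<close>; the
  product collects the step sizes of the \<open>k\<close> variables.\<close>

lemma norm_power_le_box_mean:
  fixes b k m D :: nat
  assumes k: "k \<ge> 1"
  shows "norm (mean_shift (\<lambda>j. real (D * b ^ j)) B m k (\<lambda>x. unit_exp (\<theta> * (x + c0) ^ k))) ^ (2 ^ k)
    \<le> box_mean B m k (real (fact k * (\<Prod>i<k. D * b ^ i)) * \<theta>)"
proof -
  obtain j where j: "k = Suc j" using k by (cases k) auto
  have "poly_lead (Suc j) (\<theta> * fact k) (\<lambda>x. \<theta> * (x + c0) ^ k)"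
    unfolding j by (intro poly_lead_scale poly_lead_power)
  from box_inequality[OF this, of "\<lambda>j. real (D * b ^ j)" B m]
  show ?thesis by (simp add: j lessThan_Suc_atMost ac_simps del: box_mean.simps mean_shift.simps fact_Suc)
qed

section \<open>Sums of many powers\<close>

text \<open>The level sets \<open>{\<theta>. box_mean B m k \<theta> \<ge> (1/2) ^ y}\<close> have density at most
  \<open>B ^ (C * y - k * m)\<close> with \<open>C = level_exponent B k\<close>, so the moment of order
  \<open>moment_exponent B k\<close> converges. The values at most \<open>1 - 1 / gap_denominator B k\<close> become negligible after
  multiplying the order by about \<open>gap_denominator B k\<close>. An \<open>s\<close>-fold sum corresponds to
  the moment of order \<open>2 * s\<close> of the exponential sum, whose \<open>2 ^ k\<close>-th power is bounded by the box mean.\<close>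

definition level_exponent :: "nat \<Rightarrow> nat \<Rightarrow> nat" where
  "level_exponent B k = 10 * k * (k + 1) * B ^ (2 * k)"

definition moment_exponent :: "nat \<Rightarrow> nat \<Rightarrow> nat" where
  "moment_exponent B k = 1 + B * level_exponent B k"

definition gap_denominator :: "nat \<Rightarrow> nat \<Rightarrow> nat" where
  "gap_denominator B k = 64 * B\<^sup>2 * 4 ^ (k - 1)"

definition summands :: "nat \<Rightarrow> nat \<Rightarrow> nat" where
  "summands B k = 2 ^ (k - 1) *
     (moment_exponent B k + gap_denominator B k * (moment_exponent B k + 1))"

text \<open>If \<open>m < 3 * W\<close>, the right side is at least \<open>N\<close>. Otherwise the
  inverse theorem and the count of grid points give \<open>5 * B ^ (W + 3 * k * W)\<close>, which is
  at most \<open>B ^ (5 * k * W)\<close>.\<close>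

lemma card_level_set_le:
  fixes B k m M N y :: nat
  assumes B: "B \<ge> 9" and k: "k \<ge> 2" and M: "M \<ge> 1" and N: "2 * M * B ^ (m + k * m) \<le> N" "N \<ge> 1"
    and y: "y \<ge> 1"
  shows "real (card {t. t < N \<and> (1/2) ^ y \<le> box_mean B m k (real M * (real t / real N))})
    \<le> real N * (1 / real B ^ (k * m)) * (real B ^ level_exponent B k) ^ y"
proof -
  define W where "W = 2 * B ^ (2 * k) * (y + k)"
  let ?C = "level_exponent B k"
  \<comment> \<open>As \<open>y \<ge> 1\<close>, the additive \<open>k\<close> in \<open>W\<close>
    becomes a multiple of \<open>y\<close>, so that the bound is a pure \<open>y\<close>-th
    power.\<close>
  have "k * 1 \<le> k * y" using y by (rule mult_left_mono) simp
  then have "y + k \<le> (k + 1) * y" by simp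
  then have "(10 * k * B ^ (2 * k)) * (y + k) \<le> (10 * k * B ^ (2 * k)) * ((k + 1) * y)"
    by (rule mult_left_mono) simp
  moreover have "5 * k * W = (10 * k * B ^ (2 * k)) * (y + k)" by (simp add: W_def)
  moreover have "?C * y = (10 * k * B ^ (2 * k)) * ((k + 1) * y)"
    unfolding level_exponent_def by (simp only: ac_simps)
  ultimately have WC: "5 * k * W \<le> ?C * y" by (simp only:)
  have B1: "1 \<le> real B" using B by simp
  show ?thesis
  proof (cases "3 * W \<le> m")
    case False
    have "card {t. t < N \<and> (1/2) ^ y \<le> box_mean B m k (real M * (real t / real N))} \<le> card {..<N}"
      by (intro card_mono) auto
    then have "real (card {t. t < N \<and> (1/2) ^ y \<le> box_mean B m k (real M * (real t / real N))}) \<le> real N * 1"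
      by simp
    also have "\<dots> \<le> real N * (real B ^ (?C * y) / real B ^ (k * m))"
    proof (rule mult_left_mono)
      have "k * m \<le> k * (3 * W)" using False by (intro mult_left_mono) auto
      also have "\<dots> \<le> 5 * k * W" by simp
      also note WC
      finally have "real B ^ (k * m) \<le> real B ^ (?C * y)"
        by (rule power_increasing[OF _ B1])
      then show "1 \<le> real B ^ (?C * y) / real B ^ (k * m)" using B by simp
    qed simp
    finally show ?thesis by (simp add: power_mult)
  next
    case True
    let ?\<eta> = "real B ^ (3 * k * W) / real B ^ (k * m)"
    have "1 \<le> B ^ (2 * k)" using B by simp
    then have "1 * 1 \<le> B ^ (2 * k) * (y + k)" using y by (intro mult_mono) auto
    then have W1: "1 \<le> W" unfolding W_def by linarith
    have "{t. t < N \<and> (1/2) ^ y \<le> box_mean B m k (real M * (real t / real N))}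
        \<subseteq> {t. t < N \<and> rational_approx (B ^ W) ?\<eta> (real M * (real t / real N))}"
      using box_mean_inverse[OF B k, of y m] True unfolding W_def by blast
    then have "card {t. t < N \<and> (1/2) ^ y \<le> box_mean B m k (real M * (real t / real N))}
        \<le> card {t. t < N \<and> rational_approx (B ^ W) ?\<eta> (real M * (real t / real N))}"
      by (intro card_mono) auto
    then have "real (card {t. t < N \<and> (1/2) ^ y \<le> box_mean B m k (real M * (real t / real N))})
        \<le> real (card {t. t < N \<and> rational_approx (B ^ W) ?\<eta> (real M * (real t / real N))})"
      by (rule of_nat_mono)
    also have "\<dots> \<le> 5 * real (B ^ W) * ?\<eta> * real N"
    proof (rule card_rational_approx_le[OF N(2) M])
      have "real B ^ W \<le> real B ^ m" using True B1 by (intro power_increasing) auto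
      then have "2 * real (B ^ W) * real M * real B ^ (k * m) \<le> 2 * real B ^ m * real M * real B ^ (k * m)"
        by (intro mult_right_mono mult_left_mono) auto
      also have "\<dots> = real (2 * M * B ^ (m + k * m))" by (simp add: power_add)
      also have "\<dots> \<le> real N" using N(1) by (rule of_nat_mono)
      also have "\<dots> \<le> real B ^ (3 * k * W) * real N" using B1 by (simp add: mult_le_cancel_right1)
      finally show "2 * real (B ^ W) * real M \<le> ?\<eta> * real N"
        using B by (simp add: pos_le_divide_eq)
    qed simp
    also have "\<dots> = real N * (5 * real B ^ (W + 3 * k * W) / real B ^ (k * m))"
      by (simp add: power_add)
    also have "\<dots> \<le> real N * (real B ^ (?C * y) / real B ^ (k * m))"
    proof (intro mult_left_mono divide_right_mono)
      have "5 * real B ^ (W + 3 * k * W) \<le> real B * real B ^ (W + 3 * k * W)"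
        using B by (intro mult_right_mono) auto
      also have "\<dots> = real B ^ (1 + W + 3 * k * W)" by simp
      also have "\<dots> \<le> real B ^ (?C * y)"
      proof (rule power_increasing[OF _ B1])
        have "2 * W \<le> k * W" using k by (intro mult_right_mono) auto
        moreover have "5 * k * W = 3 * k * W + 2 * (k * W)" by simp
        ultimately have "1 + W + 3 * k * W \<le> 5 * k * W" using W1 by linarith
        then show "1 + W + 3 * k * W \<le> ?C * y" using WC by (rule order_trans)
      qed
      finally show "5 * real B ^ (W + 3 * k * W) \<le> real B ^ (?C * y)" .
    qed simp_all
    finally show ?thesis by (simp add: power_mult)
  qed
qed

text \<open>Here the denominator is 1. The exponent \<open>m - 1\<close> in place of
  \<open>m\<close> costs \<open>B ^ k\<close>, and the constants together with
  \<open>2 ^ (k - 1)\<close> cost at most another \<open>B ^ k\<close>.\<close>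

lemma card_top_level_set_le:
  fixes B k m M N :: nat
  assumes B: "B \<ge> 9" and k: "k \<ge> 2" and M: "M \<ge> 1" and m: "m \<ge> 2"
    and N: "2 * M * B ^ (m + k * m) \<le> N" "N \<ge> 1"
  shows "real (card {t. t < N \<and> 1 - 1 / real (gap_denominator B k) \<le> box_mean B m k (real M * (real t / real N))})
    \<le> real N * (1 / real B ^ (k * m)) * real B ^ (2 * k)"
proof -
  define \<eta> where "\<eta> = 2 ^ (k - 1) / (8 * real B * real B ^ (k * (m - 1)))"
  have B1: "1 \<le> real B" using B by simp
  have km: "real B ^ (k * m) = real B ^ (k * (m - 1)) * real B ^ k"
    using m by (cases m) (auto simp: power_add algebra_simps)
  have two: "(2::real) ^ (k - 1) \<le> real B ^ k"
  proof -
    have "(2::real) ^ (k - 1) \<le> 2 ^ k" by (intro power_increasing) auto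
    also have "\<dots> \<le> real B ^ k" using B by (intro power_mono) auto
    finally show ?thesis .
  qed
  have lower: "1 / real B ^ (k * m) \<le> \<eta>"
  proof -
    have "8 * real B \<le> real B * real B" using B by (intro mult_right_mono) auto
    also have "\<dots> = real B ^ 2" by (simp add: power2_eq_square)
    also have "\<dots> \<le> real B ^ k" using k B1 by (intro power_increasing) auto
    also have "\<dots> \<le> 2 ^ (k - 1) * real B ^ k"
      using mult_right_mono[of 1 "2 ^ (k - 1)" "real B ^ k"] by simp
    finally have "8 * real B \<le> 2 ^ (k - 1) * real B ^ k" .
    then show ?thesis unfolding \<eta>_def km using B by (simp add: field_simps)
  qed
  have upper: "5 * \<eta> \<le> 1 / real B ^ (k * m) * real B ^ (2 * k)"
  proof -
    have "5 * 2 ^ (k - 1) \<le> 8 * real B * real B ^ k"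
      using two B by (intro mult_mono) auto
    then have "5 * 2 ^ (k - 1) / (8 * real B) \<le> real B ^ k" using B by (simp add: field_simps)
    then have "5 * 2 ^ (k - 1) / (8 * real B) / real B ^ (k * (m - 1)) \<le> real B ^ k / real B ^ (k * (m - 1))"
      by (rule divide_right_mono) simp
    moreover have "real B ^ k / real B ^ (k * (m - 1)) = 1 / real B ^ (k * m) * real B ^ (2 * k)"
      unfolding km using B by (simp add: mult_2 power_add)
    ultimately show ?thesis unfolding \<eta>_def by simp
  qed
  have "{t. t < N \<and> 1 - 1 / real (gap_denominator B k) \<le> box_mean B m k (real M * (real t / real N))}
      \<subseteq> {t. t < N \<and> near \<eta> (real M * (real t / real N))}"
  proof safe
    fix t assume "1 - 1 / real (gap_denominator B k) \<le> box_mean B m k (real M * (real t / real N))"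
    then have "near (2 ^ (k - 1) / (8 * real B * real B ^ (Suc (k - 1) * (m - 1)))) (real M * (real t / real N))"
      using k by (intro box_mean_near_one[OF B m]) (simp add: gap_denominator_def del: box_mean.simps)
    then show "near \<eta> (real M * (real t / real N))" using k by (simp add: \<eta>_def)
  qed
  then have "card {t. t < N \<and> 1 - 1 / real (gap_denominator B k) \<le> box_mean B m k (real M * (real t / real N))}
      \<le> card {t. t < N \<and> near \<eta> (real M * (real t / real N))}"
    by (intro card_mono) auto
  then have "real (card {t. t < N \<and> 1 - 1 / real (gap_denominator B k) \<le> box_mean B m k (real M * (real t / real N))})
      \<le> real (card {t. t < N \<and> near \<eta> (real M * (real t / real N))})"
    by (rule of_nat_mono)
  also have "\<dots> \<le> 4 * \<eta> * real N + 2 * real M"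
    using B by (intro card_near_le N M) (simp add: \<eta>_def)
  also have "2 * real M \<le> \<eta> * real N"
  proof -
    have "2 * real M * 1 \<le> 2 * real M * real B ^ m" using B1 by (intro mult_left_mono one_le_power) auto
    then have "2 * real M * real B ^ (k * m) \<le> 2 * real M * real B ^ m * real B ^ (k * m)"
      by (intro mult_right_mono) auto
    also have "\<dots> = real (2 * M * B ^ (m + k * m))" by (simp add: power_add)
    also have "\<dots> \<le> real N" using N(1) by (rule of_nat_mono)
    finally have "2 * real M \<le> 1 / real B ^ (k * m) * real N" using B by (simp add: pos_le_divide_eq)
    also have "\<dots> \<le> \<eta> * real N" using lower by (rule mult_right_mono) simp
    finally show ?thesis .
  qed
  then have "4 * \<eta> * real N + 2 * real M \<le> real N * (5 * \<eta>)" by (simp add: algebra_simps)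
  also have "\<dots> \<le> real N * (1 / real B ^ (k * m) * real B ^ (2 * k))"
    using upper by (rule mult_left_mono) simp
  finally show ?thesis by (simp only: mult.assoc)
qed

text \<open>The normalised moment of order \<open>2 * s\<close> of the exponential sum is at most
  \<open>B ^ (3 * k - k * m)\<close>; Parseval turns this into a lower bound for the number of
  \<open>s\<close>-fold sums.\<close>

lemma card_sumset_kth_powers:
  fixes b k d1 d2 m :: nat
  assumes b: "b \<ge> 3" and k: "k \<ge> 2" and d: "d1 < d2" "d2 < b" and m: "m \<ge> 2"
  defines "B \<equiv> b ^ k"
  shows "real B ^ (k * m) \<le> real B ^ (3 * k) * real (card (sumset (summands B k) (kth_powers b d1 d2 k m)))"
proof -
  let ?A = "kth_powers b d1 d2 k m"
  define s where "s = summands B k"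
  define \<tau> where "\<tau> = moment_exponent B k"
  define n where "n = gap_denominator B k"
  define M where "M = fact k * (\<Prod>i<k. (d2 - d1) * b ^ i)"
  \<comment> \<open>The first term makes the grid fine enough for the level set bounds; the others
    put all \<open>s\<close>-fold sums below \<open>N\<close>.\<close>
  define N where "N = 2 * M * B ^ (m + k * m) + s * B ^ (k * m) + 1"
  define f where "f \<theta> = mean_shift (\<lambda>j. real ((d2 - d1) * b ^ j)) B m k
      (\<lambda>x. unit_exp (\<theta> * (x + real (d1 * (\<Sum>p<m * k. b ^ p))) ^ k))" for \<theta>
  define \<phi> where "\<phi> t = norm (f (real t / real N)) ^ (2 ^ k)" for t :: nat
  let ?\<delta> = "1 / real B ^ (k * m)"
  have "3 ^ 2 \<le> b ^ 2" using b by (intro power_mono) auto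
  also have "\<dots> \<le> b ^ k" using b k by (intro power_increasing) auto
  finally have B: "B \<ge> 9" by (simp add: B_def)
  have B1: "1 \<le> real B" using B by simp
  have "(\<Prod>i<k. (d2 - d1) * b ^ i) \<noteq> 0" using d b by simp
  then have "M \<noteq> 0" unfolding M_def by (simp only: mult_eq_0_iff fact_nonzero simp_thms not_False_eq_True)
  then have M: "M \<ge> 1" by simp
  have N: "2 * M * B ^ (m + k * m) \<le> N" "N \<ge> 1" by (simp_all add: N_def)
  have F: "char_on (sumset s ?A) (\<lambda>\<theta>. f \<theta> ^ s)"
    unfolding f_def B_def using b k d by (intro char_on_power char_on_kth_powers) auto
  have sub: "sumset s ?A \<subseteq> {..<N}"
  proof
    fix x assume "x \<in> sumset s ?A"
    then have "x \<le> s * B ^ (k * m)"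
    proof (rule sumset_le)
      fix a assume "a \<in> ?A"
      then obtain x where x: "a = x ^ k" "x < b ^ (m * k)" unfolding kth_powers_def by blast
      have "a \<le> (b ^ (m * k)) ^ k" unfolding x(1) using x(2) by (intro power_mono) auto
      also have "\<dots> = B ^ (k * m)" unfolding B_def power_mult[symmetric] by (simp add: ac_simps)
      finally show "a \<le> B ^ (k * m)" .
    qed
    then show "x \<in> {..<N}" by (simp add: N_def)
  qed
  have box: "\<phi> t \<le> box_mean B m k (real M * (real t / real N))" for t
    unfolding \<phi>_def f_def M_def using k by (intro norm_power_le_box_mean) simp
  have \<phi>: "0 \<le> \<phi> t" "\<phi> t \<le> 1" for t
    unfolding \<phi>_def f_def by (simp_all add: power_le_one norm_mean_shift_unit_exp_le_1 del: mean_shift.simps)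
  have C1: "1 \<le> level_exponent B k"
    using B k unfolding level_exponent_def by simp
  have moment: "(\<Sum>t<N. \<phi> t ^ \<tau>) \<le> real N * ?\<delta> * 2 ^ (\<tau> + 1)"
  proof (rule moment_le[OF \<phi>])
    fix y :: nat assume y: "y \<ge> 1"
    have "card {t. t < N \<and> (1/2) ^ y \<le> \<phi> t} \<le> card {t. t < N \<and> (1/2) ^ y \<le> box_mean B m k (real M * (real t / real N))}"
      using order_trans[OF _ box] by (intro card_mono) auto
    then have "real (card {t. t < N \<and> (1/2) ^ y \<le> \<phi> t}) \<le> real (card {t. t < N \<and> (1/2) ^ y \<le> box_mean B m k (real M * (real t / real N))})"
      by (rule of_nat_mono)
    also have "\<dots> \<le> real N * ?\<delta> * (real B ^ level_exponent B k) ^ y"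
      by (rule card_level_set_le[OF B k M N y])
    finally show "real (card {t. t < N \<and> (1/2) ^ y \<le> \<phi> t}) \<le> real N * ?\<delta> * (real B ^ level_exponent B k) ^ y" .
  next
    have B2: "real B \<le> 2 ^ B" by (rule order_less_imp_le[OF of_nat_less_two_power])
    then have "real B ^ level_exponent B k \<le> (2 ^ B) ^ level_exponent B k" by (intro power_mono) auto
    then show "2 * real B ^ level_exponent B k \<le> 2 ^ \<tau>"
      by (simp add: \<tau>_def moment_exponent_def power_mult)
    have "real B ^ (k * m) \<le> (2 ^ B) ^ (k * m)" using B2 by (intro power_mono) auto
    also have "\<dots> = 2 ^ (B * 1 * (k * m))" by (simp add: power_mult)
    also have "\<dots> \<le> 2 ^ (k * m * \<tau>)"
    proof (rule power_increasing)
      have "B * 1 \<le> B * level_exponent B k" using C1 by (rule mult_left_mono) simp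
      then have "B * 1 \<le> \<tau>" unfolding \<tau>_def moment_exponent_def by linarith
      then have "B * 1 * (k * m) \<le> \<tau> * (k * m)" by (rule mult_right_mono) simp
      then show "B * 1 * (k * m) \<le> k * m * \<tau>" by (simp only: mult.commute)
    qed simp
    finally have "real B ^ (k * m) \<le> 2 ^ (k * m * \<tau>)" .
    then show "(1/2) ^ (k * m * \<tau>) \<le> ?\<delta>" using B by (simp add: power_divide field_simps)
    show "k * m \<ge> 1" using k m by simp
  qed (use B1 in simp_all)
  \<comment> \<open>Taking \<open>\<sigma> = \<tau> + 1\<close> removes the constant
    \<open>2 ^ (\<tau> + 1)\<close> of the first moment bound.\<close>
  have "(\<Sum>t<N. \<phi> t ^ (\<tau> + n * (\<tau> + 1))) \<le> real N * ?\<delta> + real N * ?\<delta> * real B ^ (2 * k)"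
  proof (rule high_moment_le[OF \<phi> _ moment])
    show "n \<ge> 1" using B by (simp add: n_def gap_denominator_def)
    have "card {t. t < N \<and> 1 - 1 / real n \<le> \<phi> t} \<le> card {t. t < N \<and> 1 - 1 / real n \<le> box_mean B m k (real M * (real t / real N))}"
      using order_trans[OF _ box] by (intro card_mono) auto
    then have "real (card {t. t < N \<and> 1 - 1 / real n \<le> \<phi> t}) \<le> real (card {t. t < N \<and> 1 - 1 / real n \<le> box_mean B m k (real M * (real t / real N))})"
      by (rule of_nat_mono)
    also have "\<dots> \<le> real N * ?\<delta> * real B ^ (2 * k)"
      unfolding n_def by (rule card_top_level_set_le[OF B k M m N])
    finally show "real (card {t. t < N \<and> 1 - 1 / real n \<le> \<phi> t}) \<le> real N * ?\<delta> * real B ^ (2 * k)" .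
  qed simp
  also have "\<dots> = real N * (?\<delta> * (1 + real B ^ (2 * k)))" by (simp add: algebra_simps)
  also have "\<dots> \<le> real N * (?\<delta> * real B ^ (3 * k))"
  proof (intro mult_left_mono)
    have "(1::real) \<le> real B ^ (2 * k)" using B1 by (rule one_le_power)
    then have "1 + real B ^ (2 * k) \<le> 2 * real B ^ (2 * k)" by simp
    also have "\<dots> \<le> real B ^ k * real B ^ (2 * k)"
    proof (rule mult_right_mono)
      have "2 \<le> real B ^ 1" using B by simp
      also have "\<dots> \<le> real B ^ k" using k B1 by (intro power_increasing) auto
      finally show "2 \<le> real B ^ k" .
    qed simp
    also have "\<dots> = real B ^ (3 * k)" by (simp flip: power_add)
    finally show "1 + real B ^ (2 * k) \<le> real B ^ (3 * k)" .
  qed simp_all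
  finally have "(\<Sum>t<N. \<phi> t ^ (\<tau> + n * (\<tau> + 1))) \<le> real N * (?\<delta> * real B ^ (3 * k))" .
  moreover have "\<phi> t ^ (\<tau> + n * (\<tau> + 1)) = (norm (f (real t / real N) ^ s))\<^sup>2" for t
  proof -
    \<comment> \<open>The definition of \<open>summands\<close> is made so that the total exponent
      of \<open>norm (f _)\<close> is exactly \<open>2 * s\<close>.\<close>
    have "2 ^ k = 2 * (2::nat) ^ (k - 1)" using k by (cases k) auto
    then have "2 ^ k * (\<tau> + n * (\<tau> + 1)) = s * 2"
      by (simp add: s_def summands_def \<tau>_def n_def)
    then show ?thesis unfolding \<phi>_def norm_power power_mult[symmetric] by (rule arg_cong)
  qed
  ultimately have "(\<Sum>t<N. (norm (f (real t / real N) ^ s))\<^sup>2) \<le> real N * (?\<delta> * real B ^ (3 * k))" by simp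
  from char_on_card[OF F sub this N(2)] have "1 \<le> ?\<delta> * real B ^ (3 * k) * real (card (sumset s ?A))" .
  then show ?thesis using B by (simp add: s_def field_simps)
qed

section \<open>Schnirelmann density\<close>

text \<open>Schnirelmann's inequality. Let \<open>a\<close> be the last element of \<open>A\<close>
  up to \<open>N\<close>: the translate \<open>a + D\<close> fills its share of the gap after
  \<open>a\<close>, and strong induction handles the numbers below \<open>a\<close>.\<close>

lemma card_add_set_ge:
  fixes A D :: "nat set" and \<beta> :: real
  assumes zero: "0 \<in> A" "0 \<in> D" and \<beta>: "\<beta> \<le> 1"
    and dens: "\<And>N. \<beta> * real N \<le> real (card (D \<inter> {1..N}))"
    and E: "\<And>a d. a \<in> A \<Longrightarrow> d \<in> D \<Longrightarrow> a + d \<in> E"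
  shows "real (card (A \<inter> {1..N})) + \<beta> * (real N - real (card (A \<inter> {1..N}))) \<le> real (card (E \<inter> {1..N}))"
proof (induction N rule: less_induct)
  case (less N)
  define a where "a = Max (A \<inter> {0..N})"
  have fin: "finite (A \<inter> {0..N})" and "0 \<in> A \<inter> {0..N}" using zero by auto
  then have "a \<in> A \<inter> {0..N}" unfolding a_def by (intro Max_in) blast+
  then have a: "a \<in> A" "a \<le> N" by auto
  have a_max: "\<And>x. x \<in> A \<Longrightarrow> x \<le> N \<Longrightarrow> x \<le> a"
    unfolding a_def using fin by (intro Max_ge) auto
  show ?case
  proof (cases "a = 0")
    case True
    have "A \<inter> {1..N} = {}" using a_max True by fastforce
    then have "real (card (A \<inter> {1..N})) + \<beta> * (real N - real (card (A \<inter> {1..N}))) \<le> real (card (D \<inter> {1..N}))"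
      using dens by simp
    also have "card (D \<inter> {1..N}) \<le> card (E \<inter> {1..N})"
      using E[OF zero(1)] by (intro card_mono) auto
    finally show ?thesis by simp
  next
    case False
    have A: "A \<inter> {1..N} = insert a (A \<inter> {1..a - 1})"
    proof (intro equalityI subsetI)
      fix x assume "x \<in> A \<inter> {1..N}"
      then have "x \<in> A" "1 \<le> x" "x \<le> a" using a_max by auto
      then show "x \<in> insert a (A \<inter> {1..a - 1})" by (cases "x = a") auto
    next
      fix x assume "x \<in> insert a (A \<inter> {1..a - 1})"
      then show "x \<in> A \<inter> {1..N}" using a False by auto
    qed
    have cardA: "card (A \<inter> {1..N}) = Suc (card (A \<inter> {1..a - 1}))"
      unfolding A using False by (subst card_insert_disjoint) auto
    let ?U = "E \<inter> {1..a - 1}" and ?V = "(\<lambda>d. a + d) ` (D \<inter> {1..N - a})"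
    have sub: "?U \<union> (insert a ?V) \<subseteq> E \<inter> {1..N}"
      using E[OF a(1)] E[OF a(1) zero(2)] a(2) False by auto
    have "card (?U \<union> (insert a ?V)) = card ?U + card (insert a ?V)"
      by (rule card_Un_disjoint) auto
    also have "card (insert a ?V) = Suc (card ?V)" by (rule card_insert_disjoint) auto
    also have "card ?V = card (D \<inter> {1..N - a})" by (rule card_image) auto
    finally have "card ?U + Suc (card (D \<inter> {1..N - a})) \<le> card (E \<inter> {1..N})"
      using card_mono[OF _ sub] by simp
    then have "real (card ?U) + 1 + real (card (D \<inter> {1..N - a})) \<le> real (card (E \<inter> {1..N}))" by linarith
    moreover have "real (card (A \<inter> {1..a - 1})) + \<beta> * (real (a - 1) - real (card (A \<inter> {1..a - 1}))) \<le> real (card ?U)"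
      using a False by (intro less.IH) simp
    moreover have "\<beta> * real (N - a) \<le> real (card (D \<inter> {1..N - a}))" by (rule dens)
    moreover have "real (N - a) = real N - real a" "real (a - 1) = real a - 1" using a False by auto
    ultimately show ?thesis unfolding cardA by (simp add: algebra_simps)
  qed
qed

lemma sumset_Suc_mem: "n \<in> sumset s A \<Longrightarrow> a \<in> A \<Longrightarrow> n + a \<in> sumset (Suc s) A"
  unfolding sumset_def
proof safe
  fix xs assume "set xs \<subseteq> A" "a \<in> A"
  then show "\<exists>ys. length ys = Suc (length xs) \<and> set ys \<subseteq> A \<and> sum_list xs + a = sum_list ys"
    by (intro exI[of _ "a # xs"]) auto
qed

lemma sumset_add_mem: "n \<in> sumset s A \<Longrightarrow> n' \<in> sumset s' A \<Longrightarrow> n + n' \<in> sumset (s + s') A"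
  unfolding sumset_def
proof safe
  fix xs ys assume "set xs \<subseteq> A" "set ys \<subseteq> A"
  then show "\<exists>zs. length zs = length xs + length ys \<and> set zs \<subseteq> A \<and> sum_list xs + sum_list ys = sum_list zs"
    by (intro exI[of _ "xs @ ys"]) auto
qed

lemma zero_mem_sumset: "0 \<in> A \<Longrightarrow> 0 \<in> sumset s A"
  unfolding sumset_def by (intro CollectI exI[of _ "replicate s 0"]) (auto simp: sum_list_replicate)

text \<open>Each further summand multiplies the complementary density by
  \<open>1 - \<eta>\<close>.\<close>

lemma card_sumset_density:
  fixes D :: "nat set" and \<eta> :: real
  assumes zero: "0 \<in> D" and \<eta>: "\<eta> \<le> 1" and dens: "\<And>N. \<eta> * real N \<le> real (card (D \<inter> {1..N}))"
  shows "(1 - (1 - \<eta>) ^ j) * real N \<le> real (card (sumset j D \<inter> {1..N}))"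
proof (induction j)
  case (Suc j)
  let ?a = "real (card (sumset j D \<inter> {1..N}))"
  have "(1 - \<eta>) * ((1 - (1 - \<eta>) ^ j) * real N) \<le> (1 - \<eta>) * ?a"
    using \<eta> Suc by (intro mult_left_mono) auto
  then have "(1 - (1 - \<eta>) ^ Suc j) * real N \<le> ?a + \<eta> * (real N - ?a)"
    by (simp add: algebra_simps)
  also have "\<dots> \<le> real (card (sumset (Suc j) D \<inter> {1..N}))"
    using zero by (intro card_add_set_ge[OF zero_mem_sumset _ \<eta> dens] sumset_Suc_mem)
  finally show ?case .
qed simp

text \<open>With 0 included, \<open>A\<close> and its reflection \<open>N - A\<close> each have more
  than half of the \<open>N + 1\<close> points of \<open>{0..N}\<close>, so they meet.\<close>

lemma mem_add_of_card_ge_half: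
  fixes A :: "nat set"
  assumes zero: "0 \<in> A" and half: "real N / 2 \<le> real (card (A \<inter> {1..N}))"
  shows "\<exists>a\<in>A. \<exists>a'\<in>A. N = a + a'"
proof -
  let ?U = "A \<inter> {0..N}" and ?V = "(\<lambda>a. N - a) ` (A \<inter> {0..N})"
  have "?U = insert 0 (A \<inter> {1..N})" using zero by auto
  then have U: "card ?U = Suc (card (A \<inter> {1..N}))" by simp
  have V: "card ?V = card ?U" by (rule card_image) (auto simp: inj_on_def)
  have "?U \<inter> ?V \<noteq> {}"
  proof
    assume "?U \<inter> ?V = {}"
    then have "card ?U + card ?V = card (?U \<union> ?V)" by (intro card_Un_disjoint[symmetric]) auto
    also have "\<dots> \<le> card {0..N}" by (intro card_mono) auto
    finally have "card (A \<inter> {1..N}) + card (A \<inter> {1..N}) + 2 \<le> N + 1" using U V by simp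
    moreover have "real N \<le> real (2 * card (A \<inter> {1..N}))" using half by simp
    then have "N \<le> 2 * card (A \<inter> {1..N})" by (simp only: of_nat_le_iff)
    ultimately show False by simp
  qed
  then obtain a' where "N - a' \<in> A" "a' \<in> A" "a' \<le> N" by auto
  then show ?thesis by (intro bexI[of _ "N - a'"] bexI[of _ a']) simp_all
qed

text \<open>By \<open>(1 - 1 / n) ^ n \<le> 1/2\<close>, the \<open>n\<close>-fold sums have density
  at least one half, and two of them reach everything.\<close>

lemma schnirelmann_basis:
  fixes D :: "nat set"
  assumes zero: "0 \<in> D" and n: "n \<ge> 1" and dens: "\<And>N. N \<le> n * card (D \<inter> {1..N})"
  shows "N \<in> sumset (2 * n) D"
proof -
  have d: "1 / real n * real N \<le> real (card (D \<inter> {1..N}))" for N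
  proof -
    have "real N \<le> real (n * card (D \<inter> {1..N}))" by (rule of_nat_mono[OF dens])
    then show ?thesis using n by (simp add: field_simps)
  qed
  have "(1 - (1 - 1 / real n) ^ n) * real N \<le> real (card (sumset n D \<inter> {1..N}))"
    using n by (intro card_sumset_density[OF zero _ d]) simp
  moreover have "1/2 * real N \<le> (1 - (1 - 1 / real n) ^ n) * real N"
    using power_one_minus_inverse_le_half[OF n] by (intro mult_right_mono) auto
  ultimately have "real N / 2 \<le> real (card (sumset n D \<inter> {1..N}))" by simp
  then obtain a a' where "a \<in> sumset n D" "a' \<in> sumset n D" "N = a + a'"
    using mem_add_of_card_ge_half[OF zero_mem_sumset[OF zero]] by blast
  then show ?thesis using sumset_add_mem by (simp add: mult_2)
qed

section \<open>Sums of at most r powers\<close>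

definition power_sums :: "nat \<Rightarrow> nat set \<Rightarrow> nat \<Rightarrow> nat set" where
  "power_sums k S r = {n. \<exists>xs. length xs \<le> r \<and> set xs \<subseteq> S \<and> n = (\<Sum>x\<leftarrow>xs. x ^ k)}"

lemma power_sums_add: "n \<in> power_sums k S r \<Longrightarrow> n' \<in> power_sums k S r' \<Longrightarrow> n + n' \<in> power_sums k S (r + r')"
proof -
  assume "n \<in> power_sums k S r" "n' \<in> power_sums k S r'"
  then obtain xs ys where "length xs \<le> r" "set xs \<subseteq> S" "n = (\<Sum>x\<leftarrow>xs. x ^ k)"
      "length ys \<le> r'" "set ys \<subseteq> S" "n' = (\<Sum>x\<leftarrow>ys. x ^ k)"
    unfolding power_sums_def by blast
  then show ?thesis unfolding power_sums_def by (intro CollectI exI[of _ "xs @ ys"]) auto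
qed

lemma power_sums_mono: "n \<in> power_sums k S r \<Longrightarrow> r \<le> r' \<Longrightarrow> n \<in> power_sums k S r'"
  unfolding power_sums_def by (blast intro: le_trans)

lemma power_sums_mult: "x \<in> S \<Longrightarrow> l * x ^ k \<in> power_sums k S l"
  unfolding power_sums_def
  by (intro CollectI exI[of _ "replicate l x"]) (auto simp: sum_list_replicate)

lemma sumset_kth_powers_subset:
  "sumset s (kth_powers b d1 d2 k m) \<subseteq> power_sums k (restricted_digits b {d1, d2}) s"
proof (induction s)
  case 0
  show ?case by (auto simp: sumset_def power_sums_def)
next
  case (Suc s)
  show ?case
  proof
    fix n assume "n \<in> sumset (Suc s) (kth_powers b d1 d2 k m)"
    then obtain xs where xs: "length xs = Suc s" "set xs \<subseteq> kth_powers b d1 d2 k m" "n = sum_list xs"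
      unfolding sumset_def by blast
    then obtain y ys where ys: "xs = y # ys" by (cases xs) auto
    have "sum_list ys \<in> power_sums k (restricted_digits b {d1, d2}) s"
      using Suc.IH xs ys unfolding sumset_def by auto
    moreover obtain x where "x \<in> restricted_digits b {d1, d2}" "y = x ^ k"
      using xs(2) ys unfolding kth_powers_def by auto
    then have "y \<in> power_sums k (restricted_digits b {d1, d2}) 1"
      using power_sums_mult[of x _ 1 k] by simp
    ultimately show "n \<in> power_sums k (restricted_digits b {d1, d2}) (Suc s)"
      using power_sums_add[of y _ _ 1] xs(3) ys by simp
  qed
qed

text \<open>Schnirelmann's theorem will be applied to a translate by \<open>c\<close>; over
  \<open>j\<close> summands the translations add up to \<open>j * c\<close>.\<close>

lemma sumset_shifted_power_sums:
  assumes "n \<in> sumset j {x. c + x \<in> power_sums k S r}"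
  shows "j * c + n \<in> power_sums k S (j * r)"
proof -
  obtain xs where xs: "length xs = j" "set xs \<subseteq> {x. c + x \<in> power_sums k S r}" "n = sum_list xs"
    using assms unfolding sumset_def by blast
  have "length xs * c + sum_list xs \<in> power_sums k S (length xs * r)"
    using xs(2)
  proof (induction xs)
    case Nil
    show ?case by (auto simp: power_sums_def)
  next
    case (Cons x xs)
    then have "(c + x) + (length xs * c + sum_list xs) \<in> power_sums k S (r + length xs * r)"
      by (intro power_sums_add) auto
    then show ?case by (simp add: ac_simps)
  qed
  then show ?thesis using xs by simp
qed

text \<open>Reducing a Bezout coefficient modulo \<open>v\<close> gives \<open>p \<le> v\<close>,
  whence \<open>q \<le> u\<close>. The size matters because \<open>p\<close> and \<open>q\<close>
  will count summands.\<close>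

lemma bounded_bezout:
  fixes u v :: nat
  assumes "coprime u v" "1 \<le> u" "u \<le> L" "v \<le> L"
  obtains p q where "p * u = q * v + 1" "p \<le> L" "q \<le> L"
proof (cases "v \<le> 1")
  case True
  then consider "v = 0" | "v = 1" by linarith
  then show thesis
  proof cases
    case 1
    then have "u = 1" using assms(1) by simp
    then show thesis using 1 assms by (intro that[of 1 0]) auto
  next
    case 2
    then show thesis using assms by (intro that[of 1 "u - 1"]) auto
  qed
next
  case False
  obtain p0 q0 where "u * p0 = v * q0 + gcd u v"
    using bezout_nat[of u v] assms(2) by auto
  then have eq: "u * p0 = v * q0 + 1" using assms(1) by simp
  define p where "p = p0 mod v"
  have "(u * p) mod v = (u * p0) mod v" unfolding p_def by (simp add: mod_mult_right_eq)
  also have "\<dots> = 1 mod v" unfolding eq by (rule mod_mult_self4)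
  also have "\<dots> = 1" using False by simp
  finally have "(u * p) mod v = 1" .
  then have "u * p = v * (u * p div v) + 1" by (metis mult_div_mod_eq)
  moreover have "p \<le> v" unfolding p_def using False by (simp add: order_less_imp_le)
  moreover have "u * p div v \<le> u"
  proof -
    have "u * p div v \<le> u * v div v" using \<open>p \<le> v\<close> by (intro div_le_mono mult_left_mono) auto
    then show ?thesis using False by simp
  qed
  ultimately show thesis using assms by (intro that[of p "u * p div v"]) (auto simp: mult.commute)
qed

lemma single_digit_mem: "d < b \<Longrightarrow> d \<in> D \<Longrightarrow> d \<in> restricted_digits b D"
  unfolding restricted_digits_def
proof safe
  fix i assume "d < b" "d \<in> D" "b ^ i \<le> d"
  have "i = 0"
  proof (rule ccontr)
    assume "i \<noteq> 0"
    then have "b \<le> b ^ i" using \<open>d < b\<close> by (intro self_le_power) auto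
    with \<open>d < b\<close> \<open>b ^ i \<le> d\<close> show False by linarith
  qed
  then show "d div b ^ i mod b \<in> D" using \<open>d < b\<close> \<open>d \<in> D\<close> by simp
qed

lemma summands_pos: "0 < summands B k"
  by (simp add: summands_def moment_exponent_def)

lemma card_power_sums_ge:
  fixes b k d1 d2 N :: nat
  assumes b: "b \<ge> 3" and k: "k \<ge> 2" and d: "d1 < d2" "d2 < b"
  defines "B \<equiv> b ^ k"
  assumes N: "summands B k * B ^ (4 * k) \<le> N"
  shows "N \<le> 2 * summands B k * B ^ (4 * k) *
    card (power_sums k (restricted_digits b {d1, d2}) (summands B k) \<inter> {1..N})"
proof -
  define s where "s = summands B k"
  have B: "B \<ge> 2" unfolding B_def using b k self_le_power[of b k] by linarith
  have s: "s \<ge> 1" using summands_pos[of B k] by (simp add: s_def)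
  define P where "P m \<longleftrightarrow> s * B ^ (k * m) \<le> N" for m
  have bound: "m \<le> N" if "P m" for m
  proof -
    have "m < 2 ^ m" by (rule less_exp)
    also have "\<dots> \<le> B ^ m" using B by (rule power_mono) simp
    also have "\<dots> \<le> B ^ (k * m)" using B k by (intro power_increasing) auto
    also have "\<dots> \<le> s * B ^ (k * m)" using s by simp
    finally show ?thesis using that by (simp add: P_def)
  qed
  \<comment> \<open>The largest \<open>m\<close> for which all \<open>s\<close>-fold sums stay
    within \<open>N\<close>; by maximality \<open>N\<close> exceeds their range by less than a
    factor \<open>B ^ k\<close>.\<close>
  define m where "m = (GREATEST m. P m)"
  have P4: "P 4" using N by (simp add: P_def s_def mult.commute)
  have m: "P m" unfolding m_def by (rule GreatestI_nat[of P, OF P4]) (use bound in blast)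
  have m4: "4 \<le> m" unfolding m_def by (rule Greatest_le_nat[of P, OF P4]) (use bound in blast)
  have "\<not> P (Suc m)"
  proof
    assume "P (Suc m)"
    then have "Suc m \<le> m" unfolding m_def by (rule Greatest_le_nat[of P]) (use bound in blast)
    then show False by simp
  qed
  then have less: "N < s * B ^ k * B ^ (k * m)" by (simp add: P_def power_add mult.assoc)
  let ?E = "sumset s (kth_powers b d1 d2 k m)"
  let ?F = "power_sums k (restricted_digits b {d1, d2}) s"
  have E_le: "n \<le> N" if "n \<in> ?E" for n
  proof -
    have "n \<le> s * B ^ (k * m)"
      using that
    proof (rule sumset_le)
      fix a assume "a \<in> kth_powers b d1 d2 k m"
      then obtain x where x: "a = x ^ k" "x < b ^ (m * k)" unfolding kth_powers_def by blast
      have "a \<le> (b ^ (m * k)) ^ k" unfolding x(1) using x(2) by (intro power_mono) auto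
      also have "\<dots> = B ^ (k * m)" unfolding B_def power_mult[symmetric] by (simp add: ac_simps)
      finally show "a \<le> B ^ (k * m)" .
    qed
    then show ?thesis using m by (simp add: P_def)
  qed
  have finE: "finite ?E" using E_le by (intro finite_subset[of ?E "{..N}"]) auto
  have "real (B ^ (k * m)) \<le> real (B ^ (3 * k) * card ?E)"
    using card_sumset_kth_powers[OF b k d, of m] m4 by (simp add: B_def s_def)
  then have card: "B ^ (k * m) \<le> B ^ (3 * k) * card ?E" by (simp only: of_nat_le_iff)
  \<comment> \<open>Having two elements compensates for 0, which \<open>{1..N}\<close> omits, at the
    cost of a factor 2.\<close>
  have "2 \<le> card ?E"
  proof -
    have "B ^ (3 * k) * 2 \<le> B ^ (3 * k) * B ^ k"
      using B k self_le_power[of B k] by (intro mult_left_mono) auto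
    also have "\<dots> = B ^ (k * 4)" by (simp add: power_add[symmetric] mult.commute)
    also have "\<dots> \<le> B ^ (k * m)" using m4 B by (intro power_increasing) auto
    finally have "B ^ (3 * k) * 2 \<le> B ^ (3 * k) * card ?E" using card by linarith
    then show ?thesis using B by simp
  qed
  moreover have "card ?E \<le> Suc (card (?F \<inter> {1..N}))"
  proof -
    have "?E \<subseteq> insert 0 (?F \<inter> {1..N})"
    proof
      fix x assume x: "x \<in> ?E"
      have "x \<in> ?F" by (rule subsetD[OF sumset_kth_powers_subset x])
      then show "x \<in> insert 0 (?F \<inter> {1..N})" using E_le[OF x] by auto
    qed
    then have "card ?E \<le> card (insert 0 (?F \<inter> {1..N}))" by (intro card_mono) auto
    then show ?thesis by (simp add: card_insert_if split: if_splits)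
  qed
  ultimately have E2: "card ?E \<le> 2 * card (?F \<inter> {1..N})" by linarith
  have "N \<le> s * B ^ k * B ^ (k * m)" using less by simp
  also have "\<dots> \<le> s * B ^ k * (B ^ (3 * k) * (2 * card (?F \<inter> {1..N})))"
    using E2 by (intro mult_left_mono order_trans[OF card]) auto
  also have "\<dots> = 2 * s * B ^ (4 * k) * card (?F \<inter> {1..N})"
  proof -
    have "B ^ (4 * k) = B ^ k * B ^ (3 * k)" by (simp flip: power_add)
    then show ?thesis by (simp only: ac_simps)
  qed
  finally show ?thesis by (simp only: s_def)
qed

text \<open>All constants are absorbed into powers of \<open>B\<close> by means of
  \<open>9 \<le> B\<close>, \<open>2 ^ k \<le> B\<close> and \<open>k + 1 \<le> B\<close>.\<close>

lemma summands_le: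
  fixes b k :: nat
  assumes b: "b \<ge> 3" and k: "k \<ge> 2"
  defines "B \<equiv> b ^ k"
  shows "summands B k \<le> B ^ (2 * k + 15)"
proof -
  have "3 ^ 2 \<le> b ^ 2" using b by (intro power_mono) auto
  also have "\<dots> \<le> b ^ k" using b k by (intro power_increasing) auto
  finally have B: "B \<ge> 9" by (simp add: B_def)
  have two: "2 ^ k \<le> B" unfolding B_def using b by (intro power_mono) auto
  have k1: "k + 1 \<le> B" using less_exp[of k] two by linarith
  have B2: "81 \<le> B ^ 2" using power_mono[OF B, of 2] by simp
  have "10 * k * (k + 1) * B ^ (2 * k) \<le> B ^ 2 * B * B * B ^ (2 * k)"
    using k1 B2 by (intro mult_mono) auto
  then have C: "level_exponent B k \<le> B ^ (2 * k + 4)"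
    by (simp add: level_exponent_def power_add power2_eq_square numeral_eq_Suc ac_simps)
  have pos: "1 \<le> B ^ j" for j using B by simp
  have double: "2 * B ^ j \<le> B ^ (j + 1)" for j using B by simp
  have "moment_exponent B k \<le> 1 + B * B ^ (2 * k + 4)"
    unfolding moment_exponent_def using C by simp
  also have "B * B ^ (2 * k + 4) = B ^ (2 * k + 5)"
  proof -
    have "2 * k + 5 = Suc (2 * k + 4)" by simp
    then show ?thesis by (simp only: power_Suc)
  qed
  also have "1 + B ^ (2 * k + 5) \<le> 2 * B ^ (2 * k + 5)" using pos[of "2 * k + 5"] by linarith
  also have "\<dots> \<le> B ^ (2 * k + 5 + 1)" by (rule double)
  also have "2 * k + 5 + 1 = 2 * k + 6" by simp
  finally have M: "moment_exponent B k \<le> B ^ (2 * k + 6)" .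
  have "(4::nat) ^ (k - 1) \<le> 4 ^ k" by (intro power_increasing) auto
  also have "\<dots> = (2 ^ 2) ^ k" by simp
  also have "\<dots> = (2 ^ k) ^ 2" by (simp only: power_mult[symmetric] mult.commute)
  also have "\<dots> \<le> B ^ 2" using two by (rule power_mono) simp
  finally have four: "(4::nat) ^ (k - 1) \<le> B ^ 2" .
  have "gap_denominator B k \<le> B ^ 2 * B\<^sup>2 * B ^ 2"
    unfolding gap_denominator_def using B2 four by (intro mult_mono) auto
  then have G: "gap_denominator B k \<le> B ^ 6" by (simp flip: power_add)
  have "gap_denominator B k * (moment_exponent B k + 1) \<le> B ^ 6 * B ^ (2 * k + 7)"
  proof (rule mult_mono[OF G])
    have "moment_exponent B k + 1 \<le> 2 * B ^ (2 * k + 6)" using M pos[of "2 * k + 6"] by linarith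
    also have "\<dots> \<le> B ^ (2 * k + 6 + 1)" by (rule double)
    also have "2 * k + 6 + 1 = 2 * k + 7" by simp
    finally show "moment_exponent B k + 1 \<le> B ^ (2 * k + 7)" .
  qed simp_all
  also have "\<dots> = B ^ (2 * k + 13)" by (simp flip: power_add add: add.commute)
  finally have GM: "gap_denominator B k * (moment_exponent B k + 1) \<le> B ^ (2 * k + 13)" .
  have "B ^ (2 * k + 6) \<le> B ^ (2 * k + 13)" using B by (intro power_increasing) auto
  then have "moment_exponent B k + gap_denominator B k * (moment_exponent B k + 1) \<le> 2 * B ^ (2 * k + 13)"
    using M GM by linarith
  also have "\<dots> \<le> B ^ (2 * k + 13 + 1)" by (rule double)
  also have "2 * k + 13 + 1 = 2 * k + 14" by simp
  finally have X: "moment_exponent B k + gap_denominator B k * (moment_exponent B k + 1) \<le> B ^ (2 * k + 14)" .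
  have "(2::nat) ^ (k - 1) \<le> 2 ^ k" by (intro power_increasing) auto
  then have "(2::nat) ^ (k - 1) \<le> B" using two by linarith
  then have "summands B k \<le> B * B ^ (2 * k + 14)"
    unfolding summands_def using X by (intro mult_mono) auto
  also have "\<dots> = B ^ (2 * k + 15)"
  proof -
    have "2 * k + 15 = Suc (2 * k + 14)" by simp
    then show ?thesis by (simp only: power_Suc)
  qed
  finally show ?thesis .
qed

lemma waring_restricted_digits_ordered:
  fixes k b d1 d2 :: nat
  assumes k: "k \<ge> 2" and b: "b \<ge> 3" and d: "d1 < d2" "d2 < b" and cop: "coprime d1 d2"
  shows "\<exists>N. \<forall>n\<ge>N. n \<in> power_sums k (restricted_digits b {d1, d2}) (b ^ (160 * k ^ 2))"
proof -
  define B where "B = b ^ k"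
  define s where "s = summands B k"
  define S where "S = restricted_digits b {d1, d2}"
  define N0 where "N0 = s * B ^ (4 * k)"
  define n where "n = 2 * s * B ^ (4 * k)"
  define L where "L = N0 * B"
  have B: "B \<ge> 2" unfolding B_def using b k self_le_power[of b k] by linarith
  have s: "s \<ge> 1" using summands_pos[of B k] by (simp add: s_def)
  have S: "d1 \<in> S" "d2 \<in> S" unfolding S_def using d by (auto intro!: single_digit_mem)
  obtain p q where pq: "p * d2 ^ k = q * d1 ^ k + 1" "p \<le> B" "q \<le> B"
  proof (rule bounded_bezout[of "d2 ^ k" "d1 ^ k" B])
    show "coprime (d2 ^ k) (d1 ^ k)" using cop by (simp add: coprime_commute)
    show "1 \<le> d2 ^ k" using d by simp
    show "d2 ^ k \<le> B" "d1 ^ k \<le> B" unfolding B_def using d by (auto intro!: power_mono)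
  qed
  \<comment> \<open>The offset makes coefficients nonnegative: since
    \<open>r = r * (p * d2 ^ k - q * d1 ^ k)\<close>, the number \<open>c + r\<close> uses
    \<open>d1 ^ k\<close> exactly \<open>(N0 - r) * q\<close> times, for every
    \<open>r \<le> N0\<close>.\<close>
  define c where "c = N0 * q * d1 ^ k"
  \<comment> \<open>\<open>L\<close> powers suffice for \<open>c\<close> and for each
    \<open>c + r\<close> with \<open>r \<le> N0\<close>; the other \<open>s\<close> allow a sum of
    \<open>s\<close> powers to be added to \<open>c\<close>.\<close>
  define D where "D = {x. c + x \<in> power_sums k S (s + L)}"
  have small: "r \<in> D" if "r \<le> N0" for r
  proof -
    have "c + r = r * p * d2 ^ k + (N0 - r) * q * d1 ^ k"
    proof -
      have "r * p * d2 ^ k = r * (q * d1 ^ k + 1)" unfolding pq(1)[symmetric] by (simp only: mult.assoc)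
      moreover have "N0 * (q * d1 ^ k) = r * (q * d1 ^ k) + (N0 - r) * (q * d1 ^ k)"
        using that by (simp flip: add_mult_distrib)
      ultimately show ?thesis by (simp add: c_def mult.assoc)
    qed
    moreover have "r * p * d2 ^ k + (N0 - r) * q * d1 ^ k \<in> power_sums k S (r * p + (N0 - r) * q)"
      by (intro power_sums_add power_sums_mult S)
    moreover have "r * p + (N0 - r) * q \<le> s + L"
    proof -
      have "r * p + (N0 - r) * q \<le> r * B + (N0 - r) * B"
        using pq by (intro add_mono mult_left_mono) auto
      also have "\<dots> = L" using that by (simp add: L_def flip: add_mult_distrib)
      finally show ?thesis by simp
    qed
    ultimately show ?thesis unfolding D_def by (auto intro: power_sums_mono)
  qed
  have sums_D: "power_sums k S s \<subseteq> D"
  proof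
    fix x assume "x \<in> power_sums k S s"
    moreover have "c \<in> power_sums k S L"
    proof -
      have "N0 * q \<le> L" unfolding L_def using pq(3) by (rule mult_left_mono) simp
      then show ?thesis unfolding c_def by (rule power_sums_mono[OF power_sums_mult[OF S(1)]])
    qed
    ultimately show "x \<in> D" unfolding D_def using power_sums_add[of x k S s c L] by (simp add: ac_simps)
  qed
  have n: "n \<ge> 1" using s B by (simp add: n_def)
  have "N \<in> sumset (2 * n) D" for N
  proof (rule schnirelmann_basis[OF small n])
    fix N
    show "N \<le> n * card (D \<inter> {1..N})"
    \<comment> \<open>Up to \<open>N0\<close> the set \<open>D\<close> contains every integer;
      beyond, the density bound for \<open>s\<close>-fold sums takes over.\<close>
    proof (cases "N \<le> N0")
      case True
      then have "D \<inter> {1..N} = {1..N}" using small by auto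
      then show ?thesis using n by simp
    next
      case False
      then have "N \<le> n * card (power_sums k S s \<inter> {1..N})"
        using card_power_sums_ge[OF b k d, of N] unfolding n_def N0_def S_def s_def B_def by simp
      also have "\<dots> \<le> n * card (D \<inter> {1..N})"
        using sums_D by (intro mult_left_mono card_mono) auto
      finally show ?thesis .
    qed
  qed simp
  then have all: "2 * n * c + N \<in> power_sums k S (2 * n * (s + L))" for N
    unfolding D_def by (rule sumset_shifted_power_sums)
  have "2 * n * (s + L) \<le> b ^ (160 * k ^ 2)"
  proof -
    have "s + L \<le> s * B ^ (4 * k + 2)"
    proof -
      have "1 + B ^ (4 * k + 1) \<le> 2 * B ^ (4 * k + 1)" using B by simp
      also have "\<dots> \<le> B * B ^ (4 * k + 1)" using B by (intro mult_right_mono) auto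
      finally have "1 + B ^ (4 * k + 1) \<le> B ^ (4 * k + 2)" by simp
      then have "s * (1 + B ^ (4 * k + 1)) \<le> s * B ^ (4 * k + 2)" by (rule mult_left_mono) simp
      then show ?thesis by (simp add: L_def N0_def algebra_simps)
    qed
    then have "2 * n * (s + L) \<le> 4 * s * B ^ (4 * k) * (s * B ^ (4 * k + 2))"
      unfolding n_def by simp
    also have "\<dots> = 4 * (s * s) * B ^ (8 * k + 2)"
    proof -
      have "B ^ (8 * k + 2) = B ^ (4 * k) * B ^ (4 * k + 2)" by (simp flip: power_add)
      then show ?thesis by (simp only: ac_simps)
    qed
    also have "\<dots> \<le> B ^ 2 * (B ^ (2 * k + 15) * B ^ (2 * k + 15)) * B ^ (8 * k + 2)"
    proof (intro mult_right_mono mult_mono)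
      show "4 \<le> B ^ 2" using power_mono[OF B, of 2] by simp
      show "s \<le> B ^ (2 * k + 15)" "s \<le> B ^ (2 * k + 15)"
        unfolding s_def B_def by (rule summands_le[OF b k])+
    qed simp_all
    also have "\<dots> = B ^ (12 * k + 34)"
    proof -
      have "12 * k + 34 = 2 + ((2 * k + 15) + (2 * k + 15)) + (8 * k + 2)" by simp
      then show ?thesis by (simp only: power_add)
    qed
    also have "\<dots> = b ^ (k * (12 * k + 34))" by (simp only: B_def power_mult)
    also have "\<dots> \<le> b ^ (160 * k ^ 2)"
    proof (rule power_increasing)
      \<comment> \<open>\<open>k \<ge> 2\<close> gives \<open>34 \<le> 17 * k\<close>, so the
        exponent is at most \<open>29 * k ^ 2\<close>.\<close>
      have "k * (12 * k + 34) \<le> k * (12 * k + 17 * k)" using k by (intro mult_left_mono) auto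
      then show "k * (12 * k + 34) \<le> 160 * k ^ 2" by (simp add: power2_eq_square algebra_simps)
    qed (use b in simp)
    finally show ?thesis .
  qed
  then have "2 * n * c + N \<in> power_sums k S (b ^ (160 * k ^ 2))" for N
    by (rule power_sums_mono[OF all])
  then have "\<forall>x\<ge>2 * n * c. x \<in> power_sums k S (b ^ (160 * k ^ 2))"
    by (metis le_add_diff_inverse)
  then show ?thesis unfolding S_def by blast
qed

theorem theorem1p1:
  fixes k b d1 d2 :: nat
  assumes "k \<ge> 2" and "b \<ge> 3"
    and "d1 \<in> {0..b - 1}" and "d2 \<in> {0..b - 1}"
    and "d1 \<noteq> d2" and "coprime d1 d2"
  shows "\<exists>N. \<forall>n\<ge>N. \<exists>xs :: nat list.
           length xs \<le> b ^ (160 * k ^ 2) \<and>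
           set xs \<subseteq> restricted_digits b {d1, d2} \<and>
           n = (\<Sum>x\<leftarrow>xs. x ^ k)"
proof -
  have less: "d1 < b" "d2 < b" using assms(2-4) by auto
  have "\<exists>N. \<forall>n\<ge>N. n \<in> power_sums k (restricted_digits b {d1, d2}) (b ^ (160 * k ^ 2))"
  proof (cases "d1 < d2")
    case True
    then show ?thesis using waring_restricted_digits_ordered assms(1,2,6) less by blast
  next
    case False
    then have "d2 < d1" using assms(5) by simp
    moreover have "coprime d2 d1" using assms(6) by (simp add: coprime_commute)
    ultimately show ?thesis
      using waring_restricted_digits_ordered[of k b d2 d1] assms(1,2) less by (simp add: insert_commute)
  qed
  then show ?thesis unfolding power_sums_def mem_Collect_eq .
qed

end
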